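(* In the setting of random lattice potentials (see context), for $\beta$-a.e. $\omega\in\Omega$ the energy velocity distribution $$\nu_\omega:=\lim_{n\to\infty}\Gamma_\omega(\lambda_n)$$ exists in the sense of vague convergence of measures on $\mathbb R\times\mathbb R^d$ and is independent of $\omega$ (i.e. there is a non-random measure $\hat\nu$ on $\mathbb R^{d+1}$ with $\nu_\omega=\hat\nu$ for $\beta$-a.e. $\omega$).
   Context: Let $\mathcal L\subseteq\mathbb R^d$ be a lattice with basis $\ell_1,\dots,\ell_d$. $J$ is a finite set, $|J|\ge2$; $\eta\in\mathbb N\cup\{\infty\}$, $\eta\ge2$; the single site potentials $W_j\in C^\eta(\mathbb R^d,\mathbb R)$, $j\in J$, satisfy, for some $\varepsilon>0$ and constants $C_\alpha>0$, $|\partial^\alpha W_j(q)|\le C_\alpha(1+\|q\|^2)^{-(d+\varepsilon)/2}$ for all $q\in\mathbb R^d$ and multi-indices $|\alpha|\le\eta$. $\Omega=J^{\mathcal L}$ with product topology; $\beta$ is a Borel probability measure on $\Omega$ invariant and ergodic under the shifts $\vartheta_\ell(\omega)(\ell')=\omega(\ell'+\ell)$, $\ell\in\mathcal L$. $V_\omega(q)=V(\omega,q)=\sum_{\ell\in\mathcal L}W_{\omega(\ell)}(q-\ell)$, $H_\omega(p,q)=\frac12\|p\|^2+V_\omega(q)$ on $\mathbb R^d_p\times\mathbb R^d_q$, with complete Hamiltonian flow $\Phi_\omega^t(x_0)=(p_\omega(t,x_0),q_\omega(t,x_0))$. Asymptotic velocities: $\bar v^\pm_\omega(x_0)=\lim_{T\to\pm\infty}q_\omega(T,x_0)/T$;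 $\bar v_\omega(x_0)$ is their common value if both limits exist and coincide, and $\bar v_\omega(x_0):=0$ otherwise. $\Gamma_\omega=(H_\omega,\bar v_\omega)\colon\mathbb R^d_p\times\mathbb R^d_q\to\mathbb R\times\mathbb R^d$. For $n\in\mathbb N$, $Q_n=\{\sum_{k=1}^d x_k\ell_k\mid -n\le x_k<n\}$ and $\lambda_n=\frac1{\lambda^d(Q_n)}\lambda^{2d}\restriction_{\mathbb R^d_p\times Q_n}$, where $\lambda^m$ is Lebesgue measure on $\mathbb R^m$. $\Gamma_\omega(\lambda_n)$ is the image measure. *)

theory Defs
  imports "HOL-Probability.Probability" "HOL-Library.Extended_Nat"
begin

section \<open>Partial derivatives and functions of class \<open>C\<^sup>\<eta>\<close>\<close>

definition partial_deriv :: "'n::finite \<Rightarrow> (real^'n \<Rightarrow> real) \<Rightarrow> real^'n \<Rightarrow> real" where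
  "partial_deriv i f x = deriv (\<lambda>t. f (x + t *\<^sub>R axis i 1)) 0"

definition has_partial :: "'n::finite \<Rightarrow> (real^'n \<Rightarrow> real) \<Rightarrow> real^'n \<Rightarrow> bool" where
  "has_partial i f x \<longleftrightarrow> (\<lambda>t. f (x + t *\<^sub>R axis i 1)) differentiable (at 0)"

definition iter_partial :: "'n::finite list \<Rightarrow> (real^'n \<Rightarrow> real) \<Rightarrow> real^'n \<Rightarrow> real" where
  "iter_partial is f = foldr partial_deriv is f"

definition C_diff :: "enat \<Rightarrow> (real^'n::finite \<Rightarrow> real) \<Rightarrow> bool" where
  "C_diff \<eta> f \<longleftrightarrow>
     (\<forall>is. enat (length is) \<le> \<eta> \<longrightarrow> continuous_on UNIV (iter_partial is f)) \<and>
     (\<forall>i is x. enat (Suc (length is)) \<le> \<eta> \<longrightarrow> has_partial i (iter_partial is f) x)"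

definition mi_order :: "('n::finite \<Rightarrow> nat) \<Rightarrow> nat" where
  "mi_order \<alpha> = (\<Sum>i\<in>UNIV. \<alpha> i)"

(* The derivative for the multi-index \<alpha>: differentiate \<alpha> i times in direction i.  The index
   type carries no order, so an arbitrary order of differentiation is chosen; by Schwarz's
   theorem the choice is immaterial for functions of class C^k with k at least mi_order \<alpha>. *)
definition mi_partial :: "('n::finite \<Rightarrow> nat) \<Rightarrow> (real^'n \<Rightarrow> real) \<Rightarrow> real^'n \<Rightarrow> real" where
  "mi_partial \<alpha> f = iter_partial (SOME is. \<forall>i. count_list is i = \<alpha> i) f"

definition grad :: "(real^'n::finite \<Rightarrow> real) \<Rightarrow> real^'n \<Rightarrow> real^'n" where
  "grad f x = (\<chi> i. partial_deriv i f x)"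

section \<open>Lattices and lattice configurations\<close>

definition is_lattice_basis :: "('n::finite \<Rightarrow> real^'n) \<Rightarrow> bool" where
  "is_lattice_basis b \<longleftrightarrow> inj b \<and> independent (range b)"

definition lattice_of :: "('n::finite \<Rightarrow> real^'n) \<Rightarrow> (real^'n) set" where
  "lattice_of b = {\<Sum>i\<in>UNIV. real_of_int (k i) *\<^sub>R b i | k. True}"

(* The space J^L with the product of the discrete topologies; configurations are extensional,
   i.e. take the value undefined off the lattice. *)
definition config_topology :: "('n::finite \<Rightarrow> real^'n) \<Rightarrow> 'j set \<Rightarrow> (real^'n \<Rightarrow> 'j) topology" where
  "config_topology b J = product_topology (\<lambda>_. discrete_topology J) (lattice_of b)"

definition config_borel :: "('n::finite \<Rightarrow> real^'n) \<Rightarrow> 'j set \<Rightarrow> (real^'n \<Rightarrow> 'j) measure" where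
  "config_borel b J = sigma (topspace (config_topology b J)) {U. openin (config_topology b J) U}"

definition shift ::
  "('n::finite \<Rightarrow> real^'n) \<Rightarrow> real^'n \<Rightarrow> (real^'n \<Rightarrow> 'j) \<Rightarrow> (real^'n \<Rightarrow> 'j)" where
  "shift b l \<omega> = (\<lambda>l'\<in>lattice_of b. \<omega> (l' + l))"

definition shift_invariant ::
  "('n::finite \<Rightarrow> real^'n) \<Rightarrow> (real^'n \<Rightarrow> 'j) measure \<Rightarrow> bool" where
  "shift_invariant b \<beta> \<longleftrightarrow>
     (\<forall>l\<in>lattice_of b. \<forall>A\<in>sets \<beta>. emeasure \<beta> (shift b l -` A \<inter> space \<beta>) = emeasure \<beta> A)"

definition shift_ergodic ::
  "('n::finite \<Rightarrow> real^'n) \<Rightarrow> (real^'n \<Rightarrow> 'j) measure \<Rightarrow> bool" where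
  "shift_ergodic b \<beta> \<longleftrightarrow>
     (\<forall>A\<in>sets \<beta>. (\<forall>l\<in>lattice_of b. shift b l -` A \<inter> space \<beta> = A) \<longrightarrow>
        emeasure \<beta> A = 0 \<or> emeasure \<beta> A = 1)"

section \<open>Random potential, Hamiltonian flow, asymptotic velocity\<close>

definition potential ::
  "('n::finite \<Rightarrow> real^'n) \<Rightarrow> ('j \<Rightarrow> real^'n \<Rightarrow> real) \<Rightarrow> (real^'n \<Rightarrow> 'j) \<Rightarrow> real^'n \<Rightarrow> real" where
  "potential b W \<omega> q = (\<Sum>\<^sub>\<infinity>l\<in>lattice_of b. W (\<omega> l) (q - l))"

text \<open>Phase space points are written \<open>(p, q)\<close>, momentum first.\<close>

definition hamiltonian ::
  "('n::finite \<Rightarrow> real^'n) \<Rightarrow> ('j \<Rightarrow> real^'n \<Rightarrow> real) \<Rightarrow> (real^'n \<Rightarrow> 'j) \<Rightarrow>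
   (real^'n) \<times> (real^'n) \<Rightarrow> real" where
  "hamiltonian b W \<omega> = (\<lambda>(p, q). (norm p)\<^sup>2 / 2 + potential b W \<omega> q)"

definition hamiltonian_field ::
  "((real^'n::finite) \<times> (real^'n) \<Rightarrow> real) \<Rightarrow> (real^'n) \<times> (real^'n) \<Rightarrow> (real^'n) \<times> (real^'n)" where
  "hamiltonian_field H = (\<lambda>(p, q). (- grad (\<lambda>q'. H (p, q')) q, grad (\<lambda>p'. H (p', q)) p))"

definition hamiltonian_trajectory ::
  "((real^'n::finite) \<times> (real^'n) \<Rightarrow> real) \<Rightarrow> (real^'n) \<times> (real^'n) \<Rightarrow>
   (real \<Rightarrow> (real^'n) \<times> (real^'n)) \<Rightarrow> bool" where
  "hamiltonian_trajectory H x \<phi> \<longleftrightarrow>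
     \<phi> 0 = x \<and> (\<forall>t. (\<phi> has_vector_derivative hamiltonian_field H (\<phi> t)) (at t))"

(* Meaningful when H has a complete flow, i.e. exactly one global trajectory through each x;
   this is the case for the Hamiltonians considered here, whose Hamiltonian vector field is
   globally Lipschitz. *)
definition hamiltonian_flow ::
  "((real^'n::finite) \<times> (real^'n) \<Rightarrow> real) \<Rightarrow> real \<Rightarrow> (real^'n) \<times> (real^'n) \<Rightarrow> (real^'n) \<times> (real^'n)" where
  "hamiltonian_flow H t x = (THE \<phi>. hamiltonian_trajectory H x \<phi>) t"

definition mean_velocity ::
  "((real^'n::finite) \<times> (real^'n) \<Rightarrow> real) \<Rightarrow> (real^'n) \<times> (real^'n) \<Rightarrow> real \<Rightarrow> real^'n" where
  "mean_velocity H x T = (1 / T) *\<^sub>R snd (hamiltonian_flow H T x)"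

definition asymptotic_velocity ::
  "((real^'n::finite) \<times> (real^'n) \<Rightarrow> real) \<Rightarrow> (real^'n) \<times> (real^'n) \<Rightarrow> real^'n" where
  "asymptotic_velocity H x =
     (if \<exists>v. (mean_velocity H x \<longlongrightarrow> v) at_top \<and> (mean_velocity H x \<longlongrightarrow> v) at_bot
      then Lim at_top (mean_velocity H x) else 0)"

definition energy_velocity ::
  "((real^'n::finite) \<times> (real^'n) \<Rightarrow> real) \<Rightarrow> (real^'n) \<times> (real^'n) \<Rightarrow> real \<times> (real^'n)" where
  "energy_velocity H x = (H x, asymptotic_velocity H x)"

section \<open>Normalised phase space volume and vague convergence\<close>

definition box_of :: "('n::finite \<Rightarrow> real^'n) \<Rightarrow> nat \<Rightarrow> (real^'n) set" where
  "box_of b n = {\<Sum>i\<in>UNIV. x i *\<^sub>R b i | x. \<forall>i. - real n \<le> x i \<and> x i < real n}"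

definition box_measure :: "('n::finite \<Rightarrow> real^'n) \<Rightarrow> nat \<Rightarrow> ((real^'n) \<times> (real^'n)) measure" where
  "box_measure b n =
     scale_measure (1 / emeasure lborel (box_of b n))
       (restrict_space lborel (UNIV \<times> box_of b n))"

definition locally_finite_borel :: "'a::topological_space measure \<Rightarrow> bool" where
  "locally_finite_borel M \<longleftrightarrow> sets M = sets borel \<and> (\<forall>K. compact K \<longrightarrow> emeasure M K < \<infinity>)"

definition vague_limit ::
  "(nat \<Rightarrow> 'a::topological_space measure) \<Rightarrow> 'a measure \<Rightarrow> bool" where
  "vague_limit \<mu> \<nu> \<longleftrightarrow>
     (\<forall>n. locally_finite_borel (\<mu> n)) \<and> locally_finite_borel \<nu> \<and>
     (\<forall>f :: 'a \<Rightarrow> real. continuous_on UNIV f \<and> compact (closure {x. f x \<noteq> 0}) \<longrightarrow>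
        (\<lambda>n. integral\<^sup>L (\<mu> n) f) \<longlonglongrightarrow> integral\<^sup>L \<nu> f)"

end

theory Submission
  imports Defs
begin

text \<open>A momentum ball controls every bounded energy window because the potential is bounded, so for a
  bounded Borel set \<open>A\<close> the phase space volume of \<open>{x. \<Gamma>\<^sub>\<omega> x \<in> A}\<close> over one fundamental cell is a
  bounded measurable function of \<open>\<omega>\<close>.  Translating the configuration translates the flow and leaves
  asymptotic velocities unchanged, so \<open>\<Gamma>\<^sub>\<omega>(\<lambda>\<^sub>n)(A)\<close> is exactly the average of this function over a box
  of lattice translations and converges almost surely to its expectation by the multidimensional
  ergodic theorem.  Applying this to the countably many cells of rational grids gives vague convergence.

  The ergodic theorem along boxes is reduced to the one-dimensional one, direction by direction, by
  dominating the tail of the inner averages by its supremum, which is bounded and tends to zero.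
  Joint measurability of the flow in \<open>(\<omega>, x)\<close> follows from convergence of the Euler scheme.\<close>

section \<open>Pointwise ergodic theorem\<close>

text \<open>The limit is known before anything converges: \<open>limit_measure\<close> is the image
  of \<beta> times Lebesgue measure, restricted to positions in one fundamental cell and divided by
  the cell volume, under the energy velocity map of the pair (\<omega>, x). By Tonelli its value on
  a bounded Borel set is the expectation of the cell average, so the ergodic theorem identifies the
  limit as one fixed measure; joint measurability in (\<omega>, x) is what gives this construction a
  meaning. The asymptotic velocity need not depend continuously on x, hence its existence is
  expressed by countably many measurable conditions on rational times. The null set outside which
  averages converge depends on the test set, which is why vague convergence has to be reduced to
  countably many sets. Grid cells can serve although their boundaries may carry limit mass:
  convergence is obtained on each cell itself, not deduced from weak convergence. The half-open
  boxes are exact unions of translates of one half-open cell, so the passage from phase space to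
  averages has no boundary error.\<close>

definition birkhoff_sum :: "('a \<Rightarrow> real) \<Rightarrow> ('a \<Rightarrow> 'a) \<Rightarrow> nat \<Rightarrow> 'a \<Rightarrow> real" where
  "birkhoff_sum f T n x = (\<Sum>k<n. f ((T ^^ k) x))"

text \<open>The maximum of 0 and the first \<open>n\<close> Birkhoff sums, in the recursive form that makes
  Garsia's proof of the maximal inequality a pointwise estimate.\<close>

fun max_birkhoff :: "('a \<Rightarrow> real) \<Rightarrow> ('a \<Rightarrow> 'a) \<Rightarrow> nat \<Rightarrow> 'a \<Rightarrow> real" where
  "max_birkhoff f T 0 x = 0"
| "max_birkhoff f T (Suc n) x = max 0 (f x + max_birkhoff f T n (T x))"

lemma birkhoff_sum_Suc: "birkhoff_sum f T (Suc n) x = f x + birkhoff_sum f T n (T x)"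
  unfolding birkhoff_sum_def by (subst sum.lessThan_Suc_shift) (simp add: funpow_swap1)

text \<open>The two sums share all but one term at each end. After division by \<open>n\<close> the
  difference is O(1/n) for bounded \<open>f\<close>, which makes the upper and lower limits of the
  averages exactly \<open>T\<close>-invariant.\<close>

lemma birkhoff_sum_shift:
  "birkhoff_sum f T n (T x) = birkhoff_sum f T n x + f ((T ^^ n) x) - f x"
  using birkhoff_sum_Suc[of f T n x] unfolding birkhoff_sum_def by simp

lemma birkhoff_sum_le_max: "birkhoff_sum f T n x \<le> max_birkhoff f T n x"
proof (induction n arbitrary: x)
  case 0 then show ?case by (simp add: birkhoff_sum_def)
next
  case (Suc n) show ?case using Suc[of "T x"] by (simp add: birkhoff_sum_Suc)
qed

lemma max_birkhoff_nonneg: "0 \<le> max_birkhoff f T n x"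
  by (cases n) auto

lemma max_birkhoff_le_Suc: "max_birkhoff f T n x \<le> max_birkhoff f T (Suc n) x"
proof (induction n arbitrary: x)
  case (Suc n) show ?case using Suc[of "T x"] by simp
qed simp

lemma funpow_measurable [measurable (raw)]:
  assumes "T \<in> measurable M M" shows "(T ^^ n) \<in> measurable M M"
proof (induction n)
  case (Suc n) show ?case using measurable_comp[OF Suc assms] by (simp add: comp_def)
qed (simp add: id_def)

lemma max_birkhoff_measurable:
  assumes [measurable]: "T \<in> measurable M M" "f \<in> borel_measurable M"
  shows "max_birkhoff f T n \<in> borel_measurable M"
proof (induction n)
  case 0 then show ?case by (simp add: measurable_cong[of M "max_birkhoff f T 0" "\<lambda>_. 0"])
next
  case (Suc n)
  note [measurable] = Suc
  have "(\<lambda>x. max 0 (f x + max_birkhoff f T n (T x))) \<in> borel_measurable M" by measurable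
  then show ?case by (simp cong: measurable_cong)
qed

lemma max_birkhoff_bounded:
  assumes "\<And>x. x \<in> space M \<Longrightarrow> \<bar>f x\<bar> \<le> B" "T \<in> measurable M M" "x \<in> space M"
  shows "\<bar>max_birkhoff f T n x\<bar> \<le> real n * B"
  using assms(3)
proof (induction n arbitrary: x)
  case (Suc n)
  have "T x \<in> space M" using Suc.prems assms(2) by (simp add: measurable_space)
  from Suc.IH[OF this] assms(1)[OF Suc.prems] show ?case by (simp add: algebra_simps)
qed simp

section \<open>Birkhoff's theorem for bounded functions on a probability space\<close>

context prob_space
begin

lemma integrable_bounded:
  assumes "f \<in> borel_measurable M" "\<And>x. x \<in> space M \<Longrightarrow> \<bar>f x\<bar> \<le> (B::real)"
  shows "integrable M f"
  by (rule integrable_const_bound[of _ B]) (use assms in \<open>auto intro!: AE_I2\<close>)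

lemma integral_measure_preserving:
  fixes f :: "'a \<Rightarrow> real"
  assumes "T \<in> measurable M M" "distr M M T = M" "f \<in> borel_measurable M"
  shows "(\<integral>x. f (T x) \<partial>M) = (\<integral>x. f x \<partial>M)"
  using integral_distr[of T M M f] assms by simp

text \<open>Write m for \<open>max_birkhoff f T (Suc n)\<close>. Where m is positive it equals
  \<open>f x + max_birkhoff f T n (T x)\<close>, and enlarging the index gives m - m o T <= f there;
  where m vanishes, m - m o T <= 0. The left side integrates to 0 because \<open>T\<close> preserves
  the measure.\<close>

lemma maximal_ergodic_inequality:
  fixes f :: "'a \<Rightarrow> real"
  assumes [measurable]: "T \<in> measurable M M" "f \<in> borel_measurable M"
    and pres: "distr M M T = M" and bd: "\<And>x. x \<in> space M \<Longrightarrow> \<bar>f x\<bar> \<le> B"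
  shows "0 \<le> (\<integral>x. f x * indicator {x. 0 < max_birkhoff f T (Suc n) x} x \<partial>M)"
proof -
  let ?m = "max_birkhoff f T (Suc n)"
  note [measurable] = max_birkhoff_measurable[OF assms(1,2)]
  have mb: "\<bar>?m x\<bar> \<le> real (Suc n) * B" if "x \<in> space M" for x
    by (rule max_birkhoff_bounded[OF bd assms(1) that])
  have i1: "integrable M ?m"
    by (rule integrable_bounded[of _ "real (Suc n) * B"]) (use mb in auto)
  have i2: "integrable M (\<lambda>x. ?m (T x))"
    by (rule integrable_bounded[of _ "real (Suc n) * B"])
      (use mb measurable_space[OF assms(1)] in \<open>auto simp del: max_birkhoff.simps\<close>)
  have i3: "integrable M (\<lambda>x. f x * indicator {x. 0 < ?m x} x)"
    by (rule integrable_bounded[of _ B])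
      (use bd in \<open>fastforce simp del: max_birkhoff.simps simp: indicator_def\<close>)+
  have "0 = (\<integral>x. ?m x - ?m (T x) \<partial>M)"
    using integral_measure_preserving[OF assms(1) pres, of ?m] i1 i2
    by (simp del: max_birkhoff.simps)
  also have "\<dots> \<le> (\<integral>x. f x * indicator {x. 0 < ?m x} x \<partial>M)"
  proof (rule integral_mono[OF Bochner_Integration.integrable_diff[OF i1 i2] i3])
    fix x assume "x \<in> space M"
    show "?m x - ?m (T x) \<le> f x * indicator {x. 0 < ?m x} x"
    proof (cases "0 < ?m x")
      case True
      then have "?m x = f x + max_birkhoff f T n (T x)" by simp
      with max_birkhoff_le_Suc[of f T n "T x"] True show ?thesis
        by (simp del: max_birkhoff.simps)
    next
      case False
      with max_birkhoff_nonneg[of f T "Suc n" "T x"] show ?thesis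
        by (simp del: max_birkhoff.simps)
    qed
  qed
  finally show ?thesis .
qed

text \<open>The maximal inequality is applied to \<open>f\<close> cut off outside \<open>A\<close>.
  Invariance of \<open>A\<close> keeps the Birkhoff sums unchanged on \<open>A\<close> and zero
  outside, so the sets where the maximum is positive increase to \<open>A\<close>, and dominated
  convergence removes the index.\<close>

lemma integral_nonneg_of_birkhoff_sum_pos:
  fixes f :: "'a \<Rightarrow> real"
  assumes [measurable]: "T \<in> measurable M M" "f \<in> borel_measurable M" "A \<in> sets M"
    and pres: "distr M M T = M" and bd: "\<And>x. x \<in> space M \<Longrightarrow> \<bar>f x\<bar> \<le> B"
    and inv: "\<And>x. x \<in> space M \<Longrightarrow> T x \<in> A \<longleftrightarrow> x \<in> A"
    and pos: "\<And>x. x \<in> A \<Longrightarrow> \<exists>n. 0 < birkhoff_sum f T n x"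
  shows "0 \<le> (\<integral>x. f x * indicator A x \<partial>M)"
proof -
  define g where "g x = f x * indicator A x" for x
  have [measurable]: "g \<in> borel_measurable M" unfolding g_def by measurable
  have gb: "\<bar>g x\<bar> \<le> B" if "x \<in> space M" for x
    using bd[OF that] unfolding g_def by (auto simp: indicator_def)
  let ?m = "max_birkhoff g T"
  note [measurable] = max_birkhoff_measurable[OF assms(1), of g]
  have Tn: "(T ^^ k) x \<in> space M \<and> ((T ^^ k) x \<in> A \<longleftrightarrow> x \<in> A)" if "x \<in> space M" for k x
    using that by (induction k) (auto simp: measurable_space[OF assms(1)] inv)
  have off: "?m n x = 0" if "x \<in> space M" "x \<notin> A" for n x
    using that
  proof (induction n arbitrary: x)
    case (Suc n)
    have "T x \<in> space M" "T x \<notin> A" using Suc.prems inv measurable_space[OF assms(1)] by auto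
    from Suc.IH[OF this] Suc.prems show ?case by (simp add: g_def)
  qed simp
  have on: "eventually (\<lambda>n. 0 < ?m (Suc n) x) sequentially" if x: "x \<in> space M" "x \<in> A" for x
  proof -
    obtain N where N: "0 < birkhoff_sum f T N x" using pos x by blast
    have "birkhoff_sum g T N x = birkhoff_sum f T N x"
      unfolding birkhoff_sum_def g_def using Tn[OF x(1)] x(2) by simp
    with N birkhoff_sum_le_max[of g T N x] have p: "0 < ?m N x" by simp
    have "?m N x \<le> ?m (Suc n) x" if "n \<ge> N" for n
      by (rule lift_Suc_mono_le[of "\<lambda>n. ?m n x"]) (use max_birkhoff_le_Suc that in auto)
    then show ?thesis unfolding eventually_sequentially using p by (meson less_le_trans)
  qed
  have "(\<lambda>n. \<integral>x. g x * indicator {x. 0 < ?m (Suc n) x} x \<partial>M) \<longlonglongrightarrow> (\<integral>x. g x \<partial>M)"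
  proof (rule integral_dominated_convergence[where w="\<lambda>_. B"])
    show "AE x in M. (\<lambda>n. g x * indicator {x. 0 < ?m (Suc n) x} x) \<longlonglongrightarrow> g x"
    proof (rule AE_I2)
      fix x assume x: "x \<in> space M"
      show "(\<lambda>n. g x * indicator {x. 0 < ?m (Suc n) x} x) \<longlonglongrightarrow> g x"
      proof (cases "x \<in> A")
        case True
        show ?thesis
          by (rule tendsto_eventually, rule eventually_mono[OF on[OF x True]]) simp
      next
        case False
        then show ?thesis by (simp add: g_def)
      qed
    qed
    show "AE x in M. norm (g x * indicator {x. 0 < ?m (Suc n) x} x) \<le> B" for n
      by (rule AE_I2) (use gb in \<open>fastforce simp del: max_birkhoff.simps simp: indicator_def\<close>)
  qed (simp_all del: max_birkhoff.simps)
  then show ?thesis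
    unfolding g_def[symmetric]
    by (rule LIMSEQ_le_const)
      (use maximal_ergodic_inequality[OF assms(1) \<open>g \<in> _\<close> pres gb] in blast)
qed

text \<open>On the invariant set \<open>A\<close> where the lower limit is below \<open>a\<close>
  and the upper limit above \<open>b\<close>, the previous lemma applies to \<open>f - b\<close> and
  to \<open>a - f\<close>. Adding the two integrals gives 0 <= (a - b) P(A), which forces P(A) = 0
  when a < b.\<close>

lemma birkhoff_convergent:
  fixes f :: "'a \<Rightarrow> real"
  assumes [measurable]: "T \<in> measurable M M" "f \<in> borel_measurable M"
    and pres: "distr M M T = M" and bd: "\<And>x. x \<in> space M \<Longrightarrow> \<bar>f x\<bar> \<le> B"
  shows "AE x in M. convergent (\<lambda>n. birkhoff_sum f T n x / real n)"
proof -
  define u where "u n x = birkhoff_sum f T n x / real n" for n x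
  define up where "up x = limsup (\<lambda>n. ereal (u n x))" for x
  define lo where "lo x = liminf (\<lambda>n. ereal (u n x))" for x
  have [measurable]: "u n \<in> borel_measurable M" for n
    unfolding u_def birkhoff_sum_def by measurable
  have [measurable]: "up \<in> borel_measurable M" "lo \<in> borel_measurable M"
    unfolding up_def lo_def by measurable
  have Tn: "(T ^^ k) x \<in> space M" if "x \<in> space M" for k x
    using that by (induction k) (auto simp: measurable_space[OF assms(1)])
  have B0: "0 \<le> B" using bd not_empty by fastforce
  have ub: "\<bar>u n x\<bar> \<le> B" if "x \<in> space M" for n x
  proof -
    have "\<bar>birkhoff_sum f T n x\<bar> \<le> (\<Sum>k<n. B)"
      unfolding birkhoff_sum_def by (rule order_trans[OF sum_abs sum_mono]) (use bd Tn that in auto)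
    then show ?thesis using B0 by (cases "n = 0") (auto simp: u_def field_simps)
  qed
  have diff: "(\<lambda>n. u n (T x) - u n x) \<longlonglongrightarrow> 0" if x: "x \<in> space M" for x
  proof (rule Lim_null_comparison[where g="\<lambda>n. 2 * B / real n"])
    have "\<bar>u n (T x) - u n x\<bar> \<le> 2 * B / real n" for n
    proof -
      have "u n (T x) - u n x = (f ((T ^^ n) x) - f x) / real n"
        unfolding u_def birkhoff_sum_shift by (simp add: diff_divide_distrib add_divide_distrib)
      moreover have "\<bar>f ((T ^^ n) x) - f x\<bar> \<le> 2 * B"
        using bd[OF x] bd[OF Tn[OF x, of n]] by linarith
      ultimately show ?thesis by (simp add: divide_right_mono)
    qed
    then show "\<forall>\<^sub>F n in sequentially. norm (u n (T x) - u n x) \<le> 2 * B / real n" by simp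
  qed (rule lim_const_over_n)
  have upT: "up (T x) = up x" and loT: "lo (T x) = lo x" if x: "x \<in> space M" for x
  proof -
    have d: "(\<lambda>n. ereal (u n (T x) - u n x)) \<longlonglongrightarrow> ereal 0" using diff[OF x] by simp
    show "up (T x) = up x" "lo (T x) = lo x"
      using ereal_limsup_lim_add[OF d, of "\<lambda>n. ereal (u n x)"]
        ereal_liminf_lim_add[OF d, of "\<lambda>n. ereal (u n x)"]
      by (simp_all add: up_def lo_def zero_ereal_def[symmetric])
  qed
  have null: "AE x in M. \<not> (lo x < ereal a \<and> ereal b < up x)" if "a < b" for a b
  proof -
    define A where "A = {x \<in> space M. lo x < ereal a \<and> ereal b < up x}"
    have Am [measurable]: "A \<in> sets M" unfolding A_def by measurable
    have inv: "T x \<in> A \<longleftrightarrow> x \<in> A" if "x \<in> space M" for x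
      using that upT loT measurable_space[OF assms(1)] by (auto simp: A_def)
    have "0 \<le> (\<integral>x. (f x - b) * indicator A x \<partial>M)"
    proof (rule integral_nonneg_of_birkhoff_sum_pos[OF assms(1) _ Am pres _ inv])
      show "\<bar>f x - b\<bar> \<le> B + \<bar>b\<bar>" if "x \<in> space M" for x using bd[OF that] by linarith
      fix x assume "x \<in> A"
      then have "ereal b < limsup (\<lambda>n. ereal (u n x))" by (simp add: A_def up_def)
      then have "\<exists>\<^sub>F n in sequentially. ereal b < ereal (u n x)"
        by (rule contrapos_pp)
          (auto simp: not_frequently not_less intro!: Limsup_bounded)
      then have "\<forall>N. \<exists>n\<ge>N. b < u n x" by (simp add: frequently_sequentially)
      \<comment> \<open>Asking for \<open>n\<close> beyond 1 excludes the index 0, where the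
        quotient is 0 by the convention on division.\<close>
      from spec[OF this, of 1] obtain n where n: "n \<ge> 1" "b < u n x" by blast
      have "birkhoff_sum (\<lambda>x. f x - b) T n x = birkhoff_sum f T n x - real n * b"
        by (simp add: birkhoff_sum_def sum_subtractf)
      with n show "\<exists>n. 0 < birkhoff_sum (\<lambda>x. f x - b) T n x"
        by (intro exI[of _ n]) (simp add: u_def field_simps)
    qed simp
    moreover have "0 \<le> (\<integral>x. (a - f x) * indicator A x \<partial>M)"
    proof (rule integral_nonneg_of_birkhoff_sum_pos[OF assms(1) _ Am pres _ inv])
      show "\<bar>a - f x\<bar> \<le> B + \<bar>a\<bar>" if "x \<in> space M" for x using bd[OF that] by linarith
      fix x assume "x \<in> A"
      then have "liminf (\<lambda>n. ereal (u n x)) < ereal a" by (simp add: A_def lo_def)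
      then have "\<exists>\<^sub>F n in sequentially. ereal (u n x) < ereal a"
        by (rule contrapos_pp)
          (auto simp: not_frequently not_less intro!: Liminf_bounded)
      then have "\<forall>N. \<exists>n\<ge>N. u n x < a" by (simp add: frequently_sequentially)
      from spec[OF this, of 1] obtain n where n: "n \<ge> 1" "u n x < a" by blast
      have "birkhoff_sum (\<lambda>x. a - f x) T n x = real n * a - birkhoff_sum f T n x"
        by (simp add: birkhoff_sum_def sum_subtractf)
      with n show "\<exists>n. 0 < birkhoff_sum (\<lambda>x. a - f x) T n x"
        by (intro exI[of _ n]) (simp add: u_def field_simps)
    qed simp
    moreover have "(\<integral>x. (f x - b) * indicator A x \<partial>M) + (\<integral>x. (a - f x) * indicator A x \<partial>M)
        = (a - b) * prob A"
    proof -
      have "integrable M (\<lambda>x. (f x - b) * indicator A x)"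
        by (rule integrable_bounded[of _ "B + \<bar>b\<bar>"])
          (use bd in \<open>fastforce simp: indicator_def\<close>)+
      moreover have "integrable M (\<lambda>x. (a - f x) * indicator A x)"
        by (rule integrable_bounded[of _ "B + \<bar>a\<bar>"])
          (use bd in \<open>fastforce simp: indicator_def\<close>)+
      ultimately have "(\<integral>x. (f x - b) * indicator A x \<partial>M) + (\<integral>x. (a - f x) * indicator A x \<partial>M)
        = (\<integral>x. (f x - b) * indicator A x + (a - f x) * indicator A x \<partial>M)" by simp
      also have "\<dots> = (\<integral>x. (a - b) * indicator A x \<partial>M)"
        by (rule Bochner_Integration.integral_cong) (auto simp: algebra_simps)
      also have "\<dots> = (a - b) * prob A" by simp
      finally show ?thesis .
    qed
    ultimately have "0 \<le> (a - b) * prob A" by linarith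
    with \<open>a < b\<close> have "prob A = 0"
      by (simp add: zero_le_mult_iff measure_le_0_iff)
    then have "AE x in M. x \<notin> A" using Am by (simp add: prob_eq_0)
    then show ?thesis by (rule AE_mp) (auto simp: A_def)
  qed
  \<comment> \<open>Rational pairs separate any two distinct extended reals and leave only countably
    many null sets.\<close>
  have "AE x in M. \<forall>r\<in>(UNIV :: (rat \<times> rat) set). fst r < snd r \<longrightarrow>
      \<not> (lo x < ereal (real_of_rat (fst r)) \<and> ereal (real_of_rat (snd r)) < up x)"
    by (subst AE_ball_countable, simp, intro ballI AE_impI null) (simp add: of_rat_less)
  then show ?thesis
  proof (rule AE_mp, intro AE_I2 impI)
    fix x assume x: "x \<in> space M" and H: "\<forall>r\<in>(UNIV :: (rat \<times> rat) set). fst r < snd r \<longrightarrow>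
      \<not> (lo x < ereal (real_of_rat (fst r)) \<and> ereal (real_of_rat (snd r)) < up x)"
    have le: "lo x \<le> up x" unfolding lo_def up_def by (rule Liminf_le_Limsup) simp
    have "\<not> lo x < up x"
    proof
      assume "lo x < up x"
      then obtain r where r: "lo x < ereal (real_of_rat r)" "ereal (real_of_rat r) < up x"
        using ereal_dense3 by blast
      then obtain s where s: "ereal (real_of_rat r) < ereal (real_of_rat s)" "ereal (real_of_rat s) < up x"
        using ereal_dense3 by blast
      with H[rule_format, of "(r, s)"] r show False by (simp add: of_rat_less)
    qed
    with le have eq: "lo x = up x" by simp
    \<comment> \<open>Boundedness of \<open>f\<close> keeps the common value of the two limits
      finite, so convergence takes place in the reals.\<close>
    have "up x \<le> ereal B" unfolding up_def
      by (rule Limsup_bounded) (use ub[OF x] in \<open>auto simp: abs_le_iff\<close>)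
    moreover have "ereal (- B) \<le> lo x" unfolding lo_def
      by (rule Liminf_bounded) (use ub[OF x] in \<open>auto simp: abs_le_iff minus_le_iff simp del: uminus_ereal.simps\<close>)
    ultimately obtain l where l: "up x = ereal l" using eq by (cases "up x") auto
    have "(\<lambda>n. ereal (u n x)) \<longlonglongrightarrow> ereal l"
      by (subst tendsto_iff_Liminf_eq_Limsup) (use eq l in \<open>simp_all add: up_def lo_def\<close>)
    then have "(\<lambda>n. u n x) \<longlonglongrightarrow> l" by simp
    then show "convergent (\<lambda>n. birkhoff_sum f T n x / real n)"
      unfolding u_def convergent_def by blast
  qed
qed

end

section \<open>Box averages of actions of integer lattices\<close>

text \<open>Coordinates outside \<open>S\<close> are frozen at 0, so lower-dimensional boxes live in
  the same group and an induction on \<open>S\<close> can add one coordinate at a time. The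
  half-open range gives exactly 2 n values per coordinate and matches the shape of
  \<open>box_of\<close>.\<close>

definition index_box :: "'i::finite set \<Rightarrow> nat \<Rightarrow> (int^'i) set" where
  "index_box S n = {k. (\<forall>i\<in>S. - int n \<le> k $ i \<and> k $ i < int n) \<and> (\<forall>i. i \<notin> S \<longrightarrow> k $ i = 0)}"

lemma axis_zero [simp]: "axis i (0::int) = 0"
  by (simp add: vec_eq_iff axis_def)

lemma axis_add: "axis i (j::int) + axis i k = axis i (j + k)"
  by (simp add: vec_eq_iff axis_def)

lemma index_box_insert:
  assumes "i \<notin> S"
  shows "bij_betw (\<lambda>(j, k). k + axis i j) ({- int n..<int n} \<times> index_box S n) (index_box (insert i S) n)"
proof (rule bij_betw_byWitness[where f'="\<lambda>k. (k $ i, k - axis i (k $ i))"])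
  show "\<forall>a\<in>{- int n..<int n} \<times> index_box S n.
      (\<lambda>k. (k $ i, k - axis i (k $ i))) ((\<lambda>(j, k). k + axis i j) a) = a"
    using assms by (auto simp: index_box_def vec_eq_iff axis_def)
  show "\<forall>k\<in>index_box (insert i S) n.
      (\<lambda>(j, k). k + axis i j) (k $ i, k - axis i (k $ i)) = k"
    by simp
  show "(\<lambda>(j, k). k + axis i j) ` ({- int n..<int n} \<times> index_box S n) \<subseteq> index_box (insert i S) n"
  proof (intro image_subsetI, unfold mem_Times_iff)
    fix a assume "fst a \<in> {- int n..<int n} \<and> snd a \<in> index_box S n"
    with assms show "(case a of (j, k) \<Rightarrow> k + axis i j) \<in> index_box (insert i S) n"
      unfolding index_box_def case_prod_beta by (auto simp: axis_def)
  qed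
  show "(\<lambda>k. (k $ i, k - axis i (k $ i))) ` index_box (insert i S) n
      \<subseteq> {- int n..<int n} \<times> index_box S n"
    unfolding index_box_def by (intro image_subsetI) (use assms in \<open>auto simp: axis_def\<close>)
qed

lemma finite_index_box [simp]: "finite (index_box S n)"
proof (induction S rule: finite_induct[OF finite])
  case 1
  have "index_box {} n \<subseteq> {0}" by (auto simp: index_box_def vec_eq_iff)
  then show ?case using finite_subset by blast
next
  case (2 i S)
  then show ?case using bij_betw_finite[OF index_box_insert[of i S n]] by simp
qed

lemma card_index_box:
  fixes S :: "'i::finite set"
  shows "card (index_box S n) = (2 * n) ^ card S"
proof (induction S rule: finite_induct[OF finite])
  case 1
  have "index_box ({} :: 'i set) n = {0}" by (auto simp: index_box_def vec_eq_iff)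
  then show ?case by simp
next
  case (2 i S)
  have "card (index_box (insert i S) n) = card ({- int n..<int n} \<times> index_box S n)"
    using bij_betw_same_card[OF index_box_insert[OF 2(2)]] by simp
  also have "\<dots> = 2 * n * card (index_box S n)" by (simp add: card_cartesian_product nat_mult_distrib)
  finally show ?case using 2 by simp
qed

text \<open>The action laws are required only on \<open>space M\<close>: a shift restricts its
  result to the lattice, hence translation by 0 fixes only extensional configurations.\<close>

locale measure_preserving_action = prob_space M for M :: "'a measure" +
  fixes \<tau> :: "int^'i::finite \<Rightarrow> 'a \<Rightarrow> 'a"
  assumes act_measurable: "\<tau> k \<in> measurable M M"
    and act_distr: "distr M M (\<tau> k) = M"
    and act_zero: "x \<in> space M \<Longrightarrow> \<tau> 0 x = x"
    and act_add: "x \<in> space M \<Longrightarrow> \<tau> (k + l) x = \<tau> k (\<tau> l x)"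
begin

declare act_measurable [measurable]

lemma act_space [simp]: "x \<in> space M \<Longrightarrow> \<tau> k x \<in> space M"
  by (rule measurable_space[OF act_measurable])

definition axis_avg :: "'i \<Rightarrow> nat \<Rightarrow> ('a \<Rightarrow> real) \<Rightarrow> 'a \<Rightarrow> real" where
  "axis_avg i n f x = (\<Sum>j\<in>{- int n..<int n}. f (\<tau> (axis i j) x)) / (2 * real n)"

definition box_avg :: "'i set \<Rightarrow> nat \<Rightarrow> ('a \<Rightarrow> real) \<Rightarrow> 'a \<Rightarrow> real" where
  "box_avg S n f x = (\<Sum>k\<in>index_box S n. f (\<tau> k x)) / (2 * real n) ^ card S"

text \<open>Both layers carry the same \<open>n\<close>, so the iterated average is not an iterated
  limit; \<open>box_avg_convergent\<close> has to compare the moving inner average with its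
  limit.\<close>

lemma box_avg_insert:
  assumes "i \<notin> S" "x \<in> space M"
  shows "box_avg (insert i S) n f x = axis_avg i n (box_avg S n f) x"
proof -
  have "(\<Sum>k\<in>index_box (insert i S) n. f (\<tau> k x))
      = (\<Sum>(j, k)\<in>{- int n..<int n} \<times> index_box S n. f (\<tau> (k + axis i j) x))"
    by (subst sum.reindex_bij_betw[OF index_box_insert[OF assms(1)], symmetric])
      (simp add: case_prod_beta)
  also have "\<dots> = (\<Sum>j\<in>{- int n..<int n}. \<Sum>k\<in>index_box S n. f (\<tau> k (\<tau> (axis i j) x)))"
    by (simp add: sum.cartesian_product act_add[OF assms(2)])
  finally show ?thesis using assms(1)
    by (simp add: box_avg_def axis_avg_def sum_divide_distrib[symmetric] field_simps)
qed

lemma axis_avg_measurable [measurable]: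
  assumes [measurable]: "f \<in> borel_measurable M"
  shows "axis_avg i n f \<in> borel_measurable M"
  unfolding axis_avg_def by measurable

lemma box_avg_measurable [measurable]:
  assumes [measurable]: "f \<in> borel_measurable M"
  shows "box_avg S n f \<in> borel_measurable M"
  unfolding box_avg_def by measurable

lemma axis_avg_mono:
  assumes "\<And>y. y \<in> space M \<Longrightarrow> f y \<le> g y" "x \<in> space M"
  shows "axis_avg i n f x \<le> axis_avg i n g x"
  unfolding axis_avg_def by (intro divide_right_mono sum_mono) (use assms in auto)

lemma axis_avg_const_le: "0 \<le> B \<Longrightarrow> axis_avg i n (\<lambda>_. B) x \<le> B"
  by (cases "n = 0") (auto simp: axis_avg_def)

lemma axis_avg_diff: "axis_avg i n (\<lambda>y. f y - g y) x = axis_avg i n f x - axis_avg i n g x"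
  by (simp add: axis_avg_def sum_subtractf diff_divide_distrib)

lemma axis_avg_abs: "\<bar>axis_avg i n f x\<bar> \<le> axis_avg i n (\<lambda>y. \<bar>f y\<bar>) x"
  unfolding axis_avg_def by (simp add: divide_right_mono sum_abs)

lemma abs_diff_bound: "\<bar>y\<bar> \<le> B \<Longrightarrow> \<bar>z\<bar> \<le> B \<Longrightarrow> \<bar>y - z\<bar> \<le> 2 * (B::real)"
  by linarith

lemma nonneg_bound: "(\<And>x. x \<in> space M \<Longrightarrow> \<bar>f x\<bar> \<le> B) \<Longrightarrow> 0 \<le> (B::real)"
proof -
  assume bd: "\<And>x. x \<in> space M \<Longrightarrow> \<bar>f x\<bar> \<le> B"
  obtain x where "x \<in> space M" using not_empty by blast
  from order_trans[OF abs_ge_zero bd[OF this]] show "0 \<le> B" .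
qed

lemma axis_avg_bounded:
  assumes "\<And>x. x \<in> space M \<Longrightarrow> \<bar>f x\<bar> \<le> B" "x \<in> space M"
  shows "\<bar>axis_avg i n f x\<bar> \<le> B"
proof -
  have "\<bar>axis_avg i n f x\<bar> \<le> axis_avg i n (\<lambda>y. \<bar>f y\<bar>) x" by (rule axis_avg_abs)
  also have "\<dots> \<le> axis_avg i n (\<lambda>_. B) x" by (rule axis_avg_mono) (use assms in auto)
  also have "\<dots> \<le> B" by (rule axis_avg_const_le[OF nonneg_bound[OF assms(1)]])
  finally show ?thesis .
qed

lemma box_avg_empty [simp]: "x \<in> space M \<Longrightarrow> box_avg {} n f x = f x"
proof -
  have "index_box ({} :: 'i set) n = {0}" by (auto simp: index_box_def vec_eq_iff)
  then show "x \<in> space M \<Longrightarrow> box_avg {} n f x = f x" by (simp add: box_avg_def act_zero)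
qed

lemma box_avg_bounded:
  assumes "\<And>x. x \<in> space M \<Longrightarrow> \<bar>f x\<bar> \<le> B" "x \<in> space M"
  shows "\<bar>box_avg S n f x\<bar> \<le> B"
  using assms(2)
proof (induction S arbitrary: x rule: finite_induct[OF finite])
  case 1 then show ?case using assms(1) by simp
next
  case (2 i S) then show ?case using axis_avg_bounded[of "box_avg S n f" B x i n]
    by (simp add: box_avg_insert)
qed

text \<open>A two-sided average is half the sum of a forward and a backward one-sided average, each
  covered by Birkhoff's theorem for one generator.\<close>

lemma axis_avg_convergent:
  assumes [measurable]: "f \<in> borel_measurable M" and bd: "\<And>x. x \<in> space M \<Longrightarrow> \<bar>f x\<bar> \<le> B"
  shows "AE x in M. convergent (\<lambda>n. axis_avg i n f x)"
proof -
  let ?T = "\<tau> (axis i 1)" and ?T' = "\<tau> (axis i (- 1))"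
  have funpow_act: "(\<tau> (axis i e) ^^ n) x = \<tau> (axis i (e * int n)) x" if x: "x \<in> space M" for e n x
  proof (induction n)
    case 0 show ?case using act_zero[OF x] by simp
  next
    case (Suc n)
    have "axis i (e * int (Suc n)) = axis i e + axis i (e * int n)"
      by (simp add: axis_add algebra_simps)
    then show ?case using Suc by (simp only: funpow.simps comp_apply act_add[OF x])
  qed
  \<comment> \<open>The backward sum uses \<open>f\<close> composed with the inverse generator: its
    first term is j = -1, so j = 0 is counted only in the forward sum.\<close>
  have split: "(\<Sum>j\<in>{- int n..<int n}. f (\<tau> (axis i j) x))
      = birkhoff_sum f ?T n x + birkhoff_sum (\<lambda>x. f (?T' x)) ?T' n x" if x: "x \<in> space M" for n x
  proof (induction n)
    case 0 show ?case by (simp add: birkhoff_sum_def)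
  next
    case (Suc n)
    have s: "{- int (Suc n)..<int (Suc n)} = insert (- 1 - int n) (insert (int n) {- int n..<int n})"
      by auto
    have p: "(?T ^^ n) x = \<tau> (axis i (int n)) x" using funpow_act[OF x, of n 1] by simp
    have "(?T' ^^ Suc n) x = \<tau> (axis i (- 1 - int n)) x"
      using funpow_act[OF x, of "Suc n" "- 1"] by (simp del: funpow.simps)
    then have q: "?T' ((?T' ^^ n) x) = \<tau> (axis i (- 1 - int n)) x"
      by (simp only: funpow.simps comp_apply)
    have "(\<Sum>j\<in>{- int (Suc n)..<int (Suc n)}. f (\<tau> (axis i j) x))
        = f (\<tau> (axis i (- 1 - int n)) x) + (f (\<tau> (axis i (int n)) x)
          + (\<Sum>j\<in>{- int n..<int n}. f (\<tau> (axis i j) x)))"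
      unfolding s by simp
    also have "\<dots> = birkhoff_sum f ?T (Suc n) x + birkhoff_sum (\<lambda>x. f (?T' x)) ?T' (Suc n) x"
      unfolding Suc p[symmetric] q[symmetric] birkhoff_sum_def by simp
    finally show ?case .
  qed
  have A: "AE x in M. convergent (\<lambda>n. birkhoff_sum f ?T n x / real n)"
    by (rule birkhoff_convergent[OF act_measurable _ act_distr bd]) auto
  have B: "AE x in M. convergent (\<lambda>n. birkhoff_sum (\<lambda>x. f (?T' x)) ?T' n x / real n)"
    by (rule birkhoff_convergent[OF act_measurable _ act_distr bd]) auto
  show ?thesis using A B AE_space
  proof eventually_elim
    case (elim x)
    then obtain a c where "(\<lambda>n. birkhoff_sum f ?T n x / real n) \<longlonglongrightarrow> a"
      "(\<lambda>n. birkhoff_sum (\<lambda>x. f (?T' x)) ?T' n x / real n) \<longlonglongrightarrow> c"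
      by (auto simp: convergent_def)
    then have "(\<lambda>n. (birkhoff_sum f ?T n x / real n
        + birkhoff_sum (\<lambda>x. f (?T' x)) ?T' n x / real n) / 2) \<longlonglongrightarrow> (a + c) / 2"
      by (intro tendsto_intros) auto
    moreover have "axis_avg i n f x = (birkhoff_sum f ?T n x / real n
        + birkhoff_sum (\<lambda>x. f (?T' x)) ?T' n x / real n) / 2" for n
      unfolding axis_avg_def split[OF elim(3)] by (simp add: add_divide_distrib)
    ultimately show ?case by (simp only: convergent_def) blast
  qed
qed

lemma integral_axis_avg:
  assumes [measurable]: "f \<in> borel_measurable M" and bd: "\<And>x. x \<in> space M \<Longrightarrow> \<bar>f x\<bar> \<le> B"
    and n: "0 < n"
  shows "(\<integral>x. axis_avg i n f x \<partial>M) = (\<integral>x. f x \<partial>M)"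
proof -
  have "integrable M (\<lambda>x. f (\<tau> k x))" for k
    by (rule integrable_bounded[of _ B]) (use bd in auto)
  then show ?thesis using n
    unfolding axis_avg_def
    by (simp add: integral_measure_preserving[OF act_measurable act_distr])
qed

lemma integral_box_avg:
  assumes [measurable]: "f \<in> borel_measurable M" and bd: "\<And>x. x \<in> space M \<Longrightarrow> \<bar>f x\<bar> \<le> B"
    and n: "0 < n"
  shows "(\<integral>x. box_avg S n f x \<partial>M) = (\<integral>x. f x \<partial>M)"
proof (induction S rule: finite_induct[OF finite])
  case 1 then show ?case by (intro Bochner_Integration.integral_cong) auto
next
  case (2 i S)
  have "(\<integral>x. box_avg (insert i S) n f x \<partial>M) = (\<integral>x. axis_avg i n (box_avg S n f) x \<partial>M)"
    by (intro Bochner_Integration.integral_cong) (auto simp: box_avg_insert 2)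
  then show ?case
    using integral_axis_avg[of "box_avg S n f" B n i] box_avg_bounded[OF bd] n 2 by simp
qed

text \<open>The limit \<open>k N\<close> of the outer averages of the tail supremum
  \<open>h N\<close> has the same integral as \<open>h N\<close>, and these integrals tend to 0.
  Hence the infimum of \<open>k N\<close> over \<open>N\<close> vanishes almost everywhere, and the
  box averages share the limit of the outer averages of \<open>l\<close>.\<close>

lemma box_avg_convergent:
  assumes f [measurable]: "f \<in> borel_measurable M" and bd: "\<And>x. x \<in> space M \<Longrightarrow> \<bar>f x\<bar> \<le> B"
  shows "AE x in M. convergent (\<lambda>n. box_avg S n f x)"
proof (induction S rule: finite_induct[OF finite])
  case 1 then show ?case by (intro AE_I2) (simp add: convergent_const)
next
  case (2 i S)
  define a where "a n x = box_avg S n f x" for n x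
  \<comment> \<open>The default 0 makes \<open>l\<close> measurable and bounded everywhere, so that
    it may itself be averaged along the new axis.\<close>
  define l where "l x = (if convergent (\<lambda>n. a n x) then lim (\<lambda>n. a n x) else 0)" for x
  define h where "h N x = (SUP m. \<bar>a (N + m) x - l x\<bar>)" for N x
  have B0: "0 \<le> B" by (rule nonneg_bound[OF bd])
  have [measurable]: "a n \<in> borel_measurable M" for n unfolding a_def by measurable
  have [measurable]: "l \<in> borel_measurable M" unfolding l_def Cauchy_convergent_iff[symmetric] by measurable
  have ab: "\<bar>a n x\<bar> \<le> B" if "x \<in> space M" for n x
    unfolding a_def by (rule box_avg_bounded[OF bd that])
  have lb: "\<bar>l x\<bar> \<le> B" if x: "x \<in> space M" for x
  proof (cases "convergent (\<lambda>n. a n x)")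
    case True
    then have "(\<lambda>n. \<bar>a n x\<bar>) \<longlonglongrightarrow> \<bar>l x\<bar>"
      by (simp add: l_def convergent_LIMSEQ_iff tendsto_rabs)
    then show ?thesis by (rule LIMSEQ_le_const2) (use ab[OF x] in auto)
  qed (use B0 in \<open>simp add: l_def\<close>)
  have bdd: "bdd_above (range (\<lambda>m. \<bar>a (N + m) x - l x\<bar>))" if "x \<in> space M" for N x
    by (rule bdd_aboveI[of _ "2 * B"]) (use abs_diff_bound[OF ab[OF that] lb[OF that]] in auto)
  have [measurable]: "h N \<in> borel_measurable M" for N
    unfolding h_def by (rule borel_measurable_cSUP) (use bdd in auto)
  have hge: "\<bar>a n x - l x\<bar> \<le> h N x" if "x \<in> space M" "N \<le> n" for n N x
    unfolding h_def using cSUP_upper[OF UNIV_I bdd[OF that(1), of N], of "n - N"] that(2) by simp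
  have h0: "0 \<le> h N x" if "x \<in> space M" for N x
    using order_trans[OF abs_ge_zero hge[OF that order_refl]] .
  have hb: "\<bar>h N x\<bar> \<le> 2 * B" if x: "x \<in> space M" for N x
  proof -
    have "h N x \<le> 2 * B" unfolding h_def
      by (rule cSUP_least) (use abs_diff_bound[OF ab[OF x] lb[OF x]] in auto)
    then show ?thesis using h0[OF x, of N] by simp
  qed
  have "AE x in M. (\<lambda>N. h N x) \<longlonglongrightarrow> 0"
    using 2(3) AE_space
  proof eventually_elim
    case (elim x)
    then have lim: "(\<lambda>n. a n x) \<longlonglongrightarrow> l x"
      by (simp add: l_def a_def convergent_LIMSEQ_iff)
    show ?case
    proof (rule LIMSEQ_I)
      fix r :: real assume r: "0 < r"
      then obtain N where N: "\<And>n. n \<ge> N \<Longrightarrow> \<bar>a n x - l x\<bar> < r / 2"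
        using LIMSEQ_D[OF lim, of "r / 2"] by auto
      have "\<bar>h n x\<bar> < r" if "n \<ge> N" for n
      proof -
        have "h n x \<le> r / 2" unfolding h_def
          by (rule cSUP_least) (use N that in \<open>auto intro!: less_imp_le\<close>)
        then show ?thesis using h0[OF elim(2), of n] r by simp
      qed
      then show "\<exists>no. \<forall>n\<ge>no. norm (h n x - 0) < r" by auto
    qed
  qed
  then have ih: "(\<lambda>N. \<integral>x. h N x \<partial>M) \<longlonglongrightarrow> (\<integral>x. 0 \<partial>M)"
    by (intro integral_dominated_convergence[where w="\<lambda>_. 2 * B"]) (use hb in auto)
  define k where "k N x = (if convergent (\<lambda>n. axis_avg i n (h N) x)
      then lim (\<lambda>n. axis_avg i n (h N) x) else 0)" for N x
  have [measurable]: "k N \<in> borel_measurable M" for N unfolding k_def Cauchy_convergent_iff[symmetric] by measurable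
  have kc: "AE x in M. (\<lambda>n. axis_avg i n (h N) x) \<longlonglongrightarrow> k N x" for N
    by (rule AE_mp[OF axis_avg_convergent[OF _ hb]])
      (auto intro!: AE_I2 simp: k_def convergent_LIMSEQ_iff)
  have k0: "0 \<le> k N x" if x: "x \<in> space M" for N x
  proof (cases "convergent (\<lambda>n. axis_avg i n (h N) x)")
    case True
    then have "(\<lambda>n. axis_avg i n (h N) x) \<longlonglongrightarrow> k N x" by (simp add: k_def convergent_LIMSEQ_iff)
    then show ?thesis
      by (rule LIMSEQ_le_const)
        (use h0 x in \<open>auto simp: axis_avg_def intro!: exI sum_nonneg divide_nonneg_nonneg\<close>)
  qed (simp add: k_def)
  have avb: "\<bar>axis_avg i n (h N) x\<bar> \<le> 2 * B" if "x \<in> space M" for n N x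
    by (rule axis_avg_bounded[OF hb that])
  have ik: "(\<integral>x. k N x \<partial>M) = (\<integral>x. h N x \<partial>M)" for N
  proof -
    have "(\<lambda>n. \<integral>x. axis_avg i n (h N) x \<partial>M) \<longlonglongrightarrow> (\<integral>x. k N x \<partial>M)"
      by (rule integral_dominated_convergence[where w="\<lambda>_. 2 * B"]) (use kc avb in auto)
    moreover have "(\<lambda>n. \<integral>x. axis_avg i n (h N) x \<partial>M) \<longlonglongrightarrow> (\<integral>x. h N x \<partial>M)"
      by (rule tendsto_eventually, rule eventually_mono[OF eventually_gt_at_top[of 0]])
        (rule integral_axis_avg[OF _ hb], auto)
    ultimately show ?thesis by (rule LIMSEQ_unique)
  qed
  \<comment> \<open>An infimum is enough: for given x and r, a single \<open>N\<close> with
    \<open>k N x < r\<close> controls all later averages.\<close>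
  define g where "g x = (INF N. k N x)" for x
  have bb: "bdd_below (range (\<lambda>N. k N x))" if "x \<in> space M" for x
    using k0[OF that] by (auto intro!: bdd_belowI[of _ 0])
  have [measurable]: "g \<in> borel_measurable M" unfolding g_def
    by (rule borel_measurable_cINF) (use bb in auto)
  have g0: "0 \<le> g x" if "x \<in> space M" for x
    unfolding g_def by (rule cINF_greatest) (use k0[OF that] in auto)
  have gk: "g x \<le> k N x" if "x \<in> space M" for x N
    unfolding g_def by (rule cINF_lower[OF bb[OF that]]) simp
  have kb: "AE x in M. \<bar>k N x\<bar> \<le> 2 * B" for N
    using kc[of N] AE_space
  proof eventually_elim
    case (elim x)
    then have "(\<lambda>n. \<bar>axis_avg i n (h N) x\<bar>) \<longlonglongrightarrow> \<bar>k N x\<bar>" by (intro tendsto_rabs)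
    then show ?case by (rule LIMSEQ_le_const2) (use avb[OF elim(2)] in auto)
  qed
  have ki: "integrable M (k N)" for N
    by (rule integrable_const_bound[of _ "2 * B"]) (use kb in auto)
  have gi: "integrable M g"
    by (rule Bochner_Integration.integrable_bound[OF ki[of 0]])
      (use g0 gk k0 in \<open>auto intro!: AE_I2\<close>)
  have "(\<integral>x. g x \<partial>M) \<le> 0"
  proof (rule LIMSEQ_le_const)
    show "(\<lambda>N. \<integral>x. h N x \<partial>M) \<longlonglongrightarrow> 0" using ih by simp
    show "\<exists>N. \<forall>n\<ge>N. (\<integral>x. g x \<partial>M) \<le> (\<integral>x. h n x \<partial>M)"
    proof (intro exI allI impI)
      fix n
      have "(\<integral>x. g x \<partial>M) \<le> (\<integral>x. k n x \<partial>M)" by (rule integral_mono[OF gi ki gk])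
      then show "(\<integral>x. g x \<partial>M) \<le> (\<integral>x. h n x \<partial>M)" by (simp add: ik)
    qed
  qed
  moreover have "0 \<le> (\<integral>x. g x \<partial>M)" using g0 by (intro integral_nonneg_AE AE_I2)
  ultimately have "AE x in M. g x = 0"
    using integral_nonneg_eq_0_iff_AE[OF gi AE_I2[OF g0]] by simp
  moreover have "AE x in M. \<forall>N. (\<lambda>n. axis_avg i n (h N) x) \<longlonglongrightarrow> k N x"
    using kc by (simp add: AE_all_countable)
  moreover have "AE x in M. convergent (\<lambda>n. axis_avg i n l x)"
    by (rule axis_avg_convergent[OF _ lb]) auto
  ultimately show ?case using AE_space
  proof eventually_elim
    case (elim x)
    then obtain c where c: "(\<lambda>n. axis_avg i n l x) \<longlonglongrightarrow> c" by (auto simp: convergent_def)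
    have "(\<lambda>n. box_avg (insert i S) n f x - axis_avg i n l x) \<longlonglongrightarrow> 0"
    proof (rule LIMSEQ_I)
      fix r :: real assume r: "0 < r"
      have "\<exists>N. k N x < r"
        using cINF_less_iff[OF _ bb[OF elim(4)], of r] elim(1) r by (simp add: g_def)
      then obtain N where N: "k N x < r" by blast
      have "eventually (\<lambda>n. axis_avg i n (h N) x < r) sequentially"
        by (rule order_tendstoD(2)[OF _ N]) (use elim in auto)
      then obtain N' where N': "\<And>n. n \<ge> N' \<Longrightarrow> axis_avg i n (h N) x < r"
        by (auto simp: eventually_sequentially)
      have "\<bar>box_avg (insert i S) n f x - axis_avg i n l x\<bar> < r" if "n \<ge> max N N'" for n
      proof -
        have "box_avg (insert i S) n f x - axis_avg i n l x = axis_avg i n (\<lambda>y. a n y - l y) x"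
          using box_avg_insert[OF 2(2) elim(4)] by (simp add: axis_avg_diff a_def[abs_def])
        also have "\<bar>\<dots>\<bar> \<le> axis_avg i n (\<lambda>y. \<bar>a n y - l y\<bar>) x" by (rule axis_avg_abs)
        also have "\<dots> \<le> axis_avg i n (h N) x"
          by (rule axis_avg_mono) (use hge that elim(4) in auto)
        also have "\<dots> < r" using N' that by simp
        finally show ?thesis .
      qed
      then show "\<exists>no. \<forall>n\<ge>no. norm (box_avg (insert i S) n f x - axis_avg i n l x - 0) < r"
        by (intro exI[of _ "max N N'"]) auto
    qed
    from tendsto_add[OF this c] show ?case by (auto simp: convergent_def)
  qed
qed

text \<open>A unit shift along axis \<open>i\<close> telescopes: only two opposite faces survive,
  each face average is at most \<open>B\<close> in absolute value, and the factor 1 / (2 n)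
  remains.\<close>

lemma box_avg_shift:
  assumes bd: "\<And>x. x \<in> space M \<Longrightarrow> \<bar>f x\<bar> \<le> B" and x: "x \<in> space M"
  shows "(\<lambda>n. box_avg UNIV n f (\<tau> (axis i 1) x) - box_avg UNIV n f x) \<longlonglongrightarrow> 0"
proof (rule Lim_null_comparison[where g="\<lambda>n. B / real n"])
  have "\<bar>box_avg UNIV n f (\<tau> (axis i 1) x) - box_avg UNIV n f x\<bar> \<le> B / real n" for n
  proof -
    define g where "g j = box_avg (UNIV - {i}) n f (\<tau> (axis i j) x)" for j
    have U: "UNIV = insert i (UNIV - {i})" by auto
    have e: "box_avg UNIV n f y = axis_avg i n (box_avg (UNIV - {i}) n f) y" if "y \<in> space M" for y
      using box_avg_insert[of i "UNIV - {i}" y n f] that U by simp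
    have "(\<Sum>j\<in>{- int m..<int m}. g (j + 1) - g j) = g (int m) - g (- int m)" for m
    proof (induction m)
      case (Suc m)
      have "{- int (Suc m)..<int (Suc m)} = insert (- 1 - int m) (insert (int m) {- int m..<int m})"
        by auto
      then show ?case using Suc by (simp add: algebra_simps)
    qed simp
    then have "box_avg UNIV n f (\<tau> (axis i 1) x) - box_avg UNIV n f x
        = (g (int n) - g (- int n)) / (2 * real n)"
      using x by (simp add: e axis_avg_def g_def act_add[symmetric] axis_add
          diff_divide_distrib[symmetric] sum_subtractf[symmetric])
    moreover have "\<bar>g (int n) - g (- int n)\<bar> \<le> 2 * B"
      unfolding g_def by (rule abs_diff_bound) (intro box_avg_bounded bd act_space x; assumption)+
    ultimately have "\<bar>box_avg UNIV n f (\<tau> (axis i 1) x) - box_avg UNIV n f x\<bar> \<le> 2 * B / (2 * real n)"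
      using divide_right_mono[of "\<bar>g (int n) - g (- int n)\<bar>" "2 * B" "2 * real n"]
      by (simp only: abs_divide) simp
    then show ?thesis by simp
  qed
  then show "\<forall>\<^sub>F n in sequentially.
      norm (box_avg UNIV n f (\<tau> (axis i 1) x) - box_avg UNIV n f x) \<le> B / real n" by simp
qed (rule lim_const_over_n)

text \<open>The unit vectors generate the group; a negative multiple is undone by the positive
  multiple applied at the translated point.\<close>

lemma invariant_of_axis_invariant:
  assumes inv: "\<And>x i. x \<in> space M \<Longrightarrow> u (\<tau> (axis i 1) x) = u x" and "x \<in> space M"
  shows "u (\<tau> k x) = u x"
proof -
  have nat: "u (\<tau> (axis i (int n)) x) = u x" if "x \<in> space M" for i n x
  proof (induction n)
    case 0 then show ?case using act_zero[OF that] by simp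
  next
    case (Suc n)
    then show ?case using inv[of "\<tau> (axis i (int n)) x" i] that
      by (simp add: act_add[symmetric] axis_add)
  qed
  have int: "u (\<tau> (axis i j) x) = u x" if "x \<in> space M" for i j x
  proof (cases "0 \<le> j")
    case True
    then show ?thesis using nat[OF that, of i "nat j"] by simp
  next
    case False
    then have "u (\<tau> (axis i (- j)) (\<tau> (axis i j) x)) = u (\<tau> (axis i j) x)"
      using nat[of "\<tau> (axis i j) x" i "nat (- j)"] that by simp
    then show ?thesis using that act_zero[OF that] by (simp add: act_add[symmetric] axis_add)
  qed
  have "u (\<tau> (\<Sum>i\<in>S. axis i (k $ i)) x) = u x" for S
  proof (induction S rule: finite_induct[OF finite])
    case 1 then show ?case using act_zero[OF assms(2)] by simp
  next
    case (2 i S)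
    then show ?case using int[of "\<tau> (\<Sum>i\<in>S. axis i (k $ i)) x" i "k $ i"] assms(2)
      by (simp add: act_add)
  qed
  moreover have "(\<Sum>i\<in>UNIV. axis i (k $ i)) = k"
    by (simp add: vec_eq_iff axis_def if_distrib cong: if_cong)
  ultimately show ?thesis by metis
qed

text \<open>Ergodicity is available for strictly invariant sets, so the set \<open>A\<close> is cut
  out by the upper limit \<open>u\<close>, which is invariant at every point of the space, rather
  than by the almost sure limit \<open>l\<close>. If \<open>A\<close> had full measure,
  \<open>l\<close> would exceed its own mean \<open>c\<close>; hence \<open>l\<close> is at most
  \<open>c\<close> almost everywhere, and equal integrals give equality.\<close>

theorem box_avg_tendsto_integral:
  assumes f [measurable]: "f \<in> borel_measurable M" and bd: "\<And>x. x \<in> space M \<Longrightarrow> \<bar>f x\<bar> \<le> B"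
    and erg: "\<And>A. A \<in> sets M \<Longrightarrow> (\<And>k. \<tau> k -` A \<inter> space M = A) \<Longrightarrow> prob A = 0 \<or> prob A = 1"
  shows "AE x in M. (\<lambda>n. box_avg UNIV n f x) \<longlonglongrightarrow> (\<integral>x. f x \<partial>M)"
proof -
  define c where "c = (\<integral>x. f x \<partial>M)"
  define u where "u x = limsup (\<lambda>n. ereal (box_avg UNIV n f x))" for x
  define l where "l x = (if convergent (\<lambda>n. box_avg UNIV n f x)
      then lim (\<lambda>n. box_avg UNIV n f x) else 0)" for x
  have [measurable]: "u \<in> borel_measurable M" unfolding u_def by measurable
  have [measurable]: "l \<in> borel_measurable M" unfolding l_def Cauchy_convergent_iff[symmetric] by measurable
  have lim: "AE x in M. (\<lambda>n. box_avg UNIV n f x) \<longlonglongrightarrow> l x"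
    by (rule AE_mp[OF box_avg_convergent[OF f bd]])
      (auto intro!: AE_I2 simp: l_def convergent_LIMSEQ_iff)
  then have ul: "AE x in M. u x = ereal (l x)"
    by (rule AE_mp) (auto intro!: AE_I2 lim_imp_Limsup simp: u_def)
  have bb: "\<bar>box_avg UNIV n f x\<bar> \<le> B" if "x \<in> space M" for n x
    by (rule box_avg_bounded[OF bd that])
  have lb: "AE x in M. \<bar>l x\<bar> \<le> B" using lim AE_space
  proof eventually_elim
    case (elim x)
    from tendsto_rabs[OF elim(1)] show ?case
      by (rule LIMSEQ_le_const2) (use bb[OF elim(2)] in auto)
  qed
  have il: "(\<integral>x. l x \<partial>M) = c"
  proof -
    have "(\<lambda>n. \<integral>x. box_avg UNIV n f x \<partial>M) \<longlonglongrightarrow> (\<integral>x. l x \<partial>M)"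
      by (rule integral_dominated_convergence[where w="\<lambda>_. B"]) (use lim bb in auto)
    moreover have "(\<lambda>n. \<integral>x. box_avg UNIV n f x \<partial>M) \<longlonglongrightarrow> c" unfolding c_def
      by (rule tendsto_eventually, rule eventually_mono[OF eventually_gt_at_top[of 0]])
        (rule integral_box_avg[OF _ bd], auto)
    ultimately show ?thesis by (rule LIMSEQ_unique)
  qed
  have li: "integrable M l" by (rule integrable_const_bound[of _ B]) (use lb in auto)
  have uinv: "u (\<tau> k x) = u x" if "x \<in> space M" for k x
  proof (rule invariant_of_axis_invariant[OF _ that])
    fix y i assume y: "y \<in> space M"
    have "(\<lambda>n. ereal (box_avg UNIV n f (\<tau> (axis i 1) y) - box_avg UNIV n f y)) \<longlonglongrightarrow> ereal 0"
      using box_avg_shift[OF bd y] by simp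
    from ereal_limsup_lim_add[OF this, of "\<lambda>n. ereal (box_avg UNIV n f y)"]
    show "u (\<tau> (axis i 1) y) = u y" by (simp add: u_def zero_ereal_def[symmetric])
  qed
  define A where "A = {x \<in> space M. ereal c < u x}"
  have [measurable]: "A \<in> sets M" unfolding A_def by measurable
  have "prob A = 0 \<or> prob A = 1"
    by (rule erg) (auto simp: A_def uinv)
  moreover have "prob A \<noteq> 1"
  proof
    assume "prob A = 1"
    then have "AE x in M. x \<in> A" by (simp add: prob_eq_1)
    then have gt: "AE x in M. c < l x" using ul by eventually_elim (simp add: A_def)
    have "AE x in M. l x - c = 0"
    proof (subst integral_nonneg_eq_0_iff_AE[symmetric])
      show "(\<integral>x. l x - c \<partial>M) = 0" using li il by (simp add: prob_space)
    qed (use li gt in auto)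
    with gt have "AE x in M. False" by eventually_elim simp
    then show False by simp
  qed
  ultimately have "AE x in M. x \<notin> A" by (simp add: prob_eq_0)
  then have le: "AE x in M. l x \<le> c" using ul AE_space by eventually_elim (simp add: A_def)
  have "AE x in M. c - l x = 0"
  proof (subst integral_nonneg_eq_0_iff_AE[symmetric])
    show "(\<integral>x. c - l x \<partial>M) = 0" using li il by (simp add: prob_space)
  qed (use li le in auto)
  then show ?thesis unfolding c_def[symmetric] using lim by eventually_elim simp
qed

end

section \<open>Globally Lipschitz differential equations\<close>

definition euler_step :: "('a::real_normed_vector \<Rightarrow> 'a) \<Rightarrow> real \<Rightarrow> 'a \<Rightarrow> 'a" where
  "euler_step X h y = y + h *\<^sub>R X y"

text \<open>Discrete Gronwall estimate: one step multiplies the error by at most 1 + |h| L and adds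
  at most \<open>e\<close>. The absolute value admits negative steps, which serve backward
  time.\<close>

lemma euler_step_error:
  assumes lip: "\<And>y z. norm (X y - X z) \<le> L * norm (y - z)" and L: "0 \<le> L" and e: "0 \<le> e"
    and loc: "\<And>k. k < n \<Longrightarrow> norm (y (Suc k) - y k - h *\<^sub>R X (y k)) \<le> e"
  shows "k \<le> n \<Longrightarrow> norm (y k - (euler_step X h ^^ k) (y 0)) \<le> real k * (1 + \<bar>h\<bar> * L) ^ k * e"
proof (induction k)
  case (Suc k)
  define q where "q = 1 + \<bar>h\<bar> * L"
  define z where "z = (euler_step X h ^^ k) (y 0)"
  have q: "1 \<le> q" using L by (simp add: q_def)
  have "y (Suc k) - (euler_step X h ^^ Suc k) (y 0)
      = (y (Suc k) - y k - h *\<^sub>R X (y k)) + ((y k - z) + h *\<^sub>R (X (y k) - X z))"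
    by (simp add: euler_step_def z_def algebra_simps)
  also have "norm \<dots> \<le> e + (norm (y k - z) + \<bar>h\<bar> * (L * norm (y k - z)))"
    using loc[of k] Suc.prems lip[of "y k" z]
    by (intro norm_triangle_le add_mono) (auto intro!: mult_left_mono)
  also have "\<dots> = e + q * norm (y k - z)" by (simp add: q_def algebra_simps)
  \<comment> \<open>Since q >= 1, the new error may be inflated to \<open>q ^ Suc k * e\<close>;
    this produces the factor \<open>k\<close> in place of a geometric sum.\<close>
  also have "\<dots> \<le> q ^ Suc k * e + q * (real k * q ^ k * e)"
  proof (intro add_mono mult_left_mono)
    show "norm (y k - z) \<le> real k * q ^ k * e" using Suc by (simp add: q_def z_def)
    have "1 * e \<le> q ^ Suc k * e" by (intro mult_right_mono one_le_power q e)
    then show "e \<le> q ^ Suc k * e" by simp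
  qed (use q in simp)
  also have "\<dots> = real (Suc k) * q ^ Suc k * e" by (simp add: algebra_simps)
  finally show ?case by (simp add: q_def)
qed simp

lemma lipschitz_imp_continuous_on:
  assumes lip: "\<And>y z. norm (X y - X z) \<le> L * norm (y - z)"
  shows "continuous_on S X"
proof (rule lipschitz_on_continuous_on[OF lipschitz_onI])
  fix y z
  show "dist (X y) (X z) \<le> \<bar>L\<bar> * dist y z"
    using order_trans[OF lip mult_right_mono[OF abs_ge_self norm_ge_zero]] by (simp add: dist_norm)
qed simp

definition solves_ode :: "('a::real_normed_vector \<Rightarrow> 'a) \<Rightarrow> 'a \<Rightarrow> (real \<Rightarrow> 'a) \<Rightarrow> bool" where
  "solves_ode X x \<phi> \<longleftrightarrow> \<phi> 0 = x \<and> (\<forall>t. (\<phi> has_vector_derivative X (\<phi> t)) (at t))"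

text \<open>On a compact time interval the solution moves at speed at most M, so one Euler step errs
  by at most L M h^2; n steps of size t / n with stability factor exp(|t| L) leave an error of order
  1 / n. The convergence serves twice, for uniqueness and for measurability of the flow.\<close>

lemma euler_tendsto:
  assumes lip: "\<And>y z. norm (X y - X z) \<le> L * norm (y - z)" and L: "0 \<le> L"
    and \<phi>: "solves_ode X x \<phi>"
  shows "(\<lambda>n. (euler_step X (t / real n) ^^ n) x) \<longlonglongrightarrow> \<phi> t"
proof -
  have d: "(\<phi> has_vector_derivative X (\<phi> s)) (at s within S)" for s S
    using \<phi> by (auto simp: solves_ode_def intro: has_vector_derivative_at_within)
  have c: "continuous_on S \<phi>" for S
    by (intro continuous_on_vector_derivative[OF d])
  let ?I = "{- \<bar>t\<bar>..\<bar>t\<bar>}"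
  have "continuous_on ?I (\<lambda>s. X (\<phi> s))"
    by (rule continuous_on_compose2[OF lipschitz_imp_continuous_on[OF lip, of UNIV] c]) auto
  then have "bounded ((\<lambda>s. X (\<phi> s)) ` ?I)"
    by (intro compact_imp_bounded compact_continuous_image) auto
  then obtain M where M: "\<And>s. s \<in> ?I \<Longrightarrow> norm (X (\<phi> s)) \<le> M"
    unfolding bounded_iff by blast
  have M0: "0 \<le> M" using order_trans[OF norm_ge_zero M[of 0]] by simp
  have D: "norm (\<phi> s - \<phi> r) \<le> M * \<bar>s - r\<bar>" if "s \<in> ?I" "r \<in> ?I" for s r
  proof -
    have "norm (\<phi> s - \<phi> r) \<le> M * norm (s - r)"
    proof (rule differentiable_bound[where f'="\<lambda>s h. h *\<^sub>R X (\<phi> s)"])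
      fix u assume u: "u \<in> ?I"
      show "(\<phi> has_derivative (\<lambda>h. h *\<^sub>R X (\<phi> u))) (at u within ?I)"
        using d by (simp add: has_vector_derivative_def)
      show "onorm (\<lambda>h. h *\<^sub>R X (\<phi> u)) \<le> M"
        by (rule onorm_le) (use mult_left_mono[OF M[OF u] abs_ge_zero] in \<open>simp add: mult.commute\<close>)
    qed (use that in auto)
    then show ?thesis by simp
  qed
  \<comment> \<open>On the segment from r to s the velocity deviates from its value at r by at most
    L M |s - r|; the mean value inequality turns this into a quadratic error.\<close>
  have loc: "norm (\<phi> s - \<phi> r - (s - r) *\<^sub>R X (\<phi> r)) \<le> \<bar>s - r\<bar> * (L * (M * \<bar>s - r\<bar>))"
    if sr: "s \<in> ?I" "r \<in> ?I" for s r
  proof -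
    have sub: "closed_segment r s \<subseteq> ?I"
      using sr by (intro closed_segment_subset) auto
    have "norm (\<phi> s - \<phi> r - (s - r) *\<^sub>R X (\<phi> r)) \<le> norm (s - r) * (L * (M * \<bar>s - r\<bar>))"
    proof (rule vector_differentiable_bound_linearization[where S="closed_segment r s" and f'="\<lambda>s. X (\<phi> s)"])
      fix u assume u: "u \<in> closed_segment r s"
      then have "\<bar>u - r\<bar> \<le> \<bar>s - r\<bar>" by (auto simp: closed_segment_eq_real_ivl split: if_splits)
      then have "norm (\<phi> u - \<phi> r) \<le> M * \<bar>s - r\<bar>"
        by (intro order_trans[OF D mult_left_mono[OF _ M0]]) (use u sub sr in auto)
      then show "norm (X (\<phi> u) - X (\<phi> r)) \<le> L * (M * \<bar>s - r\<bar>)"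
        by (rule order_trans[OF lip mult_left_mono[OF _ L]])
    qed (use d in auto)
    then show ?thesis by simp
  qed
  have err: "norm (\<phi> t - (euler_step X (t / real n) ^^ n) x) \<le> exp (\<bar>t\<bar> * L) * L * M * t\<^sup>2 / real n"
    if n: "0 < n" for n
  proof -
    define h where "h = t / real n"
    define e where "e = \<bar>h\<bar> * (L * (M * \<bar>h\<bar>))"
    have "norm (\<phi> (real n * h) - (euler_step X h ^^ n) (\<phi> (real 0 * h)))
        \<le> real n * (1 + \<bar>h\<bar> * L) ^ n * e"
    proof (rule euler_step_error[OF lip L, where n=n])
      show "0 \<le> e" using L M0 by (simp add: e_def)
      fix k assume k: "k < n"
      have mem: "real j * h \<in> ?I" if "j \<le> n" for j
      proof -
        have "\<bar>real j * h\<bar> = (real j / real n) * \<bar>t\<bar>" by (simp add: h_def abs_mult)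
        also have "\<dots> \<le> 1 * \<bar>t\<bar>" using that n by (intro mult_right_mono) auto
        finally show ?thesis by (simp only: atLeastAtMost_iff) linarith
      qed
      show "norm (\<phi> (real (Suc k) * h) - \<phi> (real k * h) - h *\<^sub>R X (\<phi> (real k * h))) \<le> e"
        using loc[OF mem[of "Suc k"] mem[of k]] k by (simp add: e_def algebra_simps)
    qed simp
    moreover have "real n * h = t" using n by (simp add: h_def)
    moreover have "\<phi> (real 0 * h) = x" using \<phi> by (simp add: solves_ode_def)
    moreover have "real n * (1 + \<bar>h\<bar> * L) ^ n * e \<le> real n * exp (\<bar>t\<bar> * L) * e"
    proof (intro mult_right_mono mult_left_mono)
      have "(1 + (\<bar>t\<bar> * L) / real n) ^ n \<le> exp (\<bar>t\<bar> * L)"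
        by (rule exp_ge_one_plus_x_over_n_power_n) (use n L in \<open>simp_all add: order_trans[of _ 0]\<close>)
      then show "(1 + \<bar>h\<bar> * L) ^ n \<le> exp (\<bar>t\<bar> * L)" by (simp add: h_def abs_divide)
      show "0 \<le> e" using L M0 by (simp add: e_def)
    qed simp
    moreover have "real n * exp (\<bar>t\<bar> * L) * e = exp (\<bar>t\<bar> * L) * L * M * t\<^sup>2 / real n"
    proof -
      have "\<bar>h\<bar> * \<bar>h\<bar> = t\<^sup>2 / (real n * real n)" by (simp add: h_def power2_eq_square)
      then have "e = L * M * (t\<^sup>2 / (real n * real n))" by (simp add: e_def algebra_simps)
      then show ?thesis using n by (simp add: field_simps)
    qed
    ultimately show ?thesis by (simp add: h_def)
  qed
  have "(\<lambda>n. \<phi> t - (euler_step X (t / real n) ^^ n) x) \<longlonglongrightarrow> 0"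
    by (rule Lim_null_comparison[OF _ lim_const_over_n])
      (rule eventually_mono[OF eventually_gt_at_top[of 0]], rule err)
  from tendsto_diff[OF tendsto_const[of "\<phi> t"] this] show ?thesis by simp
qed

text \<open>The Euler approximations are built from \<open>X\<close> and \<open>x\<close> alone, so
  every solution is their limit.\<close>

lemma solves_ode_unique:
  assumes "\<And>y z. norm (X y - X z) \<le> L * norm (y - z)" "0 \<le> L"
    and "solves_ode X x \<phi>" "solves_ode X x \<psi>"
  shows "\<phi> = \<psi>"
proof
  fix t
  show "\<phi> t = \<psi> t"
    by (rule LIMSEQ_unique[OF euler_tendsto[OF assms(1,2,3)] euler_tendsto[OF assms(1,2,4)]])
qed

section \<open>Global existence by a weighted Picard iteration\<close>

lemma integral_exp_le:
  fixes c :: real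
  assumes "0 < c" "0 \<le> s"
  shows "integral {0..s} (\<lambda>r. exp (c * r)) \<le> exp (c * s) / c"
proof -
  have "((\<lambda>r. exp (c * r)) has_integral (exp (c * s) / c - exp (c * 0) / c)) {0..s}"
    by (rule fundamental_theorem_of_calculus[OF assms(2)])
      (use assms in \<open>auto intro!: derivative_eq_intros simp: has_real_derivative_iff_has_vector_derivative[symmetric]\<close>)
  then show ?thesis using assms(1) by (simp add: integral_unique)
qed

text \<open>The weight \<open>exp (- c t)\<close> with \<open>c = 2 L\<close> makes the Picard operator a contraction on the whole half line.\<close>

definition picard :: "('a::banach \<Rightarrow> 'a) \<Rightarrow> real \<Rightarrow> 'a \<Rightarrow> (real \<Rightarrow> 'a) \<Rightarrow> real \<Rightarrow> 'a" where
  "picard X c x g t = exp (- c * max 0 t) *\<^sub>R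
     (x + integral {0..max 0 t} (\<lambda>r. X (exp (c * r) *\<^sub>R g r)))"

text \<open>The factor 1/2 is L / c for c = 2 L: the integral of L D exp(c r) over [0, s],
  multiplied by exp(- c s), is at most L D / c. The unknown \<open>g\<close> stands for the solution
  multiplied by exp(- c t).\<close>

lemma picard_diff:
  assumes lip: "\<And>y z. norm (X y - X z) \<le> L * norm (y - z)" and L: "0 < L"
    and g: "continuous_on UNIV g" and g': "continuous_on UNIV g'"
    and D: "\<And>r. norm (g r - g' r) \<le> D"
  shows "norm (picard X (2 * L) x g t - picard X (2 * L) x g' t) \<le> D / 2"
proof -
  define c where "c = 2 * L"
  define s where "s = max 0 t"
  have c: "0 < c" and s: "0 \<le> s" using L by (auto simp: c_def s_def)
  have D0: "0 \<le> D" using order_trans[OF norm_ge_zero D] .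
  have ig: "(\<lambda>r. X (exp (c * r) *\<^sub>R f r)) integrable_on {0..s}" if "continuous_on UNIV f" for f
    by (intro integrable_continuous_real continuous_on_compose2[OF lipschitz_imp_continuous_on[OF lip, of UNIV]])
      (auto intro!: continuous_intros continuous_on_subset[OF that])
  have ie: "(\<lambda>r. L * D * exp (c * r)) integrable_on {0..s}"
    by (intro integrable_continuous_real continuous_intros)
  have "picard X c x g t - picard X c x g' t
      = exp (- c * s) *\<^sub>R integral {0..s} (\<lambda>r. X (exp (c * r) *\<^sub>R g r) - X (exp (c * r) *\<^sub>R g' r))"
    using ig[OF g] ig[OF g'] by (simp add: picard_def s_def[symmetric] integral_diff scaleR_diff_right[symmetric])
  also have "norm \<dots> \<le> exp (- c * s) * integral {0..s} (\<lambda>r. L * D * exp (c * r))"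
    unfolding norm_scaleR abs_exp_cancel
  proof (intro mult_left_mono integral_norm_bound_integral[OF _ ie])
    fix r
    have "norm (X (exp (c * r) *\<^sub>R g r) - X (exp (c * r) *\<^sub>R g' r))
        \<le> L * norm (exp (c * r) *\<^sub>R (g r - g' r))"
      using lip by (simp add: scaleR_diff_right)
    also have "\<dots> \<le> L * (exp (c * r) * D)" using L D by (simp add: mult_left_mono)
    finally show "norm (X (exp (c * r) *\<^sub>R g r) - X (exp (c * r) *\<^sub>R g' r)) \<le> L * D * exp (c * r)"
      by (simp add: algebra_simps)
  qed (use ig[OF g] ig[OF g'] in \<open>auto intro: integrable_diff\<close>)
  also have "\<dots> \<le> exp (- c * s) * (L * D * (exp (c * s) / c))"
    unfolding integral_mult_right using integral_exp_le[OF c s] L D0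
    by (intro mult_left_mono) simp_all
  also have "\<dots> = D / 2" using L by (simp add: c_def exp_minus field_simps)
  finally show ?thesis by (simp add: c_def)
qed

text \<open>Freezing time at \<open>max 0 t\<close> gives functions on the whole line, so the
  complete space of bounded continuous functions and its fixed point theorem apply. Boundedness
  follows by comparison with the image of the zero function, which is explicit and controlled by c s
  <= exp(c s).\<close>

lemma picard_bcontfun:
  assumes lip: "\<And>y z. norm (X y - X z) \<le> L * norm (y - z)" and L: "0 < L"
  shows "picard X (2 * L) x (apply_bcontfun g) \<in> bcontfun"
proof -
  define c where "c = 2 * L"
  have c: "0 < c" using L by (simp add: c_def)
  have cX: "continuous_on S X" for S by (rule lipschitz_imp_continuous_on[OF lip])
  have cf: "continuous_on S (\<lambda>r. X (exp (c * r) *\<^sub>R g r))" for S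
    by (intro continuous_on_compose2[OF cX[of UNIV]]) (auto intro!: continuous_intros)
  have ci: "continuous_on {0..} (\<lambda>s. integral {0..s} (\<lambda>r. X (exp (c * r) *\<^sub>R g r)))"
  proof (rule continuous_on_vector_derivative)
    fix s :: real assume s: "s \<in> {0..}"
    have "((\<lambda>s. integral {0..s} (\<lambda>r. X (exp (c * r) *\<^sub>R g r))) has_vector_derivative X (exp (c * s) *\<^sub>R g s))
        (at s within {0..s + 1})"
      by (rule integral_has_vector_derivative[OF cf]) (use s in auto)
    moreover have "at s within {0..} = at s within {0..s + 1}"
      by (rule at_within_nhd[of s "{..<s + 1}"]) (use s in auto)
    ultimately show "((\<lambda>s. integral {0..s} (\<lambda>r. X (exp (c * r) *\<^sub>R g r))) has_vector_derivative X (exp (c * s) *\<^sub>R g s))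
        (at s within {0..})" by simp
  qed
  obtain G where G: "\<And>r. norm (apply_bcontfun g r) \<le> G"
    using bounded_apply_bcontfun[of g] by (auto simp: bounded_iff)
  show ?thesis unfolding c_def[symmetric] bcontfun_def
  proof (intro CollectI conjI)
    show "continuous_on UNIV (picard X c x g)"
      unfolding picard_def
      by (intro continuous_intros continuous_on_compose2[OF ci]) auto
    have "norm (picard X c x g t) \<le> G / 2 + (norm x + norm (X 0) / c)" for t
    proof -
      define s where "s = max 0 t"
      have s: "0 \<le> s" by (simp add: s_def)
      have "picard X c x (\<lambda>_. 0) t = exp (- c * s) *\<^sub>R x + (exp (- c * s) * s) *\<^sub>R X 0"
        by (simp add: picard_def s_def[symmetric] s scaleR_add_right)
      also have "norm \<dots> \<le> norm x + norm (X 0) / c"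
      proof (rule norm_triangle_mono)
        show "norm (exp (- c * s) *\<^sub>R x) \<le> norm x"
          using c s by (simp add: mult_left_le_one_le)
        have "c * s \<le> exp (c * s)" using exp_ge_add_one_self[of "c * s"] by linarith
        then have "exp (- c * s) * s \<le> 1 / c" using c by (simp add: exp_minus field_simps)
        then have "exp (- c * s) * s * norm (X 0) \<le> 1 / c * norm (X 0)"
          by (rule mult_right_mono) simp
        then show "norm ((exp (- c * s) * s) *\<^sub>R X 0) \<le> norm (X 0) / c"
          using s by (simp add: abs_mult)
      qed
      finally have "norm (picard X c x (\<lambda>_. 0) t) \<le> norm x + norm (X 0) / c" .
      moreover have "norm (picard X c x g t - picard X c x (\<lambda>_. 0) t) \<le> G / 2"
        unfolding c_def by (rule picard_diff[OF lip L]) (use G in auto)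
      ultimately show ?thesis
        using norm_triangle_ineq[of "picard X c x g t - picard X c x (\<lambda>_. 0) t" "picard X c x (\<lambda>_. 0) t"]
        by simp
    qed
    then show "bounded (range (picard X c x g))" by (auto simp: bounded_iff)
  qed
qed

lemma forward_solution_exists:
  fixes X :: "'a::banach \<Rightarrow> 'a"
  assumes lip: "\<And>y z. norm (X y - X z) \<le> L * norm (y - z)" and L: "0 < L"
  obtains \<phi> where "\<phi> 0 = x" "\<And>t. 0 \<le> t \<Longrightarrow> (\<phi> has_vector_derivative X (\<phi> t)) (at t within {0..})"
proof -
  define c where "c = 2 * L"
  define K where "K g = Bcontfun (picard X c x (apply_bcontfun g))" for g
  have K: "apply_bcontfun (K g) = picard X c x (apply_bcontfun g)" for g
    unfolding K_def c_def by (rule Bcontfun_inverse[OF picard_bcontfun[OF lip L]])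
  have "dist (K g) (K g') \<le> 1 / 2 * dist g g'" for g g'
  proof (rule dist_bound)
    fix t
    have "norm (picard X (2 * L) x g t - picard X (2 * L) x g' t) \<le> dist g g' / 2"
      by (rule picard_diff[OF lip L]) (auto simp: dist_norm[symmetric] dist_bounded)
    then show "dist (apply_bcontfun (K g) t) (apply_bcontfun (K g') t) \<le> 1 / 2 * dist g g'"
      by (simp add: K dist_norm c_def)
  qed
  then obtain g where g: "K g = g" using banach_fix_type[of "1 / 2" K] by auto
  define f where "f r = X (exp (c * r) *\<^sub>R apply_bcontfun g r)" for r
  \<comment> \<open>Undoing the weight turns the bounded fixed point into the solution, which may
    grow exponentially.\<close>
  define \<phi> where "\<phi> t = exp (c * t) *\<^sub>R apply_bcontfun g t" for t
  have cf: "continuous_on S f" for S unfolding f_def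
    by (intro continuous_on_compose2[OF lipschitz_imp_continuous_on[OF lip, of UNIV]])
      (auto intro!: continuous_intros)
  have eq: "\<phi> t = x + integral {0..t} f" if "0 \<le> t" for t
  proof -
    have "apply_bcontfun g t = exp (- c * t) *\<^sub>R (x + integral {0..t} f)"
      using fun_cong[OF K[of g], of t] that by (simp add: g picard_def f_def[abs_def])
    then show ?thesis by (simp add: \<phi>_def exp_minus)
  qed
  show thesis
  proof
    show "\<phi> 0 = x" by (simp add: eq)
    fix t :: real assume t: "0 \<le> t"
    have "((\<lambda>s. x + integral {0..s} f) has_vector_derivative 0 + f t) (at t within {0..t + 1})"
      by (intro derivative_intros integral_has_vector_derivative cf) (use t in auto)
    moreover have "at t within {0..} = at t within {0..t + 1}"
      by (rule at_within_nhd[of t "{..<t + 1}"]) (use t in auto)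
    ultimately have "((\<lambda>s. x + integral {0..s} f) has_vector_derivative X (\<phi> t)) (at t within {0..})"
      by (simp add: f_def \<phi>_def)
    then show "(\<phi> has_vector_derivative X (\<phi> t)) (at t within {0..})"
      by (rule has_vector_derivative_transform[rotated 2]) (use t eq in auto)
  qed
qed

text \<open>Backward time is forward time for \<open>- X\<close>. At the junction t = 0 both
  one-sided derivatives equal \<open>X x\<close>, so the glued curve is differentiable
  there.\<close>

lemma solves_ode_exists:
  fixes X :: "'a::banach \<Rightarrow> 'a"
  assumes lip: "\<And>y z. norm (X y - X z) \<le> L * norm (y - z)" and L: "0 < L"
  obtains \<phi> where "solves_ode X x \<phi>"
proof -
  obtain u where u: "u 0 = x" "\<And>t. 0 \<le> t \<Longrightarrow> (u has_vector_derivative X (u t)) (at t within {0..})"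
    using forward_solution_exists[OF lip L] by metis
  have lip': "norm (- X y - - X z) \<le> L * norm (y - z)" for y z
    using lip[of y z] by (simp add: norm_minus_commute)
  obtain v where v: "v 0 = x" "\<And>t. 0 \<le> t \<Longrightarrow> (v has_vector_derivative - X (v t)) (at t within {0..})"
    using forward_solution_exists[of "\<lambda>y. - X y" L, OF lip' L] by metis
  define \<phi> where "\<phi> t = (if 0 \<le> t then u t else v (- t))" for t
  have pos: "(\<phi> has_vector_derivative X (\<phi> t)) (at t within {0..})" if "0 \<le> t" for t
    using u(2)[OF that]
    by (rule has_vector_derivative_transform[rotated 2, THEN has_vector_derivative_eq_rhs])
      (use that in \<open>auto simp: \<phi>_def\<close>)
  have neg: "(\<phi> has_vector_derivative X (\<phi> t)) (at t within {..0})" if "t \<le> 0" for t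
  proof -
    have "(v has_vector_derivative - X (v (- t))) (at (- t) within uminus ` {..0})"
      using v(2)[of "- t"] that by simp
    moreover have "(uminus has_vector_derivative (- 1 :: real)) (at t within {..0})"
      by (auto intro!: derivative_eq_intros)
    ultimately have "((v \<circ> uminus) has_vector_derivative (- 1) *\<^sub>R - X (v (- t))) (at t within {..0})"
      by (intro vector_diff_chain_within) auto
    then have "((v \<circ> uminus) has_vector_derivative X (v (- t))) (at t within {..0})" by simp
    moreover have "X (v (- t)) = X (\<phi> t)" using that u(1) v(1) by (cases "t = 0") (auto simp: \<phi>_def)
    ultimately show ?thesis
      using has_vector_derivative_transform[of t "{..0}" \<phi> "v \<circ> uminus"] that
      by (simp add: \<phi>_def u(1) v(1))
  qed
  have "(\<phi> has_vector_derivative X (\<phi> t)) (at t)" for t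
  proof -
    consider "0 < t" | "t < 0" | "t = 0" by linarith
    then show ?thesis
    proof cases
      case 1
      then have "at t within {0..} = at t" by (intro at_within_interior) simp
      then show ?thesis using pos[of t] 1 by simp
    next
      case 2
      then have "at t within {..0} = at t" by (intro at_within_interior) simp
      then show ?thesis using neg[of t] 2 by simp
    next
      case 3
      have U: "UNIV = {0..} \<union> {..(0::real)}" by auto
      have "(\<phi> has_derivative (\<lambda>h. h *\<^sub>R X (\<phi> t))) (at t within {0..})"
        "(\<phi> has_derivative (\<lambda>h. h *\<^sub>R X (\<phi> t))) (at t within {..0})"
        using pos[of t] neg[of t] 3 by (simp_all add: has_vector_derivative_def)
      then show ?thesis
        unfolding has_vector_derivative_def has_derivative_within U Lim_within_Un by simp
    qed
  qed
  moreover have "\<phi> 0 = x" by (simp add: \<phi>_def u(1))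
  ultimately show thesis using that by (auto simp: solves_ode_def)
qed

section \<open>Vague convergence on grids\<close>

text \<open>The fibres of this map are half-open cubes of side 1 / (k + 1) that partition the space;
  they are the cells on which measures are compared.\<close>

definition grid_point :: "nat \<Rightarrow> 'a::euclidean_space \<Rightarrow> 'a" where
  "grid_point k x = (\<Sum>b\<in>Basis. (of_int \<lfloor>real (Suc k) * (x \<bullet> b)\<rfloor> / real (Suc k)) *\<^sub>R b)"

lemma grid_point_dist:
  fixes x :: "'a::euclidean_space"
  shows "norm (x - grid_point k x) \<le> DIM('a) / real (Suc k)"
proof -
  have "norm (x - grid_point k x) \<le> (\<Sum>b\<in>Basis. \<bar>(x - grid_point k x) \<bullet> b\<bar>)" by (rule norm_le_l1)
  also have "\<dots> \<le> (\<Sum>b\<in>(Basis::'a set). 1 / real (Suc k))"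
  proof (rule sum_mono)
    fix b :: 'a assume b: "b \<in> Basis"
    define y where "y = real (Suc k) * (x \<bullet> b)"
    have "(x - grid_point k x) \<bullet> b = (y - of_int \<lfloor>y\<rfloor>) / real (Suc k)"
      using b by (simp add: grid_point_def inner_diff_left y_def diff_divide_distrib)
    moreover have "\<bar>y - of_int \<lfloor>y\<rfloor>\<bar> \<le> 1" by linarith
    ultimately show "\<bar>(x - grid_point k x) \<bullet> b\<bar> \<le> 1 / real (Suc k)"
      by (simp add: abs_divide divide_right_mono)
  qed
  also have "\<dots> = DIM('a) / real (Suc k)" by simp
  finally show ?thesis .
qed

lemma grid_point_dist':
  fixes x :: "'a::euclidean_space"
  shows "norm (x - grid_point k x) \<le> DIM('a)"
proof -
  have "real DIM('a) / real (Suc k) \<le> DIM('a) / 1" by (intro divide_left_mono) auto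
  then show ?thesis using grid_point_dist[of x k] by simp
qed

lemma grid_point_vimage_subset:
  fixes y :: "'a::euclidean_space"
  shows "grid_point k -` {y} \<subseteq> cball 0 (norm y + DIM('a))"
proof
  fix x :: 'a assume "x \<in> grid_point k -` {y}"
  then have "norm (x - y) \<le> DIM('a)" using grid_point_dist'[of x k] by simp
  then show "x \<in> cball 0 (norm y + DIM('a))"
    using norm_triangle_ineq[of "x - y" y] by simp
qed

lemma grid_point_measurable [measurable]: "grid_point k \<in> borel_measurable borel"
  unfolding grid_point_def by measurable

lemma countable_range_grid_point: "countable (range (grid_point k :: 'a::euclidean_space \<Rightarrow> 'a))"
proof (rule countable_subset)
  let ?f = "\<lambda>z. \<Sum>b\<in>(Basis::'a set). (of_int (z b) / real (Suc k)) *\<^sub>R b"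
  show "range (grid_point k) \<subseteq> ?f ` (PiE Basis (\<lambda>_. UNIV :: int set))"
  proof (rule image_subsetI)
    fix x :: 'a
    show "grid_point k x \<in> ?f ` (PiE Basis (\<lambda>_. UNIV :: int set))"
      by (rule image_eqI[of _ _ "\<lambda>b\<in>Basis. \<lfloor>real (Suc k) * (x \<bullet> b)\<rfloor>"])
        (auto simp: grid_point_def)
  qed
  show "countable (?f ` (PiE Basis (\<lambda>_. UNIV :: int set)))"
    by (intro countable_image countable_PiE) auto
qed

lemma finite_grid_points:
  "finite {y \<in> range (grid_point k :: 'a::euclidean_space \<Rightarrow> 'a). norm y \<le> R}"
proof (rule finite_subset)
  let ?f = "\<lambda>z. \<Sum>b\<in>(Basis::'a set). (of_int (z b) / real (Suc k)) *\<^sub>R b"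
  let ?N = "\<lceil>real (Suc k) * R\<rceil>"
  show "{y \<in> range (grid_point k). norm y \<le> R} \<subseteq> ?f ` (PiE Basis (\<lambda>_. {- ?N..?N}))"
  proof clarify
    fix x :: 'a assume n: "norm (grid_point k x) \<le> R"
    have "\<lfloor>real (Suc k) * (x \<bullet> b)\<rfloor> \<in> {- ?N..?N}" if b: "b \<in> Basis" for b
    proof -
      have "\<bar>grid_point k x \<bullet> b\<bar> \<le> R" using Basis_le_norm[OF b] n order_trans by blast
      then have "\<bar>of_int \<lfloor>real (Suc k) * (x \<bullet> b)\<rfloor>\<bar> \<le> real (Suc k) * R"
        using b by (simp add: grid_point_def abs_divide field_simps)
      then show ?thesis by (simp only: atLeastAtMost_iff) linarith
    qed
    then show "grid_point k x \<in> ?f ` (PiE Basis (\<lambda>_. {- ?N..?N}))"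
      by (intro image_eqI[of _ _ "\<lambda>b\<in>Basis. \<lfloor>real (Suc k) * (x \<bullet> b)\<rfloor>"])
        (auto simp: grid_point_def)
  qed
  show "finite (?f ` (PiE Basis (\<lambda>_. {- ?N..?N})))"
    by (intro finite_imageI finite_PiE) auto
qed

lemma emeasure_cball_subset_finite:
  fixes M :: "'a::euclidean_space measure"
  assumes "locally_finite_borel M" "A \<subseteq> cball 0 R"
  shows "emeasure M A < \<infinity>"
proof -
  have "emeasure M A \<le> emeasure M (cball 0 R)"
    using assms by (intro emeasure_mono) (auto simp: locally_finite_borel_def)
  also have "\<dots> < \<infinity>" using assms by (auto simp: locally_finite_borel_def)
  finally show ?thesis .
qed

text \<open>Composed with \<open>grid_point k\<close>, \<open>f\<close> becomes a step function with
  finitely many nonzero cells, so its integral is a finite combination of cell masses. Only the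
  rounding error, supported in a ball, separates it from the integral of \<open>f\<close>.\<close>

lemma integral_grid_approx:
  fixes M :: "'a::euclidean_space measure" and f :: "'a \<Rightarrow> real"
  assumes M: "locally_finite_borel M" and f: "continuous_on UNIV f"
    and supp: "\<And>x. f x \<noteq> 0 \<Longrightarrow> norm x \<le> R"
    and close: "\<And>x. \<bar>f x - f (grid_point k x)\<bar> \<le> e * indicator (cball 0 S) x"
  shows "\<bar>integral\<^sup>L M f - (\<Sum>y\<in>{y \<in> range (grid_point k). norm y \<le> R}. f y * measure M (grid_point k -` {y}))\<bar>
    \<le> e * measure M (cball 0 S)"
proof -
  let ?Y = "{y \<in> range (grid_point k :: 'a \<Rightarrow> 'a). norm y \<le> R}"
  have sM [measurable_cong]: "sets M = sets borel" using M by (simp add: locally_finite_borel_def)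
  have spM: "space M = UNIV" using sets_eq_imp_space_eq[OF sM] by simp
  have [measurable]: "f \<in> borel_measurable M"
    using borel_measurable_continuous_onI[OF f] by (simp add: measurable_cong_sets[OF sM refl])
  have cell [measurable]: "grid_point k -` {y} \<in> sets M" for y :: 'a
    using measurable_sets[OF grid_point_measurable, of "{y}" k] by (simp add: sM)
  have cellfin: "emeasure M (grid_point k -` {y}) < \<infinity>" for y :: 'a
    by (rule emeasure_cball_subset_finite[OF M grid_point_vimage_subset])
  have ic: "integrable M (\<lambda>x. e * indicator (cball 0 S) x)"
    using emeasure_cball_subset_finite[OF M order_refl, of S] by (auto intro!: integrable_real_indicator simp: sM)
  have fin: "finite ?Y" by (rule finite_grid_points)
  define g where "g x = (\<Sum>y\<in>?Y. f y * indicator (grid_point k -` {y}) x)" for x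
  have g: "g x = f (grid_point k x)" for x
  proof -
    have "g x = (\<Sum>y\<in>?Y. if y = grid_point k x then f (grid_point k x) else 0)"
      unfolding g_def by (rule sum.cong) (auto simp: indicator_def)
    also have "\<dots> = (if grid_point k x \<in> ?Y then f (grid_point k x) else 0)"
      by (subst sum.delta[OF fin]) simp
    finally show ?thesis using supp[of "grid_point k x"] by auto
  qed
  have ig: "integrable M g" unfolding g_def
    using cellfin by (intro Bochner_Integration.integrable_sum integrable_mult_right integrable_real_indicator) auto
  have id: "integrable M (\<lambda>x. f x - g x)"
    by (rule Bochner_Integration.integrable_bound[OF ic])
      (use close in \<open>auto simp: g intro!: AE_I2 borel_measurable_diff borel_measurable_integrable[OF ig]
        intro: order_trans[OF _ abs_ge_self]\<close>)
  have if': "integrable M f" using Bochner_Integration.integrable_add[OF id ig] by simp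
  have "integral\<^sup>L M g = (\<Sum>y\<in>?Y. f y * measure M (grid_point k -` {y}))"
    unfolding g_def using cellfin
    by (subst Bochner_Integration.integral_sum)
      (auto intro!: integrable_mult_right integrable_real_indicator simp: spM)
  then have "\<bar>integral\<^sup>L M f - (\<Sum>y\<in>?Y. f y * measure M (grid_point k -` {y}))\<bar> = \<bar>\<integral>x. f x - g x \<partial>M\<bar>"
    using if' ig by simp
  also have "\<dots> \<le> (\<integral>x. e * indicator (cball 0 S) x \<partial>M)"
    unfolding real_norm_def[symmetric]
    by (rule Bochner_Integration.integral_norm_bound_integral[OF id ic]) (use close in \<open>simp add: g\<close>)
  also have "\<dots> = e * measure M (cball 0 S)" by (simp add: spM)
  finally show ?thesis .
qed

text \<open>Uniform continuity makes the rounding error small against the uniform mass bound on a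
  ball; on the grid so fixed, only finitely many cell masses have to converge.\<close>

lemma vague_limit_gridI:
  fixes \<mu> :: "nat \<Rightarrow> 'a::euclidean_space measure" and \<nu> :: "'a measure"
  assumes lf: "\<And>n. locally_finite_borel (\<mu> n)" "locally_finite_borel \<nu>"
    and bd: "\<And>R. \<exists>C. \<forall>n. measure (\<mu> n) (cball 0 R) \<le> C"
    and conv: "\<And>k y. y \<in> range (grid_point k) \<Longrightarrow>
      (\<lambda>n. measure (\<mu> n) (grid_point k -` {y})) \<longlonglongrightarrow> measure \<nu> (grid_point k -` {y})"
  shows "vague_limit \<mu> \<nu>"
  unfolding vague_limit_def
proof (intro conjI allI impI lf, elim conjE)
  fix f :: "'a \<Rightarrow> real"
  assume f: "continuous_on UNIV f" and cpt: "compact (closure {x. f x \<noteq> 0})"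
  obtain R where R: "\<And>x. f x \<noteq> 0 \<Longrightarrow> norm x \<le> R"
    using compact_imp_bounded[OF cpt] closure_subset by (force simp: bounded_iff)
  obtain C where C: "\<And>n. measure (\<mu> n) (cball 0 (R + 1)) \<le> C" using bd by blast
  have C0: "0 \<le> C" using order_trans[OF measure_nonneg C] .
  \<comment> \<open>\<open>Z\<close> is chosen so that the two rounding errors, e C and e times the
    \<nu>-mass of the ball, add up to less than r / 2. The summand 1 makes this inequality strict
    and \<open>Z\<close> positive.\<close>
  define Z where "Z = 2 * (C + measure \<nu> (cball 0 (R + 1)) + 1)"
  have Z: "0 < Z" using C0 by (simp add: Z_def add_nonneg_pos)
  show "(\<lambda>n. integral\<^sup>L (\<mu> n) f) \<longlonglongrightarrow> integral\<^sup>L \<nu> f"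
  proof (rule LIMSEQ_I)
    fix r :: real assume r: "0 < r"
    define e where "e = r / Z"
    have e: "0 < e" using r Z by (simp add: e_def)
    \<comment> \<open>Radius R + 1 holds every point at which rounding can change the value of
      \<open>f\<close>; rounding moves such a point by less than 1, hence R + 2.\<close>
    have "uniformly_continuous_on (cball 0 (R + 2)) f"
      by (rule compact_uniformly_continuous[OF continuous_on_subset[OF f]]) auto
    then obtain d where d: "0 < d" "\<And>x y. x \<in> cball 0 (R + 2) \<Longrightarrow> y \<in> cball 0 (R + 2) \<Longrightarrow>
        dist y x < d \<Longrightarrow> dist (f y) (f x) < e"
      using e unfolding uniformly_continuous_on_def by metis
    obtain k where "DIM('a) / min d 1 < real k" using reals_Archimedean2 by blast
    then have "DIM('a) / min d 1 < real (Suc k)" by simp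
    then have k: "DIM('a) / real (Suc k) < min d 1" using d(1)
      by (subst pos_divide_less_eq, simp, subst (asm) pos_divide_less_eq) (simp_all add: mult.commute)
    have gd: "norm (x - grid_point k x) < d" "norm (x - grid_point k x) < 1" for x :: 'a
      using order_le_less_trans[OF grid_point_dist[of x k] k] by simp_all
    have close: "\<bar>f x - f (grid_point k x)\<bar> \<le> e * indicator (cball 0 (R + 1)) x" for x
    proof (cases "norm x \<le> R + 1")
      case True
      moreover have "norm (grid_point k x) \<le> R + 2"
        using gd(2)[of x] True norm_triangle_ineq2[of "grid_point k x" x] by (simp add: norm_minus_commute)
      ultimately have "dist (f x) (f (grid_point k x)) < e"
        using gd(1)[of x] by (intro d(2)) (auto simp: dist_norm)
      then show ?thesis using True by (simp add: dist_real_def)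
    next
      case False
      then have "norm (grid_point k x) > R"
        using gd(2)[of x] norm_triangle_ineq2[of x "grid_point k x"] by simp
      then have "f (grid_point k x) = 0" "f x = 0" using R[of "grid_point k x"] R[of x] False by fastforce+
      then show ?thesis using e by simp
    qed
    define s where "s M = (\<Sum>y\<in>{y \<in> range (grid_point k). norm y \<le> R}. f y * measure M (grid_point k -` {y}))" for M
    have "(\<lambda>n. s (\<mu> n)) \<longlonglongrightarrow> s \<nu>" unfolding s_def
      by (intro tendsto_sum tendsto_mult tendsto_const conv) auto
    then obtain N where N: "\<And>n. N \<le> n \<Longrightarrow> \<bar>s (\<mu> n) - s \<nu>\<bar> < r / 2"
      using LIMSEQ_D[of _ _ "r / 2"] r by fastforce
    have "\<bar>integral\<^sup>L (\<mu> n) f - integral\<^sup>L \<nu> f\<bar> < r" if "N \<le> n" for n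
    proof -
      have "\<bar>integral\<^sup>L (\<mu> n) f - s (\<mu> n)\<bar> \<le> e * measure (\<mu> n) (cball 0 (R + 1))"
        unfolding s_def by (rule integral_grid_approx[OF lf(1) f R close])
      also have "\<dots> \<le> e * C" using C e by simp
      finally have 1: "\<bar>integral\<^sup>L (\<mu> n) f - s (\<mu> n)\<bar> \<le> e * C" .
      have 2: "\<bar>integral\<^sup>L \<nu> f - s \<nu>\<bar> \<le> e * measure \<nu> (cball 0 (R + 1))"
        unfolding s_def by (rule integral_grid_approx[OF lf(2) f R close])
      have "e * C + e * measure \<nu> (cball 0 (R + 1)) = e * (Z / 2) - e" by (simp add: Z_def algebra_simps)
      also have "e * (Z / 2) - e < r / 2"
      proof -
        have "e * (Z / 2) = r / 2" using Z by (simp add: e_def)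
        then show ?thesis using e by linarith
      qed
      finally show ?thesis using 1 2 N[OF that] by linarith
    qed
    then show "\<exists>no. \<forall>n\<ge>no. norm (integral\<^sup>L (\<mu> n) f - integral\<^sup>L \<nu> f) < r"
      by (intro exI[of _ N]) simp
  qed
qed

section \<open>Lattice sums and partial derivatives\<close>

text \<open>Uniformity in \<open>x\<close> comes from measuring distances from the floor of
  \<open>x\<close>. Each distance occurs for at most one integer on either side, which bounds the
  sum, up to the constant \<open>Z\<close>, by twice a convergent series.\<close>

lemma int_powr_sum_bound:
  assumes s: "1 < (s::real)"
  obtains K where "0 \<le> K" "\<And>x (F::int set). finite F \<Longrightarrow>
    (\<Sum>k\<in>F. (1 + (x - real_of_int k)\<^sup>2) powr (- s / 2)) \<le> K"
proof -
  define g where "g a = (1 + real a) powr (- s)" for a :: nat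
  have sg: "summable g"
  proof -
    have "summable (\<lambda>n. real n powr (- s))" using s by (simp add: summable_real_powr_iff)
    then have "summable (\<lambda>n. real (Suc n) powr (- s))" by (subst summable_Suc_iff)
    then show ?thesis by (simp add: g_def[abs_def] add.commute)
  qed
  have g0: "0 \<le> g a" for a by (simp add: g_def)
  \<comment> \<open>The 8 stems from (1 + a)^2 <= (2 + y)^2 <= 8 (1 + y^2), where y is the distance
    from x and a the distance from its floor.\<close>
  define Z where "Z = 8 powr (s / 2)"
  have Z: "0 \<le> Z" by (simp add: Z_def)
  have pointwise: "(1 + (x - real_of_int k)\<^sup>2) powr (- s / 2) \<le> Z * g (nat \<bar>k - \<lfloor>x\<rfloor>\<bar>)" for x k
  proof -
    define a where "a = real (nat \<bar>k - \<lfloor>x\<rfloor>\<bar>)"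
    define y where "y = \<bar>x - real_of_int k\<bar>"
    have a: "a = \<bar>real_of_int k - real_of_int \<lfloor>x\<rfloor>\<bar>" by (simp add: a_def)
    have "a \<le> y + 1" unfolding a y_def by linarith
    then have "(1 + a)\<^sup>2 \<le> (2 + y)\<^sup>2" by (intro power_mono) (auto simp: a)
    also have "\<dots> \<le> 8 * (1 + y\<^sup>2)"
    proof -
      have "0 \<le> (y - 2)\<^sup>2 + 6 * y\<^sup>2" by simp
      then show ?thesis by (simp add: power2_eq_square algebra_simps)
    qed
    finally have le: "(1 + a)\<^sup>2 \<le> 8 * (1 + y\<^sup>2)" .
    have a0: "0 \<le> a" by (simp add: a)
    have "(8 * (1 + y\<^sup>2)) powr (- s / 2) \<le> ((1 + a)\<^sup>2) powr (- s / 2)"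
      by (rule powr_mono2') (use s le a0 in auto)
    also have "((1 + a)\<^sup>2) powr (- s / 2) = (1 + a) powr (- s)"
    proof -
      have "(1 + a)\<^sup>2 = (1 + a) powr 2" using a0 by simp
      then show ?thesis by (simp only: powr_powr) simp
    qed
    finally have "Z * (8 * (1 + y\<^sup>2)) powr (- s / 2) \<le> Z * g (nat \<bar>k - \<lfloor>x\<rfloor>\<bar>)"
      using Z by (intro mult_left_mono) (simp_all add: g_def a_def)
    moreover have "Z * (8 * (1 + y\<^sup>2)) powr (- s / 2) = (1 + y\<^sup>2) powr (- s / 2)"
    proof -
      have "(8 * (1 + y\<^sup>2)) powr (- s / 2) = 8 powr (- s / 2) * (1 + y\<^sup>2) powr (- s / 2)"
        by (rule powr_mult)
      moreover have "Z * 8 powr (- s / 2) = 1" by (simp add: Z_def powr_add[symmetric])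
      ultimately show ?thesis by simp
    qed
    ultimately show ?thesis by (simp add: y_def)
  qed
  show thesis
  proof
    show "0 \<le> Z * (2 * suminf g)" using Z suminf_nonneg[OF sg g0] by simp
    fix x :: real and F :: "int set" assume F: "finite F"
    define m where "m = \<lfloor>x\<rfloor>"
    have half: "(\<Sum>k\<in>G. g (nat \<bar>k - m\<bar>)) \<le> suminf g"
      if "finite G" "inj_on (\<lambda>k. nat \<bar>k - m\<bar>) G" for G
    proof -
      have "(\<Sum>k\<in>G. g (nat \<bar>k - m\<bar>)) = sum g ((\<lambda>k. nat \<bar>k - m\<bar>) ` G)"
        using that(2) by (simp add: sum.reindex)
      also have "\<dots> \<le> suminf g" using that(1) g0 by (intro sum_le_suminf[OF sg]) auto
      finally show ?thesis .
    qed
    have "(\<Sum>k\<in>F. (1 + (x - real_of_int k)\<^sup>2) powr (- s / 2)) \<le> (\<Sum>k\<in>F. Z * g (nat \<bar>k - m\<bar>))"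
      unfolding m_def by (intro sum_mono pointwise)
    also have "\<dots> = Z * ((\<Sum>k\<in>F \<inter> {m..}. g (nat \<bar>k - m\<bar>)) + (\<Sum>k\<in>F - {m..}. g (nat \<bar>k - m\<bar>)))"
      using sum.Int_Diff[OF F, of "\<lambda>k. g (nat \<bar>k - m\<bar>)" "{m..}"]
      by (simp only: sum_distrib_left[symmetric])
    also have "\<dots> \<le> Z * (suminf g + suminf g)"
      using F by (intro mult_left_mono add_mono half Z) (auto simp: inj_on_def)
    finally show "(\<Sum>k\<in>F. (1 + (x - real_of_int k)\<^sup>2) powr (- s / 2)) \<le> Z * (2 * suminf g)"
      by (simp add: algebra_simps)
  qed
qed

definition real_vec :: "int^'n \<Rightarrow> real^'n" where
  "real_vec k = (\<chi> i. real_of_int (k $ i))"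

definition decay :: "real \<Rightarrow> real^'n::finite \<Rightarrow> real" where
  "decay \<epsilon> q = (1 + (norm q)\<^sup>2) powr (- (real CARD('n) + \<epsilon>) / 2)"

lemma decay_nonneg [simp]: "0 \<le> decay \<epsilon> q"
  by (simp add: decay_def)

text \<open>The exponent d + \<epsilon> is shared equally among the d coordinates. Each factor keeps
  1 + \<epsilon>/d, above the threshold 1 for summability over the integers, and replacing |y|^2 by
  a single squared coordinate only increases it.\<close>

lemma decay_le_prod:
  fixes y :: "real^'n::finite"
  assumes "0 < \<epsilon>"
  shows "decay \<epsilon> y \<le> (\<Prod>i\<in>UNIV. (1 + (y $ i)\<^sup>2) powr (- (1 + \<epsilon> / real CARD('n)) / 2))"
proof -
  let ?d = "real CARD('n)" and ?s = "1 + \<epsilon> / real CARD('n)"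
  have "decay \<epsilon> y = (\<Prod>i\<in>(UNIV::'n set). (1 + (norm y)\<^sup>2) powr (- ?s / 2))"
  proof -
    have "- (?d + \<epsilon>) / 2 = (- ?s / 2) * ?d" by (simp add: field_simps)
    then have "decay \<epsilon> y = ((1 + (norm y)\<^sup>2) powr (- ?s / 2)) powr ?d"
      unfolding decay_def powr_powr by (simp only:)
    also have "\<dots> = ((1 + (norm y)\<^sup>2) powr (- ?s / 2)) ^ CARD('n)"
      by (rule powr_realpow) (simp add: add_pos_nonneg powr_gt_zero sum_power2_gt_zero_iff add_nonneg_eq_0_iff)
    finally show ?thesis by simp
  qed
  also have "\<dots> \<le> (\<Prod>i\<in>UNIV. (1 + (y $ i)\<^sup>2) powr (- ?s / 2))"
  proof (intro prod_mono conjI powr_mono2')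
    fix i
    show "1 + (y $ i)\<^sup>2 \<le> 1 + (norm y)\<^sup>2"
      using component_le_norm_cart[of y i] power_mono[of "\<bar>y $ i\<bar>" "norm y" 2] by simp
    have "0 \<le> \<epsilon> / ?d" using assms by simp
    then show "- ?s / 2 \<le> 0" by (simp only: divide_le_0_iff) simp
  qed (auto simp: add_pos_nonneg)
  finally show ?thesis .
qed

text \<open>A finite index set lies in a product of finite sets of integers; over that product the
  sum of products factors into one-dimensional sums.\<close>

lemma int_vec_decay_sum_bound:
  assumes e: "0 < \<epsilon>"
  obtains K where "0 \<le> K" "\<And>(x::real^'n::finite) F. finite F \<Longrightarrow>
    (\<Sum>k\<in>F. decay \<epsilon> (x - real_vec k)) \<le> K"
proof -
  define s where "s = 1 + \<epsilon> / real CARD('n)"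
  have s: "1 < s" using e by (simp add: s_def)
  obtain K where K: "0 \<le> K" "\<And>x (F::int set). finite F \<Longrightarrow>
      (\<Sum>k\<in>F. (1 + (x - real_of_int k)\<^sup>2) powr (- s / 2)) \<le> K"
    using int_powr_sum_bound[OF s] by metis
  show thesis
  proof
    show "0 \<le> K ^ CARD('n)" using K(1) by simp
    fix x :: "real^'n" and F :: "(int^'n) set" assume F: "finite F"
    define G where "G = (\<Union>i. (\<lambda>k. k $ i) ` F)"
    have G: "finite G" using F by (simp add: G_def)
    define h where "h i j = (1 + ((x :: real^'n) $ i - real_of_int j)\<^sup>2) powr (- s / 2)" for i j
    have "(\<Sum>k\<in>F. decay \<epsilon> (x - real_vec k)) \<le> (\<Sum>k\<in>F. \<Prod>i\<in>UNIV. h i (k $ i))"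
    proof (rule sum_mono)
      fix k
      show "decay \<epsilon> (x - real_vec k) \<le> (\<Prod>i\<in>UNIV. h i (k $ i))"
        using decay_le_prod[OF e, of "x - real_vec k"] by (simp add: h_def s_def real_vec_def)
    qed
    also have "\<dots> = (\<Sum>g\<in>vec_nth ` F. \<Prod>i\<in>UNIV. h i (g i))"
      by (subst sum.reindex) (auto simp: inj_on_def vec_nth_inject)
    also have "\<dots> \<le> (\<Sum>g\<in>PiE UNIV (\<lambda>_. G). \<Prod>i\<in>UNIV. h i (g i))"
      by (rule sum_mono2) (auto simp: G G_def h_def intro!: finite_PiE prod_nonneg F)
    also have "\<dots> = (\<Prod>i\<in>UNIV. \<Sum>j\<in>G. h i j)"
      by (rule prod_sum_PiE[symmetric]) (use G in auto)
    also have "\<dots> \<le> (\<Prod>i\<in>(UNIV::'n set). K)"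
      using K(2)[OF G] by (intro prod_mono conjI sum_nonneg) (auto simp: h_def)
    finally show "(\<Sum>k\<in>F. decay \<epsilon> (x - real_vec k)) \<le> K ^ CARD('n)" by simp
  qed
qed

section \<open>From integer vectors to a general lattice\<close>

definition basis_comb :: "('n::finite \<Rightarrow> real^'n) \<Rightarrow> real^'n \<Rightarrow> real^'n" where
  "basis_comb b x = (\<Sum>i\<in>UNIV. x $ i *\<^sub>R b i)"

lemma linear_basis_comb: "linear (basis_comb b)"
  by (rule linearI) (simp_all add: basis_comb_def scaleR_add_left sum.distrib scaleR_sum_right)

lemma inj_basis_comb:
  assumes "is_lattice_basis b" shows "inj (basis_comb b)"
proof (subst linear_injective_0[OF linear_basis_comb], intro allI impI)
  fix x assume "basis_comb b x = 0"
  then have "(\<Sum>v\<in>range b. (x $ inv b v) *\<^sub>R v) = 0"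
    using assms by (simp add: sum.reindex is_lattice_basis_def basis_comb_def)
  then have "x $ inv b (b i) = 0" for i
    by (rule independentD[rotated 3, of _ "range b"])
      (use assms in \<open>auto simp: is_lattice_basis_def\<close>)
  then show "x = 0" using assms by (simp add: vec_eq_iff is_lattice_basis_def)
qed

lemma lattice_of_eq: "lattice_of (b :: 'n::finite \<Rightarrow> real^'n) = range (\<lambda>k. basis_comb b (real_vec k))"
proof -
  have "(\<Sum>i\<in>UNIV. real_of_int (k i) *\<^sub>R b i) = basis_comb b (real_vec (vec_lambda k))" for k
    by (simp add: basis_comb_def real_vec_def)
  then have "lattice_of b = (\<lambda>k. basis_comb b (real_vec k)) ` range vec_lambda"
    by (auto simp: lattice_of_def)
  also have "range vec_lambda = (UNIV :: (int^'n) set)"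
    by (rule surjI[of _ vec_nth]) (rule vec_nth_inverse)
  finally show ?thesis .
qed

lemma countable_lattice: "countable (lattice_of (b :: 'n::finite \<Rightarrow> real^'n))"
proof -
  have "countable (UNIV :: (int^'n) set)" by (rule countableI_type)
  then show ?thesis unfolding lattice_of_eq by (rule countable_image)
qed

text \<open>An injective linear map is bounded below, so passing to coordinates in the lattice basis
  costs only a constant factor in the decay.\<close>

lemma lattice_decay_sum_bound:
  fixes b :: "'n::finite \<Rightarrow> real^'n"
  assumes b: "is_lattice_basis b" and e: "0 < \<epsilon>"
  obtains S where "0 \<le> S" "\<And>q F. finite F \<Longrightarrow> F \<subseteq> lattice_of b \<Longrightarrow>
    (\<Sum>l\<in>F. decay \<epsilon> (q - l)) \<le> S"
proof -
  let ?f = "basis_comb b" and ?p = "- (real CARD('n) + \<epsilon>) / 2"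
  obtain c' where c': "0 < c'" "\<And>x. c' * norm x \<le> norm (?f x)"
    using linear_inj_bounded_below_pos[OF linear_basis_comb inj_basis_comb[OF b]] by metis
  \<comment> \<open>With the cap at 1, c^2 times 1 + |x|^2 stays below 1 plus the squared norm of
    the image, constant term included.\<close>
  define c where "c = min c' 1"
  have c: "0 < c" "c \<le> 1" using c' by (auto simp: c_def)
  have cn: "c * norm x \<le> norm (?f x)" for x
    using c'(2)[of x] mult_right_mono[of c c' "norm x"] by (simp add: c_def)
  have dec: "decay \<epsilon> (?f x) \<le> (c\<^sup>2) powr ?p * decay \<epsilon> x" for x
  proof -
    have "c\<^sup>2 * (1 + (norm x)\<^sup>2) \<le> 1 + (norm (?f x))\<^sup>2"
      using power_mono[OF cn[of x], of 2] power_mono[of c 1 2] c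
      by (simp add: power_mult_distrib algebra_simps)
    then have "(1 + (norm (?f x))\<^sup>2) powr ?p \<le> (c\<^sup>2 * (1 + (norm x)\<^sup>2)) powr ?p"
      by (intro powr_mono2') (use c e in \<open>auto intro!: mult_pos_pos add_pos_nonneg\<close>)
    then show ?thesis by (simp add: decay_def powr_mult)
  qed
  obtain K where K: "0 \<le> K" "\<And>(x::real^'n) F. finite F \<Longrightarrow>
    (\<Sum>k\<in>F. decay \<epsilon> (x - real_vec k)) \<le> K"
    using int_vec_decay_sum_bound[OF e] by metis
  show thesis
  proof
    show "0 \<le> (c\<^sup>2) powr ?p * K" using K(1) by simp
    fix q and F assume F: "finite F" "F \<subseteq> lattice_of b"
    from F(2) obtain G where G: "F = (\<lambda>k. ?f (real_vec k)) ` G" "inj_on (\<lambda>k. ?f (real_vec k)) G"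
      unfolding lattice_of_eq by (metis subset_image_inj)
    have fG: "finite G" using F(1) G finite_image_iff by blast
    obtain x where x: "q = ?f x"
      using linear_injective_imp_surjective[OF linear_basis_comb inj_basis_comb[OF b]] by (metis surjD)
    have "(\<Sum>l\<in>F. decay \<epsilon> (q - l)) = (\<Sum>k\<in>G. decay \<epsilon> (?f (x - real_vec k)))"
      by (simp add: G(1) sum.reindex[OF G(2)] x linear_diff[OF linear_basis_comb])
    also have "\<dots> \<le> (\<Sum>k\<in>G. (c\<^sup>2) powr ?p * decay \<epsilon> (x - real_vec k))"
      by (intro sum_mono dec)
    also have "\<dots> \<le> (c\<^sup>2) powr ?p * K"
      unfolding sum_distrib_left[symmetric] by (intro mult_left_mono K(2) fG) simp
    finally show "(\<Sum>l\<in>F. decay \<epsilon> (q - l)) \<le> (c\<^sup>2) powr ?p * K" .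
  qed
qed

section \<open>Partial derivatives along coordinate lines\<close>

definition pderiv_at :: "'n::finite \<Rightarrow> (real^'n \<Rightarrow> real) \<Rightarrow> real \<Rightarrow> real^'n \<Rightarrow> bool" where
  "pderiv_at i f D x \<longleftrightarrow> ((\<lambda>t. f (x + t *\<^sub>R axis i 1)) has_real_derivative D) (at 0)"

lemma pderiv_at_partial_deriv: "has_partial i f x \<Longrightarrow> pderiv_at i f (partial_deriv i f x) x"
  unfolding has_partial_def pderiv_at_def partial_deriv_def
  by (simp add: DERIV_deriv_iff_real_differentiable)

lemma partial_deriv_eqI: "pderiv_at i f D x \<Longrightarrow> partial_deriv i f x = D"
  unfolding pderiv_at_def partial_deriv_def by (rule DERIV_imp_deriv)

lemma pderiv_at_translate:
  "pderiv_at i f D (x - l) \<Longrightarrow> pderiv_at i (\<lambda>y. f (y - l)) D x"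
  unfolding pderiv_at_def by (simp add: algebra_simps)

lemma pderiv_at_sum:
  "(\<And>l. l \<in> F \<Longrightarrow> pderiv_at i (f l) (D l) x) \<Longrightarrow> pderiv_at i (\<lambda>y. \<Sum>l\<in>F. f l y) (\<Sum>l\<in>F. D l) x"
  unfolding pderiv_at_def by (rule DERIV_sum)

lemma pderiv_at_line:
  assumes "\<And>x. pderiv_at i f (f' x) x"
  shows "((\<lambda>u. f (x + u *\<^sub>R axis i 1)) has_real_derivative f' (x + u *\<^sub>R axis i 1)) (at u)"
proof -
  have "((\<lambda>t. f (x + (t + u) *\<^sub>R axis i 1)) has_real_derivative f' (x + u *\<^sub>R axis i 1)) (at 0)"
    using assms[of "x + u *\<^sub>R axis i 1"] by (simp add: pderiv_at_def algebra_simps)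
  then show ?thesis using DERIV_shift[of "\<lambda>u. f (x + u *\<^sub>R axis i 1)" _ 0 u] by simp
qed

lemma real_mvt_bound:
  fixes \<phi> :: "real \<Rightarrow> real"
  assumes "\<And>u. u \<in> S \<Longrightarrow> (\<phi> has_real_derivative \<phi>' u) (at u)" "\<And>u. u \<in> S \<Longrightarrow> \<bar>\<phi>' u\<bar> \<le> K"
    and "convex S" "a \<in> S" "c \<in> S"
  shows "\<bar>\<phi> c - \<phi> a\<bar> \<le> K * \<bar>c - a\<bar>"
proof -
  have "norm (\<phi> c - \<phi> a) \<le> K * norm (c - a)"
    by (rule field_differentiable_bound[OF assms(3) has_field_derivative_at_within[OF assms(1)]])
      (use assms in auto)
  then show ?thesis by simp
qed

text \<open>A bound on one of the two mixed second derivatives is enough for the Lipschitz estimate in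
  either direction, so the order of differentiation in a multi-index is irrelevant and Schwarz's
  theorem is not needed.\<close>

lemma partial_lipschitz_swapped:
  fixes f :: "real^'n::finite \<Rightarrow> real"
  assumes fi: "\<And>x. pderiv_at i f (fi x) x" and fk: "\<And>x. pderiv_at k f (fk x) x"
    and fki: "\<And>x. pderiv_at i fk (fki x) x" and bd: "\<And>x. \<bar>fki x\<bar> \<le> K"
  shows "\<bar>fi (x + t *\<^sub>R axis k 1) - fi x\<bar> \<le> K * \<bar>t\<bar>"
proof -
  let ?ei = "axis i 1 :: real^'n" and ?ek = "axis k 1 :: real^'n"
  \<comment> \<open>The second difference is differentiated along direction k, which produces
    \<open>fk\<close>; the resulting difference of \<open>fk\<close> in direction i is bounded
    through \<open>fki\<close>. Division by s and s \<rightarrow> 0 then recover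
    \<open>fi\<close>.\<close>
  have dd: "\<bar>(f (x + t *\<^sub>R ?ek + s *\<^sub>R ?ei) - f (x + t *\<^sub>R ?ek)) - (f (x + s *\<^sub>R ?ei) - f x)\<bar> \<le> K * \<bar>s\<bar> * \<bar>t\<bar>" for s
  proof -
    define \<phi> where "\<phi> u = f ((x + s *\<^sub>R ?ei) + u *\<^sub>R ?ek) - f (x + u *\<^sub>R ?ek)" for u
    have "\<bar>\<phi> t - \<phi> 0\<bar> \<le> (K * \<bar>s\<bar>) * \<bar>t - 0\<bar>"
    proof (rule real_mvt_bound[where S=UNIV])
      fix u
      show "(\<phi> has_real_derivative fk ((x + s *\<^sub>R ?ei) + u *\<^sub>R ?ek) - fk (x + u *\<^sub>R ?ek)) (at u)"
        unfolding \<phi>_def by (intro DERIV_diff pderiv_at_line fk)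
      have "\<bar>fk ((x + u *\<^sub>R ?ek) + s *\<^sub>R ?ei) - fk ((x + u *\<^sub>R ?ek) + 0 *\<^sub>R ?ei)\<bar> \<le> K * \<bar>s - 0\<bar>"
        by (rule real_mvt_bound[where S=UNIV, OF pderiv_at_line[OF fki]]) (use bd in auto)
      then show "\<bar>fk ((x + s *\<^sub>R ?ei) + u *\<^sub>R ?ek) - fk (x + u *\<^sub>R ?ek)\<bar> \<le> K * \<bar>s\<bar>"
        by (simp add: algebra_simps)
    qed auto
    then show ?thesis by (simp add: \<phi>_def algebra_simps)
  qed
  have "(\<lambda>s. ((f (x + t *\<^sub>R ?ek + s *\<^sub>R ?ei) - f (x + t *\<^sub>R ?ek)) / s - (f (x + s *\<^sub>R ?ei) - f x) / s))
      \<midarrow>0\<rightarrow> fi (x + t *\<^sub>R ?ek) - fi x"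
    using fi[of "x + t *\<^sub>R ?ek"] fi[of x] unfolding pderiv_at_def DERIV_def
    by (intro tendsto_diff) simp_all
  then have "(\<lambda>s. \<bar>(f (x + t *\<^sub>R ?ek + s *\<^sub>R ?ei) - f (x + t *\<^sub>R ?ek)) / s - (f (x + s *\<^sub>R ?ei) - f x) / s\<bar>)
      \<midarrow>0\<rightarrow> \<bar>fi (x + t *\<^sub>R ?ek) - fi x\<bar>"
    by (rule tendsto_rabs)
  then show ?thesis
  proof (rule tendsto_upperbound)
    have "\<bar>(f (x + t *\<^sub>R ?ek + s *\<^sub>R ?ei) - f (x + t *\<^sub>R ?ek)) / s - (f (x + s *\<^sub>R ?ei) - f x) / s\<bar> \<le> K * \<bar>t\<bar>"
      if "s \<noteq> 0" for s
      using dd[of s] that by (simp add: diff_divide_distrib[symmetric] abs_divide divide_simps mult_ac)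
    then show "\<forall>\<^sub>F s in at 0. \<bar>(f (x + t *\<^sub>R ?ek + s *\<^sub>R ?ei) - f (x + t *\<^sub>R ?ek)) / s - (f (x + s *\<^sub>R ?ei) - f x) / s\<bar> \<le> K * \<bar>t\<bar>"
      by (auto simp: eventually_at_filter)
  qed simp
qed

text \<open>A Taylor remainder with an explicit constant: such an inequality survives the limit over
  finite partial sums and so justifies termwise differentiation of the potential.\<close>

lemma partial_linearization:
  fixes f :: "real^'n::finite \<Rightarrow> real"
  assumes fi: "\<And>x. pderiv_at i f (fi x) x"
    and lip: "\<And>t. \<bar>fi (x + t *\<^sub>R axis i 1) - fi x\<bar> \<le> K * \<bar>t\<bar>" and K: "0 \<le> K"
  shows "\<bar>f (x + t *\<^sub>R axis i 1) - f x - t * fi x\<bar> \<le> K * t\<^sup>2"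
proof -
  define \<psi> where "\<psi> u = f (x + u *\<^sub>R axis i 1) - u * fi x" for u
  have "\<bar>\<psi> t - \<psi> 0\<bar> \<le> (K * \<bar>t\<bar>) * \<bar>t - 0\<bar>"
  proof (rule real_mvt_bound[where S="{- \<bar>t\<bar>..\<bar>t\<bar>}"])
    fix u assume u: "u \<in> {- \<bar>t\<bar>..\<bar>t\<bar>}"
    show "(\<psi> has_real_derivative fi (x + u *\<^sub>R axis i 1) - fi x) (at u)"
      unfolding \<psi>_def by (auto intro!: derivative_eq_intros pderiv_at_line[OF fi])
    have "K * \<bar>u\<bar> \<le> K * \<bar>t\<bar>" using u K by (intro mult_left_mono) auto
    then show "\<bar>fi (x + u *\<^sub>R axis i 1) - fi x\<bar> \<le> K * \<bar>t\<bar>" using lip[of u] by linarith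
  qed auto
  then show ?thesis by (simp add: \<psi>_def power2_eq_square mult.assoc algebra_simps)
qed

text \<open>One coordinate is moved at a time; each increment is at most the norm of x - y, which
  accounts for \<open>CARD('n)\<close>.\<close>

lemma lipschitz_of_partial_lipschitz:
  fixes f :: "real^'n::finite \<Rightarrow> real"
  assumes lip: "\<And>k x t. \<bar>f (x + t *\<^sub>R axis k 1) - f x\<bar> \<le> K * \<bar>t\<bar>" and K: "0 \<le> K"
  shows "\<bar>f x - f y\<bar> \<le> K * real CARD('n) * norm (x - y)"
proof -
  define z where "z = x - y"
  have "\<bar>f (y + (\<Sum>k\<in>S. (z $ k) *\<^sub>R axis k 1)) - f y\<bar> \<le> K * (\<Sum>k\<in>S. \<bar>z $ k\<bar>)" for S
  proof (induction S rule: finite_induct[OF finite])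
    case (2 k S)
    have "\<bar>f ((y + (\<Sum>k\<in>S. (z $ k) *\<^sub>R axis k 1)) + (z $ k) *\<^sub>R axis k 1)
        - f (y + (\<Sum>k\<in>S. (z $ k) *\<^sub>R axis k 1))\<bar> \<le> K * \<bar>z $ k\<bar>" by (rule lip)
    with 2 show ?case by (simp add: algebra_simps)
  qed simp
  moreover have "(\<Sum>k\<in>UNIV. (z $ k) *\<^sub>R axis k 1) = z"
    using basis_expansion[of z] by (simp add: scalar_mult_eq_scaleR)
  ultimately have "\<bar>f (y + z) - f y\<bar> \<le> K * (\<Sum>k\<in>UNIV. \<bar>z $ k\<bar>)" by metis
  also have "\<dots> \<le> K * (real CARD('n) * norm z)"
    using sum_bounded_above[of UNIV "\<lambda>k. \<bar>z $ k\<bar>" "norm z"]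
    by (intro mult_left_mono[OF _ K]) (simp add: component_le_norm_cart)
  finally have "\<bar>f (y + z) - f y\<bar> \<le> K * (real CARD('n) * norm z)" .
  then show ?thesis by (simp add: z_def mult.assoc)
qed

section \<open>The Hamiltonian flow of a lattice potential\<close>

lemma real_vec_add: "real_vec (k + l) = real_vec k + real_vec l"
  by (simp add: real_vec_def vec_eq_iff)

lemma real_vec_minus: "real_vec (- k) = - real_vec k"
  by (simp add: real_vec_def vec_eq_iff)

text \<open>In \<open>ddW_bound\<close> the alternative stands outside the quantifiers over
  \<open>j\<close> and \<open>x\<close>: \<open>mi_partial\<close> fixes one order of
  differentiation per multi-index, so the bound is available for that order only, but simultaneously
  for all single site potentials.\<close>

locale lattice_potential =
  fixes b :: "'n::finite \<Rightarrow> real^'n" and J :: "'j set"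
    and W :: "'j \<Rightarrow> real^'n \<Rightarrow> real" and \<epsilon> C :: real
  assumes basis: "is_lattice_basis b" and finite_J: "finite J" and eps: "0 < \<epsilon>" and C_nonneg: "0 \<le> C"
    and W_continuous: "j \<in> J \<Longrightarrow> continuous_on UNIV (W j)"
    and dW_continuous: "j \<in> J \<Longrightarrow> continuous_on UNIV (partial_deriv i (W j))"
    and W_partial: "j \<in> J \<Longrightarrow> has_partial i (W j) x"
    and dW_partial: "j \<in> J \<Longrightarrow> has_partial i (partial_deriv k (W j)) x"
    and W_bound: "j \<in> J \<Longrightarrow> \<bar>W j x\<bar> \<le> C * decay \<epsilon> x"
    and dW_bound: "j \<in> J \<Longrightarrow> \<bar>partial_deriv i (W j) x\<bar> \<le> C * decay \<epsilon> x"
    and ddW_bound: "(\<forall>j\<in>J. \<forall>x. \<bar>partial_deriv i (partial_deriv k (W j)) x\<bar> \<le> C * decay \<epsilon> x) \<or>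
      (\<forall>j\<in>J. \<forall>x. \<bar>partial_deriv k (partial_deriv i (W j)) x\<bar> \<le> C * decay \<epsilon> x)"
begin

section \<open>Convergence and differentiation of the potential series\<close>

definition configs :: "(real^'n \<Rightarrow> 'j) set" where
  "configs = {\<omega>. \<forall>l\<in>lattice_of b. \<omega> l \<in> J}"

definition decay_sum :: real where
  "decay_sum = (SOME S. 0 \<le> S \<and> (\<forall>q F. finite F \<longrightarrow> F \<subseteq> lattice_of b \<longrightarrow> (\<Sum>l\<in>F. decay \<epsilon> (q - l)) \<le> S))"

definition bnd :: real where "bnd = C * decay_sum"

lemma decay_sum: "0 \<le> decay_sum"
  "finite F \<Longrightarrow> F \<subseteq> lattice_of b \<Longrightarrow> (\<Sum>l\<in>F. decay \<epsilon> (q - l)) \<le> decay_sum"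
proof -
  have "\<exists>S. 0 \<le> S \<and> (\<forall>q F. finite F \<longrightarrow> F \<subseteq> lattice_of b \<longrightarrow> (\<Sum>l\<in>F. decay \<epsilon> (q - l)) \<le> S)"
    by (rule lattice_decay_sum_bound[OF basis eps]) blast
  from someI_ex[OF this, folded decay_sum_def]
  show "0 \<le> decay_sum" "finite F \<Longrightarrow> F \<subseteq> lattice_of b \<Longrightarrow> (\<Sum>l\<in>F. decay \<epsilon> (q - l)) \<le> decay_sum"
    by blast+
qed

lemma bnd_nonneg: "0 \<le> bnd"
  using decay_sum(1) C_nonneg by (simp add: bnd_def)

lemma decaying_sum_bound:
  assumes "finite F" "F \<subseteq> lattice_of b" "\<And>l. l \<in> F \<Longrightarrow> \<bar>g l\<bar> \<le> C * decay \<epsilon> (q - l)"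
  shows "(\<Sum>l\<in>F. \<bar>g l\<bar>) \<le> bnd"
proof -
  have "(\<Sum>l\<in>F. \<bar>g l\<bar>) \<le> (\<Sum>l\<in>F. C * decay \<epsilon> (q - l))" by (intro sum_mono assms(3))
  also have "\<dots> \<le> bnd" unfolding bnd_def sum_distrib_left[symmetric]
    by (intro mult_left_mono decay_sum(2) assms(1,2) C_nonneg)
  finally show ?thesis .
qed

lemma decaying_summable:
  fixes g :: "real^'n \<Rightarrow> real"
  assumes "\<And>l. l \<in> lattice_of b \<Longrightarrow> \<bar>g l\<bar> \<le> C * decay \<epsilon> (q - l)"
  shows "g summable_on lattice_of b" "\<bar>\<Sum>\<^sub>\<infinity>l\<in>lattice_of b. g l\<bar> \<le> bnd"
proof -
  have "(\<lambda>l. \<bar>g l\<bar>) summable_on lattice_of b"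
  proof (rule nonneg_bdd_above_summable_on)
    show "bdd_above (sum (\<lambda>l. \<bar>g l\<bar>) ` {F. F \<subseteq> lattice_of b \<and> finite F})"
      by (rule bdd_aboveI2[of _ _ bnd]) (auto intro!: decaying_sum_bound[of _ g q] assms)
  qed simp
  then show s: "g summable_on lattice_of b"
    by (rule abs_summable_summable[of g, unfolded real_norm_def])
  have "(sum g \<longlongrightarrow> (\<Sum>\<^sub>\<infinity>l\<in>lattice_of b. g l)) (finite_subsets_at_top (lattice_of b))"
    using has_sum_infsum[OF s] by (simp add: has_sum_def)
  then have "((\<lambda>F. \<bar>sum g F\<bar>) \<longlongrightarrow> \<bar>\<Sum>\<^sub>\<infinity>l\<in>lattice_of b. g l\<bar>) (finite_subsets_at_top (lattice_of b))"
    by (rule tendsto_rabs)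
  then show "\<bar>\<Sum>\<^sub>\<infinity>l\<in>lattice_of b. g l\<bar> \<le> bnd"
  proof (rule tendsto_upperbound)
    have "\<bar>sum g F\<bar> \<le> bnd" if "finite F" "F \<subseteq> lattice_of b" for F
      by (rule order_trans[OF sum_abs decaying_sum_bound[OF that assms]]) (use that in auto)
    then show "\<forall>\<^sub>F F in finite_subsets_at_top (lattice_of b). \<bar>sum g F\<bar> \<le> bnd"
      by (intro eventually_finite_subsets_at_top_weakI)
  qed simp
qed

text \<open>The termwise derivative of the potential; \<open>potential_pderiv\<close> shows that it
  is the actual derivative.\<close>

definition gradV :: "(real^'n \<Rightarrow> 'j) \<Rightarrow> 'n \<Rightarrow> real^'n \<Rightarrow> real" where
  "gradV \<omega> i q = (\<Sum>\<^sub>\<infinity>l\<in>lattice_of b. partial_deriv i (W (\<omega> l)) (q - l))"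

lemma potential_tendsto:
  assumes "\<omega> \<in> configs"
  shows "((\<lambda>F. \<Sum>l\<in>F. W (\<omega> l) (q - l)) \<longlongrightarrow> potential b W \<omega> q) (finite_subsets_at_top (lattice_of b))"
proof -
  have "(\<lambda>l. W (\<omega> l) (q - l)) summable_on lattice_of b"
    by (rule decaying_summable(1)) (use assms in \<open>auto simp: configs_def intro: W_bound\<close>)
  from has_sum_infsum[OF this] show ?thesis by (simp add: has_sum_def potential_def)
qed

lemma potential_bound: "\<omega> \<in> configs \<Longrightarrow> \<bar>potential b W \<omega> q\<bar> \<le> bnd"
  unfolding potential_def
  by (rule decaying_summable(2)[of _ q]) (auto simp: configs_def intro: W_bound)

lemma gradV_tendsto:
  assumes "\<omega> \<in> configs"
  shows "((\<lambda>F. \<Sum>l\<in>F. partial_deriv i (W (\<omega> l)) (q - l)) \<longlongrightarrow> gradV \<omega> i q)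
    (finite_subsets_at_top (lattice_of b))"
proof -
  have "(\<lambda>l. partial_deriv i (W (\<omega> l)) (q - l)) summable_on lattice_of b"
    by (rule decaying_summable(1)) (use assms in \<open>auto simp: configs_def intro: dW_bound\<close>)
  from has_sum_infsum[OF this] show ?thesis by (simp add: has_sum_def gradV_def)
qed

context
  fixes \<omega> F assumes \<omega>: "\<omega> \<in> configs" and F: "finite F" "F \<subseteq> lattice_of b"
begin

lemma partial_sum_pderiv:
  "pderiv_at i (\<lambda>q. \<Sum>l\<in>F. W (\<omega> l) (q - l)) (\<Sum>l\<in>F. partial_deriv i (W (\<omega> l)) (q - l)) q"
  by (intro pderiv_at_sum pderiv_at_translate pderiv_at_partial_deriv W_partial)
    (use \<omega> F in \<open>auto simp: configs_def\<close>)

lemma partial_sum_pderiv2: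
  "pderiv_at k (\<lambda>q. \<Sum>l\<in>F. partial_deriv i (W (\<omega> l)) (q - l))
    (\<Sum>l\<in>F. partial_deriv k (partial_deriv i (W (\<omega> l))) (q - l)) q"
  by (intro pderiv_at_sum pderiv_at_translate pderiv_at_partial_deriv dW_partial)
    (use \<omega> F in \<open>auto simp: configs_def\<close>)

text \<open>The constant is independent of the finite set \<open>F\<close>, which is what allows the
  limit over \<open>F\<close>. Depending on which mixed derivative is bounded, the estimate is a
  direct mean value argument or the swapped one.\<close>

lemma partial_sum_lipschitz:
  "\<bar>(\<Sum>l\<in>F. partial_deriv i (W (\<omega> l)) (q + t *\<^sub>R axis k 1 - l)) - (\<Sum>l\<in>F. partial_deriv i (W (\<omega> l)) (q - l))\<bar>
    \<le> bnd * \<bar>t\<bar>"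
proof -
  have sb: "\<bar>\<Sum>l\<in>F. g l\<bar> \<le> bnd" if "\<And>l. l \<in> F \<Longrightarrow> \<bar>g l\<bar> \<le> C * decay \<epsilon> (x - l)" for g x
    using order_trans[OF sum_abs decaying_sum_bound[OF F that]] by simp
  have \<omega>J: "\<omega> l \<in> J" if "l \<in> F" for l using \<omega> F that by (auto simp: configs_def)
  from ddW_bound[of i k] show ?thesis
  proof
    assume H: "\<forall>j\<in>J. \<forall>x. \<bar>partial_deriv i (partial_deriv k (W j)) x\<bar> \<le> C * decay \<epsilon> x"
    show ?thesis
      by (rule partial_lipschitz_swapped[OF partial_sum_pderiv partial_sum_pderiv partial_sum_pderiv2])
        (rule sb, use H \<omega>J in auto)
  next
    assume H: "\<forall>j\<in>J. \<forall>x. \<bar>partial_deriv k (partial_deriv i (W j)) x\<bar> \<le> C * decay \<epsilon> x"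
    have "\<bar>(\<Sum>l\<in>F. partial_deriv i (W (\<omega> l)) (q + t *\<^sub>R axis k 1 - l))
        - (\<Sum>l\<in>F. partial_deriv i (W (\<omega> l)) (q + 0 *\<^sub>R axis k 1 - l))\<bar> \<le> bnd * \<bar>t - 0\<bar>"
      by (rule real_mvt_bound[where S=UNIV, OF pderiv_at_line[OF partial_sum_pderiv2]])
        (rule sb | use H \<omega>J in auto)+
    then show ?thesis by simp
  qed
qed

lemma partial_sum_linearization:
  "\<bar>(\<Sum>l\<in>F. W (\<omega> l) (q + t *\<^sub>R axis i 1 - l)) - (\<Sum>l\<in>F. W (\<omega> l) (q - l))
    - t * (\<Sum>l\<in>F. partial_deriv i (W (\<omega> l)) (q - l))\<bar> \<le> bnd * t\<^sup>2"
  by (rule partial_linearization[OF partial_sum_pderiv partial_sum_lipschitz bnd_nonneg])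

end

lemma gradV_lipschitz1:
  assumes "\<omega> \<in> configs"
  shows "\<bar>gradV \<omega> i (q + t *\<^sub>R axis k 1) - gradV \<omega> i q\<bar> \<le> bnd * \<bar>t\<bar>"
  by (rule tendsto_upperbound[OF tendsto_rabs[OF tendsto_diff[OF gradV_tendsto[OF assms] gradV_tendsto[OF assms]]]])
    (auto intro!: eventually_finite_subsets_at_top_weakI partial_sum_lipschitz assms)

lemma potential_linearization:
  assumes "\<omega> \<in> configs"
  shows "\<bar>potential b W \<omega> (q + t *\<^sub>R axis i 1) - potential b W \<omega> q - t * gradV \<omega> i q\<bar> \<le> bnd * t\<^sup>2"
  by (rule tendsto_upperbound[OF tendsto_rabs[OF tendsto_diff[OF tendsto_diff[OF
        potential_tendsto[OF assms] potential_tendsto[OF assms]] tendsto_mult[OF tendsto_const gradV_tendsto[OF assms]]]]])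
    (auto intro!: eventually_finite_subsets_at_top_weakI partial_sum_linearization assms)

text \<open>The quadratic remainder is uniform over partial sums, so in the limit the difference
  quotient misses \<open>gradV\<close> by at most \<open>bnd\<close> times |t|.\<close>

lemma potential_pderiv:
  assumes "\<omega> \<in> configs"
  shows "pderiv_at i (potential b W \<omega>) (gradV \<omega> i q) q"
  unfolding pderiv_at_def DERIV_def
proof (rule LIM_zero_cancel, rule Lim_null_comparison[where g="\<lambda>t. bnd * \<bar>t\<bar>"])
  have "\<bar>(potential b W \<omega> (q + t *\<^sub>R axis i 1) - potential b W \<omega> q) / t - gradV \<omega> i q\<bar> \<le> bnd * \<bar>t\<bar>"
    if "t \<noteq> 0" for t
  proof -
    have "(potential b W \<omega> (q + t *\<^sub>R axis i 1) - potential b W \<omega> q) / t - gradV \<omega> i q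
        = (potential b W \<omega> (q + t *\<^sub>R axis i 1) - potential b W \<omega> q - t * gradV \<omega> i q) / t"
      using that by (simp add: field_simps)
    also have "\<bar>\<dots>\<bar> \<le> bnd * t\<^sup>2 / \<bar>t\<bar>"
      unfolding abs_divide by (intro divide_right_mono potential_linearization assms) simp
    also have "\<dots> = bnd * \<bar>t\<bar>"
      using that by (simp add: power2_eq_square) (simp add: abs_if)
    finally show ?thesis .
  qed
  then show "\<forall>\<^sub>F t in at 0. norm ((potential b W \<omega> (q + (0 + t) *\<^sub>R axis i 1) - potential b W \<omega> (q + 0 *\<^sub>R axis i 1)) / t
      - gradV \<omega> i q) \<le> bnd * \<bar>t\<bar>"
    by (auto simp: eventually_at_filter)
  show "((\<lambda>t. bnd * \<bar>t\<bar>) \<longlongrightarrow> 0) (at 0)"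
    by (rule tendsto_eq_intros | simp)+
qed

lemma grad_potential:
  assumes "\<omega> \<in> configs"
  shows "grad (potential b W \<omega>) q = (\<chi> i. gradV \<omega> i q)"
  unfolding grad_def partial_deriv_eqI[OF potential_pderiv[OF assms]] ..

text \<open>One factor \<open>CARD('n)\<close> comes from the coordinatewise Lipschitz estimate, the
  other from summing the components of the gradient. The summand 1 is the Lipschitz constant of the
  right side of q' = p and makes \<open>lip\<close> positive.\<close>

definition lip :: real where "lip = real CARD('n) * (bnd * real CARD('n)) + 1"

lemma lip_pos: "0 < lip"
  using bnd_nonneg by (simp add: lip_def add_nonneg_pos)

lemma grad_potential_lipschitz:
  assumes "\<omega> \<in> configs"
  shows "norm (grad (potential b W \<omega>) x - grad (potential b W \<omega>) y) \<le> (lip - 1) * norm (x - y)"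
proof -
  have "norm (grad (potential b W \<omega>) x - grad (potential b W \<omega>) y)
      \<le> (\<Sum>i\<in>UNIV. \<bar>gradV \<omega> i x - gradV \<omega> i y\<bar>)"
    using norm_le_l1_cart[of "grad (potential b W \<omega>) x - grad (potential b W \<omega>) y"]
    by (simp add: grad_potential[OF assms])
  also have "\<dots> \<le> (\<Sum>i\<in>(UNIV::'n set). bnd * real CARD('n) * norm (x - y))"
    by (intro sum_mono lipschitz_of_partial_lipschitz gradV_lipschitz1 assms bnd_nonneg)
  also have "\<dots> = (lip - 1) * norm (x - y)" by (simp add: lip_def)
  finally show ?thesis .
qed

section \<open>The Hamiltonian vector field and its flow\<close>

abbreviation H :: "(real^'n \<Rightarrow> 'j) \<Rightarrow> (real^'n) \<times> (real^'n) \<Rightarrow> real" where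
  "H \<omega> \<equiv> hamiltonian b W \<omega>"

lemma grad_kinetic: "grad (\<lambda>p'. (norm p')\<^sup>2 / 2 + c) p = p"
proof -
  have "pderiv_at i (\<lambda>p'. (norm p')\<^sup>2 / 2 + c) (p $ i) p" for i
  proof -
    have eq: "(norm (p + t *\<^sub>R axis i 1))\<^sup>2 / 2 + c = (norm p)\<^sup>2 / 2 + t * (p $ i) + t\<^sup>2 / 2 + c" for t
      unfolding power2_norm_eq_inner
      by (simp add: inner_add_left inner_add_right inner_axis inner_axis' inner_axis_axis
          power2_eq_square field_simps)
    have "((\<lambda>t. (norm p)\<^sup>2 / 2 + t * (p $ i) + t\<^sup>2 / 2 + c) has_real_derivative p $ i) (at 0)"
      by (auto intro!: derivative_eq_intros)
    then show ?thesis by (simp only: pderiv_at_def eq)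
  qed
  then show ?thesis by (simp add: grad_def partial_deriv_eqI vec_eq_iff)
qed

text \<open>Proved by comparing difference quotients, this holds even where no derivative exists;
  \<open>hamiltonian_field_eq\<close> is thereby valid for every \<omega>.\<close>

lemma partial_deriv_const_add: "partial_deriv i (\<lambda>q. c + f q) x = partial_deriv i f x"
proof -
  have "((\<lambda>t. c + f (x + t *\<^sub>R axis i 1)) has_real_derivative D) (at 0)
      \<longleftrightarrow> ((\<lambda>t. f (x + t *\<^sub>R axis i 1)) has_real_derivative D) (at 0)" for D
    unfolding DERIV_def by simp
  then show ?thesis by (simp add: partial_deriv_def deriv_def)
qed

lemma hamiltonian_field_eq:
  "hamiltonian_field (H \<omega>) (p, q) = (- grad (potential b W \<omega>) q, p)"
  by (simp add: hamiltonian_field_def hamiltonian_def grad_kinetic)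
    (simp add: grad_def partial_deriv_const_add)

lemma hamiltonian_field_lipschitz:
  assumes "\<omega> \<in> configs"
  shows "norm (hamiltonian_field (H \<omega>) x - hamiltonian_field (H \<omega>) y) \<le> lip * norm (x - y)"
proof -
  obtain p q p' q' where xy: "x = (p, q)" "y = (p', q')" by (metis surj_pair)
  have "norm (hamiltonian_field (H \<omega>) x - hamiltonian_field (H \<omega>) y)
      \<le> norm (grad (potential b W \<omega>) q - grad (potential b W \<omega>) q') + norm (p - p')"
    using norm_Pair_le[of "grad (potential b W \<omega>) q' - grad (potential b W \<omega>) q" "p - p'"]
    by (simp add: xy hamiltonian_field_eq norm_minus_commute)
  also have "\<dots> \<le> (lip - 1) * norm (x - y) + norm (x - y)"
  proof (intro add_mono order_trans[OF grad_potential_lipschitz[OF assms]] mult_left_mono)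
    show "norm (q - q') \<le> norm (x - y)" "norm (p - p') \<le> norm (x - y)"
      using norm_snd_le[of "q - q'" "p - p'"] norm_fst_le[of "p - p'" "q - q'"] by (simp_all add: xy)
    show "0 \<le> lip - 1" using bnd_nonneg by (simp add: lip_def)
  qed
  finally show ?thesis by (simp add: algebra_simps)
qed

text \<open>Existence and uniqueness together make the definite description in
  \<open>hamiltonian_flow\<close> denote the solution.\<close>

lemma flow_solves:
  assumes "\<omega> \<in> configs"
  shows "solves_ode (hamiltonian_field (H \<omega>)) x (\<lambda>t. hamiltonian_flow (H \<omega>) t x)"
proof -
  note lip = hamiltonian_field_lipschitz[OF assms]
  have eq: "hamiltonian_trajectory (H \<omega>) x = solves_ode (hamiltonian_field (H \<omega>)) x"
    by (auto simp: hamiltonian_trajectory_def solves_ode_def)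
  obtain \<phi> where \<phi>: "solves_ode (hamiltonian_field (H \<omega>)) x \<phi>"
    using solves_ode_exists[OF lip lip_pos] by blast
  have "\<exists>!\<phi>. solves_ode (hamiltonian_field (H \<omega>)) x \<phi>"
  proof (rule ex1I[of _ \<phi>])
    show "solves_ode (hamiltonian_field (H \<omega>)) x \<phi>" by (rule \<phi>)
    show "\<psi> = \<phi>" if "solves_ode (hamiltonian_field (H \<omega>)) x \<psi>" for \<psi>
      by (rule solves_ode_unique[OF lip less_imp_le[OF lip_pos] that \<phi>])
  qed
  from theI'[OF this] show ?thesis by (simp add: hamiltonian_flow_def eq)
qed

lemma flow_unique:
  assumes "\<omega> \<in> configs" "solves_ode (hamiltonian_field (H \<omega>)) x \<phi>"
  shows "hamiltonian_flow (H \<omega>) t x = \<phi> t"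
  using solves_ode_unique[OF hamiltonian_field_lipschitz[OF assms(1)] less_imp_le[OF lip_pos]
      flow_solves[OF assms(1)] assms(2)] by (rule fun_cong)

lemma flow_euler:
  assumes "\<omega> \<in> configs"
  shows "(\<lambda>n. (euler_step (hamiltonian_field (H \<omega>)) (t / real n) ^^ n) x) \<longlonglongrightarrow> hamiltonian_flow (H \<omega>) t x"
  by (rule euler_tendsto[OF hamiltonian_field_lipschitz[OF assms] less_imp_le[OF lip_pos] flow_solves[OF assms]])

lemma flow_continuous:
  assumes "\<omega> \<in> configs"
  shows "continuous_on S (\<lambda>t. hamiltonian_flow (H \<omega>) t x)"
proof -
  have "((\<lambda>t. hamiltonian_flow (H \<omega>) t x) has_vector_derivative
      hamiltonian_field (H \<omega>) (hamiltonian_flow (H \<omega>) t x)) (at t within S)" for t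
    using flow_solves[OF assms, of x] by (simp add: solves_ode_def has_vector_derivative_at_within)
  then show ?thesis by (rule continuous_on_vector_derivative)
qed

subsection \<open>Lattice translations\<close>

lemma lattice_add: "l \<in> lattice_of b \<Longrightarrow> l' \<in> lattice_of b \<Longrightarrow> l + l' \<in> lattice_of b"
  unfolding lattice_of_eq
proof clarify
  fix k k'
  have "basis_comb b (real_vec k) + basis_comb b (real_vec k') = basis_comb b (real_vec (k + k'))"
    by (simp add: linear_add[OF linear_basis_comb] real_vec_add)
  then show "basis_comb b (real_vec k) + basis_comb b (real_vec k') \<in> range (\<lambda>k. basis_comb b (real_vec k))"
    by simp
qed

lemma lattice_minus: "l \<in> lattice_of b \<Longrightarrow> - l \<in> lattice_of b"
  unfolding lattice_of_eq
proof clarify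
  fix k
  have "- basis_comb b (real_vec k) = basis_comb b (real_vec (- k))"
    by (simp add: linear_neg[OF linear_basis_comb] real_vec_minus)
  then show "- basis_comb b (real_vec k) \<in> range (\<lambda>k. basis_comb b (real_vec k))"
    by simp
qed

lemma shift_configs: "\<omega> \<in> configs \<Longrightarrow> l \<in> lattice_of b \<Longrightarrow> shift b l \<omega> \<in> configs"
  by (simp add: configs_def shift_def lattice_add)

text \<open>Translation by \<open>l\<close> permutes the lattice and so merely reindexes the
  sum.\<close>

lemma potential_shift:
  assumes l: "l \<in> lattice_of b"
  shows "potential b W (shift b l \<omega>) q = potential b W \<omega> (q + l)"
proof -
  have bij: "bij_betw (\<lambda>l'. l' + l) (lattice_of b) (lattice_of b)"
    by (rule bij_betw_byWitness[where f'="\<lambda>l'. l' - l"])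
      (use lattice_add[OF _ l] lattice_add[OF _ lattice_minus[OF l]] in auto)
  have "potential b W (shift b l \<omega>) q = (\<Sum>\<^sub>\<infinity>l'\<in>lattice_of b. W (\<omega> (l' + l)) ((q + l) - (l' + l)))"
    unfolding potential_def by (rule infsum_cong) (simp add: shift_def)
  also have "\<dots> = (\<Sum>\<^sub>\<infinity>l'\<in>lattice_of b. W (\<omega> l') ((q + l) - l'))"
    by (rule infsum_reindex_bij_betw[OF bij])
  finally show ?thesis by (simp add: potential_def)
qed

lemma hamiltonian_shift:
  "l \<in> lattice_of b \<Longrightarrow> H (shift b l \<omega>) (p, q) = H \<omega> (p, q + l)"
  by (simp add: hamiltonian_def potential_shift)

lemma grad_potential_shift:
  assumes "l \<in> lattice_of b"
  shows "grad (potential b W (shift b l \<omega>)) q = grad (potential b W \<omega>) (q + l)"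
  by (simp add: grad_def partial_deriv_def potential_shift[OF assms] ac_simps)

text \<open>The translated trajectory solves the shifted equation, because shifting the
  configuration compensates the offset in position; uniqueness identifies it with the flow.\<close>

lemma flow_shift:
  assumes "\<omega> \<in> configs" and l: "l \<in> lattice_of b"
  shows "hamiltonian_flow (H (shift b l \<omega>)) t (p, q) = hamiltonian_flow (H \<omega>) t (p, q + l) - (0, l)"
proof (rule flow_unique[OF shift_configs[OF assms]])
  let ?\<phi> = "\<lambda>t. hamiltonian_flow (H \<omega>) t (p, q + l)"
  have "hamiltonian_field (H (shift b l \<omega>)) (?\<phi> t - (0, l)) = hamiltonian_field (H \<omega>) (?\<phi> t)" for t
    by (cases "?\<phi> t") (simp add: hamiltonian_field_eq grad_potential_shift[OF l])
  moreover have "((\<lambda>t. ?\<phi> t - (0, l)) has_vector_derivative hamiltonian_field (H \<omega>) (?\<phi> t)) (at t)" for t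
    using flow_solves[OF assms(1), of "(p, q + l)"]
    by (auto simp: solves_ode_def intro!: derivative_eq_intros)
  ultimately show "solves_ode (hamiltonian_field (H (shift b l \<omega>))) (p, q) (\<lambda>t. ?\<phi> t - (0, l))"
    using flow_solves[OF assms(1), of "(p, q + l)"] by (simp add: solves_ode_def)
qed

text \<open>The two trajectories differ by the constant \<open>l\<close>, which vanishes after
  division by T.\<close>

lemma mean_velocity_shift_tendsto:
  assumes "\<omega> \<in> configs" and l: "l \<in> lattice_of b" and F: "((\<lambda>T. 1 / T) \<longlongrightarrow> (0::real)) F"
  shows "(mean_velocity (H (shift b l \<omega>)) (p, q) \<longlongrightarrow> v) F
    \<longleftrightarrow> (mean_velocity (H \<omega>) (p, q + l) \<longlongrightarrow> v) F"
proof -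
  have eq: "mean_velocity (H (shift b l \<omega>)) (p, q) = (\<lambda>T. mean_velocity (H \<omega>) (p, q + l) T - (1 / T) *\<^sub>R l)"
    by (simp add: fun_eq_iff mean_velocity_def flow_shift[OF assms(1,2)] scaleR_diff_right)
  have z: "((\<lambda>T. (1 / T) *\<^sub>R l) \<longlongrightarrow> 0) F"
    using tendsto_scaleR[OF F tendsto_const[of l]] by simp
  show ?thesis unfolding eq
    using tendsto_diff[OF _ z, of "mean_velocity (H \<omega>) (p, q + l)" v]
      tendsto_add[OF _ z, of "\<lambda>T. mean_velocity (H \<omega>) (p, q + l) T - (1 / T) *\<^sub>R l" v]
    by auto
qed

lemma energy_velocity_shift:
  assumes "\<omega> \<in> configs" and l: "l \<in> lattice_of b"
  shows "energy_velocity (H (shift b l \<omega>)) (p, q) = energy_velocity (H \<omega>) (p, q + l)"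
proof -
  have 1: "((\<lambda>T::real. 1 / T) \<longlongrightarrow> 0) at_top" "((\<lambda>T::real. 1 / T) \<longlongrightarrow> 0) at_bot"
    by real_asymp+
  note top = mean_velocity_shift_tendsto[OF assms 1(1), of p q]
    and bot = mean_velocity_shift_tendsto[OF assms 1(2), of p q]
  \<comment> \<open>\<open>Lim\<close> is only meaningful when a limit exists; here both limits
    exist and equal the same v.\<close>
  have "Lim at_top (mean_velocity (H (shift b l \<omega>)) (p, q)) = Lim at_top (mean_velocity (H \<omega>) (p, q + l))"
    if "(mean_velocity (H \<omega>) (p, q + l) \<longlongrightarrow> v) at_top" for v
    using tendsto_Lim[OF _ that] tendsto_Lim[OF _ that[folded top]] by simp
  then have "asymptotic_velocity (H (shift b l \<omega>)) (p, q) = asymptotic_velocity (H \<omega>) (p, q + l)"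
    unfolding asymptotic_velocity_def top bot by auto
  then show ?thesis by (simp add: energy_velocity_def hamiltonian_shift[OF l])
qed

end

section \<open>Measurability in the configuration\<close>

lemma space_config_borel: "space (config_borel b J) = PiE (lattice_of b) (\<lambda>_. J)"
  unfolding config_borel_def
  using openin_subset[of "config_topology b J"]
  by (subst space_measure_of) (auto simp: config_topology_def)

lemma sets_config_borel_openin:
  "openin (config_topology b J) U \<Longrightarrow> U \<in> sets (config_borel b J)"
  unfolding config_borel_def by (rule in_measure_of) (auto dest: openin_subset)

lemma config_coordinate_measurable:
  assumes "l \<in> lattice_of b"
  shows "(\<lambda>\<omega>. \<omega> l) \<in> measurable (config_borel b J) (count_space J)"
proof (rule measurableI)
  have c: "continuous_map (config_topology b J) (discrete_topology J) (\<lambda>\<omega>. \<omega> l)"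
    unfolding config_topology_def by (rule continuous_map_product_projection[OF assms])
  fix A assume "A \<in> sets (count_space J)"
  then have "openin (discrete_topology J) A" by simp
  from openin_continuous_map_preimage[OF c this]
  have "{\<omega> \<in> topspace (config_topology b J). \<omega> l \<in> A} \<in> sets (config_borel b J)"
    by (rule sets_config_borel_openin)
  moreover have "{\<omega> \<in> topspace (config_topology b J). \<omega> l \<in> A} = (\<lambda>\<omega>. \<omega> l) -` A \<inter> space (config_borel b J)"
    by (auto simp: space_config_borel config_topology_def)
  ultimately show "(\<lambda>\<omega>. \<omega> l) -` A \<inter> space (config_borel b J) \<in> sets (config_borel b J)" by simp
qed (use assms in \<open>auto simp: space_config_borel\<close>)

text \<open>Rational times and natural thresholds turn convergence into a countable condition, hence
  a measurable one. A violation at a real time persists on an interval by continuity and so reaches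
  a rational time. Continuity is asked only for positive times because mean velocities carry the
  factor 1 / T.\<close>

lemma tendsto_at_top_of_rat:
  fixes g :: "real \<Rightarrow> 'a::metric_space"
  assumes g: "continuous_on {0<..} g"
  shows "(g \<longlongrightarrow> v) at_top \<longleftrightarrow>
    (\<forall>k::nat. \<exists>N::nat. \<forall>r::rat. real N < of_rat r \<longrightarrow> dist (g (of_rat r)) v \<le> 1 / real (Suc k))"
proof
  assume L: "(g \<longlongrightarrow> v) at_top"
  show "\<forall>k::nat. \<exists>N::nat. \<forall>r::rat. real N < of_rat r \<longrightarrow> dist (g (of_rat r)) v \<le> 1 / real (Suc k)"
  proof
    fix k :: nat
    have "eventually (\<lambda>T. dist (g T) v < 1 / real (Suc k)) at_top" using L by (rule tendstoD) simp
    then obtain M where M: "\<And>T. M \<le> T \<Longrightarrow> dist (g T) v < 1 / real (Suc k)"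
      by (auto simp: eventually_at_top_linorder)
    obtain N where "M \<le> real N" using real_arch_simple by blast
    then show "\<exists>N::nat. \<forall>r::rat. real N < of_rat r \<longrightarrow> dist (g (of_rat r)) v \<le> 1 / real (Suc k)"
      by (intro exI[of _ N] allI impI less_imp_le M) linarith
  qed
next
  assume R: "\<forall>k::nat. \<exists>N::nat. \<forall>r::rat. real N < of_rat r \<longrightarrow> dist (g (of_rat r)) v \<le> 1 / real (Suc k)"
  show "(g \<longlongrightarrow> v) at_top"
  proof (rule tendstoI)
    fix e :: real assume "0 < e"
    then obtain k where k: "1 / real (Suc k) < e" using nat_approx_posE by blast
    from R obtain N :: nat where N: "\<And>r::rat. real N < of_rat r \<Longrightarrow> dist (g (of_rat r)) v \<le> 1 / real (Suc k)"
      by blast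
    have "dist (g T) v \<le> 1 / real (Suc k)" if T: "real N < T" for T
    proof (rule ccontr)
      assume "\<not> ?thesis"
      moreover have "((\<lambda>T. dist (g T) v) \<longlongrightarrow> dist (g T) v) (at T)"
      proof -
        have "isCont g T" using g T by (intro continuous_on_interior[of "{0<..}"]) (auto simp: interior_open)
        then show ?thesis by (intro tendsto_dist tendsto_const) (simp add: isCont_def)
      qed
      ultimately have "eventually (\<lambda>s. 1 / real (Suc k) < dist (g s) v) (at T)"
        by (intro order_tendstoD(1)) auto
      then obtain d where d: "0 < d" "\<And>s. s \<noteq> T \<Longrightarrow> dist s T < d \<Longrightarrow> 1 / real (Suc k) < dist (g s) v"
        by (auto simp: eventually_at)
      obtain r where "T < of_rat r" "of_rat r < T + d"
        using of_rat_dense[of T "T + d"] d(1) by auto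
      then show False using d(2)[of "of_rat r"] N[of r] T by (simp add: dist_real_def)
    qed
    then have "eventually (\<lambda>T. dist (g T) v \<le> 1 / real (Suc k)) at_top"
      by (rule eventually_mono[OF eventually_gt_at_top])
    then show "eventually (\<lambda>T. dist (g T) v < e) at_top"
      by (rule eventually_mono) (use k in simp)
  qed
qed

section \<open>Joint measurability in configuration and phase point\<close>

context lattice_potential
begin

lemma lattice_nonempty: "lattice_of b \<noteq> {}"
  by (simp add: lattice_of_eq)

lemma config_space_configs: "\<omega> \<in> space (config_borel b J) \<Longrightarrow> \<omega> \<in> configs"
  by (auto simp: space_config_borel configs_def)

lemma shift_space:
  "\<omega> \<in> space (config_borel b J) \<Longrightarrow> l \<in> lattice_of b \<Longrightarrow> shift b l \<omega> \<in> space (config_borel b J)"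
  by (auto simp: space_config_borel shift_def intro!: lattice_add)

lemma shift_measurable:
  assumes l: "l \<in> lattice_of b"
  shows "shift b l \<in> measurable (config_borel b J) (config_borel b J)"
proof -
  have c: "continuous_map (config_topology b J) (config_topology b J) (shift b l)"
    unfolding config_topology_def
    by (subst continuous_map_componentwise)
      (use l in \<open>auto simp: shift_def intro!: continuous_map_product_projection lattice_add\<close>)
  have "shift b l \<in> measurable (config_borel b J)
      (sigma (topspace (config_topology b J)) {U. openin (config_topology b J) U})"
  proof (rule measurable_measure_of)
    show "{U. openin (config_topology b J) U} \<subseteq> Pow (topspace (config_topology b J))"
      by (auto dest: openin_subset)
    show "shift b l \<in> space (config_borel b J) \<rightarrow> topspace (config_topology b J)"
      using shift_space l by (auto simp: space_config_borel config_topology_def)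
    fix U assume "U \<in> {U. openin (config_topology b J) U}"
    then have "openin (config_topology b J) U" by simp
    from sets_config_borel_openin[OF openin_continuous_map_preimage[OF c this]]
    show "shift b l -` U \<inter> space (config_borel b J) \<in> sets (config_borel b J)"
      by (simp add: space_config_borel config_topology_def Int_def vimage_def conj_commute)
  qed
  then show ?thesis by (simp add: config_borel_def)
qed

text \<open>Convergence along the directed set of finite subsets is replaced by convergence along
  one exhausting sequence \<open>F\<close>. Each summand is measurable as a selection among the
  finitely many functions \<open>g j\<close> by the measurable site value.\<close>

lemma site_sum_measurable:
  assumes g: "\<And>j. j \<in> J \<Longrightarrow> continuous_on UNIV (g j)"
    and S: "\<And>\<omega> q. \<omega> \<in> space (config_borel b J) \<Longrightarrow>
      ((\<lambda>F. \<Sum>l\<in>F. g (\<omega> l) (q - l)) \<longlongrightarrow> (S \<omega> q :: real)) (finite_subsets_at_top (lattice_of b))"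
  shows "(\<lambda>(\<omega>, q). S \<omega> q) \<in> borel_measurable (config_borel b J \<Otimes>\<^sub>M borel)"
proof -
  define F where "F n = from_nat_into (lattice_of b) ` {..n}" for n :: nat
  have F: "filterlim F (finite_subsets_at_top (lattice_of b)) sequentially"
    unfolding filterlim_finite_subsets_at_top
  proof (intro allI impI, elim conjE)
    fix X assume X: "finite X" "X \<subseteq> lattice_of b"
    let ?N = "Max (insert 0 (to_nat_on (lattice_of b) ` X))"
    have "X \<subseteq> F n" if "?N \<le> n" for n
    proof
      fix x assume x: "x \<in> X"
      have "to_nat_on (lattice_of b) x \<le> ?N" using X x by (intro Max_ge) auto
      then show "x \<in> F n" unfolding F_def
        using X(2) x that countable_lattice[of b]
        by (intro image_eqI[of _ _ "to_nat_on (lattice_of b) x"]) auto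
    qed
    moreover have "F n \<subseteq> lattice_of b" for n
      using from_nat_into[OF lattice_nonempty] by (auto simp: F_def)
    ultimately show "\<forall>\<^sub>F n in sequentially. finite (F n) \<and> X \<subseteq> F n \<and> F n \<subseteq> lattice_of b"
      unfolding eventually_sequentially by (intro exI[of _ ?N]) (auto simp: F_def)
  qed
  have Fsub: "F n \<subseteq> lattice_of b" for n
    using from_nat_into[OF lattice_nonempty] by (auto simp: F_def)
  have m: "(\<lambda>x. g (fst x l) (snd x - l)) \<in> borel_measurable (config_borel b J \<Otimes>\<^sub>M borel)"
    if l: "l \<in> lattice_of b" for l
  proof (rule measurable_compose_countable'[where g="\<lambda>x. fst x l" and I=J and f="\<lambda>j x. g j (snd x - l)"])
    show "(\<lambda>x. fst x l) \<in> measurable (config_borel b J \<Otimes>\<^sub>M borel) (count_space J)"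
      by (rule measurable_compose[OF measurable_fst config_coordinate_measurable[OF l]])
    fix j assume "j \<in> J"
    then have [measurable]: "g j \<in> borel_measurable borel"
      using g by (intro borel_measurable_continuous_onI)
    show "(\<lambda>x. g j (snd x - l)) \<in> borel_measurable (config_borel b J \<Otimes>\<^sub>M borel)" by measurable
  qed (use finite_J in \<open>simp add: countable_finite\<close>)
  have "(\<lambda>x. S (fst x) (snd x)) \<in> borel_measurable (config_borel b J \<Otimes>\<^sub>M borel)"
  proof (rule borel_measurable_LIMSEQ_real)
    fix x assume "x \<in> space (config_borel b J \<Otimes>\<^sub>M (borel :: (real^'n) measure))"
    then have "fst x \<in> space (config_borel b J)" by (auto simp: space_pair_measure)
    from filterlim_compose[OF S[OF this, of "snd x"] F]
    show "(\<lambda>n. \<Sum>l\<in>F n. g (fst x l) (snd x - l)) \<longlonglongrightarrow> S (fst x) (snd x)" .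
  next
    fix n
    show "(\<lambda>x. \<Sum>l\<in>F n. g (fst x l) (snd x - l)) \<in> borel_measurable (config_borel b J \<Otimes>\<^sub>M borel)"
      by (rule borel_measurable_sum[OF m]) (use Fsub in auto)
  qed
  then show ?thesis by (simp add: case_prod_beta')
qed

lemma potential_measurable:
  "(\<lambda>(\<omega>, q). potential b W \<omega> q) \<in> borel_measurable (config_borel b J \<Otimes>\<^sub>M borel)"
  by (rule site_sum_measurable[OF W_continuous potential_tendsto]) (auto intro: config_space_configs)

lemma gradV_measurable:
  "(\<lambda>(\<omega>, q). gradV \<omega> i q) \<in> borel_measurable (config_borel b J \<Otimes>\<^sub>M borel)"
  by (rule site_sum_measurable[OF dW_continuous gradV_tendsto]) (auto intro: config_space_configs)

lemma fst_snd_borel [measurable]: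
  "fst \<in> borel_measurable (borel :: ('a::euclidean_space \<times> 'b::euclidean_space) measure)"
  "snd \<in> borel_measurable (borel :: ('a::euclidean_space \<times> 'b::euclidean_space) measure)"
  by (intro borel_measurable_continuous_onI continuous_intros)+

lemma hamiltonian_measurable:
  "(\<lambda>(\<omega>, x). H \<omega> x) \<in> borel_measurable (config_borel b J \<Otimes>\<^sub>M borel)"
proof -
  let ?M = "config_borel b J \<Otimes>\<^sub>M (borel :: ((real^'n) \<times> (real^'n)) measure)"
  have "(\<lambda>x. (fst x, snd (snd x))) \<in> measurable ?M (config_borel b J \<Otimes>\<^sub>M (borel :: (real^'n) measure))"
    by measurable
  from measurable_compose[OF this potential_measurable]
  have [measurable]: "(\<lambda>x. potential b W (fst x) (snd (snd x))) \<in> borel_measurable ?M" by simp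
  have "(\<lambda>x. (norm (fst (snd x)))\<^sup>2 / 2 + potential b W (fst x) (snd (snd x))) \<in> borel_measurable ?M"
    by measurable
  then show ?thesis by (simp add: hamiltonian_def case_prod_beta')
qed

lemma hamiltonian_field_measurable:
  "(\<lambda>(\<omega>, x). hamiltonian_field (H \<omega>) x) \<in> borel_measurable (config_borel b J \<Otimes>\<^sub>M borel)"
proof -
  let ?M = "config_borel b J \<Otimes>\<^sub>M (borel :: ((real^'n) \<times> (real^'n)) measure)"
  have "(\<lambda>x. (fst x, snd (snd x))) \<in> measurable ?M (config_borel b J \<Otimes>\<^sub>M (borel :: (real^'n) measure))"
    by measurable
  from measurable_compose[OF this gradV_measurable]
  have [measurable]: "(\<lambda>x. gradV (fst x) i (snd (snd x))) \<in> borel_measurable ?M" for i by simp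
  \<comment> \<open>The gradient is written as a sum over axis vectors, a form to which
    measurability of finite sums applies.\<close>
  have "(\<lambda>x. (- (\<Sum>i\<in>UNIV. gradV (fst x) i (snd (snd x)) *\<^sub>R axis i (1::real)), fst (snd x))) \<in> borel_measurable ?M"
    by (rule borel_measurable_Pair) measurable
  then show ?thesis
  proof (rule measurable_cong[THEN iffD1, rotated])
    fix x assume "x \<in> space ?M"
    then have \<omega>: "fst x \<in> configs" by (auto simp: space_pair_measure intro: config_space_configs)
    have "(\<chi> i. f i) = (\<Sum>i\<in>UNIV. f i *\<^sub>R axis i (1::real))" for f :: "'n \<Rightarrow> real"
      using basis_expansion[of "\<chi> i. f i"] by (simp add: scalar_mult_eq_scaleR)
    then show "(- (\<Sum>i\<in>UNIV. gradV (fst x) i (snd (snd x)) *\<^sub>R axis i (1::real)), fst (snd x))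
        = (case x of (\<omega>, x) \<Rightarrow> hamiltonian_field (H \<omega>) x)"
      using grad_potential[OF \<omega>] hamiltonian_field_eq[of "fst x" "fst (snd x)" "snd (snd x)"]
      by (simp add: case_prod_beta')
  qed
qed

lemma flow_measurable:
  "(\<lambda>(\<omega>, x). hamiltonian_flow (H \<omega>) t x) \<in> borel_measurable (config_borel b J \<Otimes>\<^sub>M borel)"
proof -
  let ?M = "config_borel b J \<Otimes>\<^sub>M (borel :: ((real^'n) \<times> (real^'n)) measure)"
  let ?E = "\<lambda>h n z. (euler_step (hamiltonian_field (H (fst z))) h ^^ n) (snd z)"
  have E: "?E h n \<in> borel_measurable ?M" for h n
  proof -
    define e where "e n = ?E h n" for n
    have e_Suc: "e (Suc n) z = e n z + h *\<^sub>R hamiltonian_field (H (fst z)) (e n z)" for n z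
      by (simp add: e_def euler_step_def)
    have "e n \<in> borel_measurable ?M"
    proof (induction n)
      case (Suc n)
      note [measurable] = Suc
      have "(\<lambda>z. (fst z, e n z)) \<in> measurable ?M ?M" by measurable
      from measurable_compose[OF this hamiltonian_field_measurable]
      have [measurable]: "(\<lambda>z. hamiltonian_field (H (fst z)) (e n z)) \<in> borel_measurable ?M" by simp
      have "(\<lambda>z. e n z + h *\<^sub>R hamiltonian_field (H (fst z)) (e n z)) \<in> borel_measurable ?M"
        by measurable
      then show ?case by (simp only: e_Suc[symmetric] cong: measurable_cong)
    qed (simp add: e_def)
    then show ?thesis by (simp only: e_def)
  qed
  have "(\<lambda>z. hamiltonian_flow (H (fst z)) t (snd z)) \<in> borel_measurable ?M"
  proof (rule borel_measurable_LIMSEQ_metric[OF E])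
    fix z assume "z \<in> space ?M"
    then have "fst z \<in> configs" by (auto simp: space_pair_measure intro: config_space_configs)
    then show "(\<lambda>n. ?E (t / real n) n z) \<longlonglongrightarrow> hamiltonian_flow (H (fst z)) t (snd z)"
      by (rule flow_euler)
  qed
  then show ?thesis by (simp add: case_prod_beta')
qed

lemma asymptotic_velocity_measurable:
  "(\<lambda>(\<omega>, x). asymptotic_velocity (H \<omega>) x) \<in> borel_measurable (config_borel b J \<Otimes>\<^sub>M borel)"
proof -
  let ?M = "config_borel b J \<Otimes>\<^sub>M (borel :: ((real^'n) \<times> (real^'n)) measure)"
  define m where "m z T = mean_velocity (H (fst z)) (snd z) T" for z T
  have [measurable]: "(\<lambda>z. m z T) \<in> borel_measurable ?M" for T
  proof -
    have [measurable]: "(\<lambda>z. hamiltonian_flow (H (fst z)) T (snd z)) \<in> borel_measurable ?M"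
      using flow_measurable[of T] by (simp add: case_prod_beta')
    show ?thesis unfolding m_def mean_velocity_def by measurable
  qed
  \<comment> \<open>If the limit at plus infinity exists it equals \<open>v\<close>; if the sequence
    along the integers diverges, \<open>v\<close> is an arbitrary value and \<open>P\<close> fails.
    \<open>P\<close> and \<open>P'\<close> test convergence to this one candidate at both
    ends.\<close>
  define v where "v z = lim (\<lambda>n. m z (real n))" for z
  have [measurable]: "v \<in> borel_measurable ?M" unfolding v_def by measurable
  define P where "P z \<longleftrightarrow> (\<forall>k::nat. \<exists>N::nat. \<forall>r::rat. real N < of_rat r \<longrightarrow>
      dist (m z (of_rat r)) (v z) \<le> 1 / real (Suc k))" for z
  define P' where "P' z \<longleftrightarrow> (\<forall>k::nat. \<exists>N::nat. \<forall>r::rat. real N < of_rat r \<longrightarrow>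
      dist (m z (- of_rat r)) (v z) \<le> 1 / real (Suc k))" for z
  have [measurable]: "Measurable.pred ?M P" "Measurable.pred ?M P'"
    unfolding P_def P'_def by measurable
  have "(\<lambda>z. if P z \<and> P' z then v z else 0) \<in> borel_measurable ?M" by measurable
  then show ?thesis
  proof (rule measurable_cong[THEN iffD1, rotated])
    fix z assume "z \<in> space ?M"
    then have \<omega>: "fst z \<in> configs" by (auto simp: space_pair_measure intro: config_space_configs)
    have cm: "continuous_on S (m z)" if "0 \<notin> S" for S
      unfolding m_def mean_velocity_def using that
      by (intro continuous_intros flow_continuous[OF \<omega>]) auto
    have P: "P z \<longleftrightarrow> (m z \<longlongrightarrow> v z) at_top"
      unfolding P_def by (rule tendsto_at_top_of_rat[symmetric, OF cm]) simp
    have "continuous_on {0<..} (\<lambda>T. m z (- T))"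
      by (rule continuous_on_compose2[OF cm[of "- {0}"]]) (auto intro!: continuous_intros)
    then have P': "P' z \<longleftrightarrow> (m z \<longlongrightarrow> v z) at_bot"
      unfolding P'_def filterlim_at_bot_mirror by (rule tendsto_at_top_of_rat[symmetric])
    have lim: "v z = u" if "(m z \<longlongrightarrow> u) at_top" for u
      unfolding v_def by (rule limI[OF filterlim_compose[OF that filterlim_real_sequentially]])
    have "mean_velocity (H (fst z)) (snd z) = m z" by (simp add: m_def fun_eq_iff)
    then have av: "asymptotic_velocity (H (fst z)) (snd z) =
        (if \<exists>u. (m z \<longlongrightarrow> u) at_top \<and> (m z \<longlongrightarrow> u) at_bot then Lim at_top (m z) else 0)"
      by (simp only: asymptotic_velocity_def)
    have ex: "(\<exists>u. (m z \<longlongrightarrow> u) at_top \<and> (m z \<longlongrightarrow> u) at_bot) \<longleftrightarrow> P z \<and> P' z"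
      unfolding P P' using lim by metis
    have "Lim at_top (m z) = v z" if "P z"
      using that unfolding P by (intro tendsto_Lim) simp_all
    then show "(if P z \<and> P' z then v z else 0) = (case z of (\<omega>, x) \<Rightarrow> asymptotic_velocity (H \<omega>) x)"
      unfolding case_prod_beta' av ex by simp
  qed
qed

lemma energy_velocity_measurable:
  "(\<lambda>(\<omega>, x). energy_velocity (H \<omega>) x) \<in> borel_measurable (config_borel b J \<Otimes>\<^sub>M borel)"
proof -
  have [measurable]: "(\<lambda>z. H (fst z) (snd z)) \<in> borel_measurable (config_borel b J \<Otimes>\<^sub>M borel)"
    "(\<lambda>z. asymptotic_velocity (H (fst z)) (snd z)) \<in> borel_measurable (config_borel b J \<Otimes>\<^sub>M borel)"
    using hamiltonian_measurable asymptotic_velocity_measurable by (simp_all add: case_prod_beta')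
  show ?thesis
    unfolding energy_velocity_def case_prod_beta' by (rule borel_measurable_Pair) measurable
qed

end

section \<open>The limit of the empirical measures\<close>

lemma emeasure_lborel_translate:
  fixes c :: "'a::euclidean_space"
  assumes "S \<in> sets borel"
  shows "emeasure lborel {x. x - c \<in> S} = emeasure lborel S"
proof -
  have "emeasure lborel S = emeasure (distr lborel borel ((+) (- c))) S" by (simp add: lborel_distr_plus)
  also have "\<dots> = emeasure lborel {x. x - c \<in> S}"
    using assms by (subst emeasure_distr) (auto simp: vimage_def)
  finally show ?thesis by simp
qed

section \<open>Lattice cells and boxes\<close>

definition cell_index :: "('n::finite \<Rightarrow> real^'n) \<Rightarrow> real^'n \<Rightarrow> int^'n" where
  "cell_index b q = (\<chi> i. \<lfloor>inv (basis_comb b) q $ i\<rfloor>)"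

definition fund_cell :: "('n::finite \<Rightarrow> real^'n) \<Rightarrow> (real^'n) set" where
  "fund_cell b = {q. cell_index b q = 0}"

context
  fixes b :: "'n::finite \<Rightarrow> real^'n" assumes b: "is_lattice_basis b"
begin

lemma inv_basis_comb: "inv (basis_comb b) (basis_comb b x) = x" "basis_comb b (inv (basis_comb b) q) = q"
  using inj_basis_comb[OF b] linear_injective_imp_surjective[OF linear_basis_comb inj_basis_comb[OF b]]
  by (simp_all add: surj_f_inv_f)

lemma linear_inv_basis_comb: "linear (inv (basis_comb b))"
  by (rule inj_linear_imp_inv_linear[OF linear_basis_comb inj_basis_comb[OF b]])

lemma cell_index_add: "cell_index b (q + basis_comb b (real_vec k)) = cell_index b q + k"
  by (simp add: cell_index_def linear_add[OF linear_inv_basis_comb] inv_basis_comb vec_eq_iff real_vec_def)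

text \<open>The bounds -n <= x < n hold for a real number exactly when they hold for its floor, so
  each box is an exact union of cells.\<close>

lemma box_of_eq: "box_of b n = {q. cell_index b q \<in> index_box UNIV n}"
proof -
  have fl: "- real n \<le> x \<and> x < real n \<longleftrightarrow> - int n \<le> \<lfloor>x\<rfloor> \<and> \<lfloor>x\<rfloor> < int n" for x :: real
    by linarith
  have "q \<in> box_of b n \<longleftrightarrow> (\<forall>i. - real n \<le> inv (basis_comb b) q $ i \<and> inv (basis_comb b) q $ i < real n)" for q
  proof
    assume "q \<in> box_of b n"
    then obtain x where x: "q = (\<Sum>i\<in>UNIV. x i *\<^sub>R b i)" "\<forall>i. - real n \<le> x i \<and> x i < real n"
      by (auto simp: box_of_def)
    then have "q = basis_comb b (vec_lambda x)" by (simp add: basis_comb_def)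
    then show "\<forall>i. - real n \<le> inv (basis_comb b) q $ i \<and> inv (basis_comb b) q $ i < real n"
      using x(2) by (simp add: inv_basis_comb)
  next
    assume "\<forall>i. - real n \<le> inv (basis_comb b) q $ i \<and> inv (basis_comb b) q $ i < real n"
    moreover have "q = (\<Sum>i\<in>UNIV. inv (basis_comb b) q $ i *\<^sub>R b i)"
      using inv_basis_comb(2)[of q] by (simp add: basis_comb_def)
    ultimately show "q \<in> box_of b n" unfolding box_of_def by blast
  qed
  then show ?thesis by (auto simp: index_box_def cell_index_def fl)
qed

lemma cell_index_measurable [measurable]: "cell_index b \<in> measurable borel (count_space UNIV)"
proof (subst measurable_count_space_eq2_countable, intro conjI ballI)
  fix k
  have [measurable]: "inv (basis_comb b) \<in> borel_measurable borel"
    using linear_inv_basis_comb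
    by (intro borel_measurable_continuous_onI linear_continuous_on) (simp add: linear_conv_bounded_linear)
  have "cell_index b -` {k} \<inter> space borel
      = (\<Inter>i. {q. real_of_int (k $ i) \<le> inv (basis_comb b) q $ i} \<inter> {q. inv (basis_comb b) q $ i < real_of_int (k $ i) + 1})"
    by (auto simp: cell_index_def vec_eq_iff floor_eq_iff)
  also have "\<dots> \<in> sets borel"
    by (rule sets.countable_INT') auto
  finally show "cell_index b -` {k} \<inter> space borel \<in> sets borel" .
qed auto

lemma fund_cell_borel [measurable]: "fund_cell b \<in> sets borel"
  using measurable_sets[OF cell_index_measurable, of "{0}"] by (simp add: fund_cell_def vimage_def)

lemma fund_cell_finite: "emeasure lborel (fund_cell b) < \<infinity>"
proof (rule emeasure_bounded_finite, rule bounded_subset)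
  have "bounded (cbox 0 1 :: (real^'n) set)" by (rule bounded_cbox)
  then show "bounded (basis_comb b ` cbox 0 1)"
    by (rule bounded_linear_image) (simp add: linear_conv_bounded_linear[symmetric] linear_basis_comb)
  show "fund_cell b \<subseteq> basis_comb b ` cbox 0 1"
  proof
    fix q assume "q \<in> fund_cell b"
    then have "inv (basis_comb b) q \<in> cbox 0 1"
      by (auto simp: fund_cell_def cell_index_def vec_eq_iff mem_box_cart floor_eq_iff less_imp_le)
    then show "q \<in> basis_comb b ` cbox 0 1"
      using inv_basis_comb(2)[of q] by (metis imageI)
  qed
qed

text \<open>A null cell would have countably many null translates, and these cover the whole
  space.\<close>

lemma fund_cell_pos: "0 < emeasure lborel (fund_cell b)"
proof (rule ccontr)
  assume "\<not> ?thesis"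
  then have z: "emeasure lborel (fund_cell b) = 0" by (simp add: not_less)
  have "cell_index b -` {k} \<in> null_sets lborel" for k
  proof -
    have eq: "cell_index b -` {k} = {q. q - basis_comb b (real_vec k) \<in> fund_cell b}"
    proof -
      have "cell_index b q = k \<longleftrightarrow> cell_index b (q - basis_comb b (real_vec k)) = 0" for q
        using cell_index_add[of "q - basis_comb b (real_vec k)" k] by simp
      then show ?thesis by (simp add: fund_cell_def vimage_def)
    qed
    have "emeasure lborel (cell_index b -` {k}) = 0"
      unfolding eq using emeasure_lborel_translate[OF fund_cell_borel] z by simp
    moreover have "cell_index b -` {k} \<in> sets borel"
      using measurable_sets[OF cell_index_measurable, of "{k}"] by simp
    ultimately show ?thesis by (simp add: null_sets_def)
  qed
  then have "(\<Union>k\<in>UNIV. cell_index b -` {k}) \<in> null_sets lborel"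
    by (intro null_sets_UN') (auto intro: countableI_type)
  moreover have "(\<Union>k\<in>UNIV. cell_index b -` {k}) = UNIV" by auto
  ultimately show False by (simp add: null_sets_def)
qed

lemma cells_borel [measurable]:
  assumes "E \<in> sets (borel :: ('a::euclidean_space \<times> (real^'n)) measure)"
  shows "{x. cell_index b (snd x) \<in> K \<and> x \<in> E} \<in> sets borel"
proof -
  have [measurable]: "snd \<in> borel_measurable (borel :: ('a \<times> (real^'n)) measure)"
    by (intro borel_measurable_continuous_onI continuous_intros)
  have "(\<lambda>x. cell_index b (snd x)) \<in> measurable (borel :: ('a \<times> (real^'n)) measure) (count_space UNIV)"
    by measurable
  from measurable_sets[OF this, of K] have "{x. cell_index b (snd x) \<in> K} \<in> sets (borel :: ('a \<times> (real^'n)) measure)"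
    by (simp add: vimage_def)
  from sets.Int[OF this assms] show ?thesis by (simp add: Int_def)
qed

text \<open>Each cell is translated back to the fundamental one, and the translation passes into the
  condition on \<open>E\<close>. Only the second component is cut into cells; the first stays
  general so that momenta and an auxiliary interval both fit.\<close>

lemma emeasure_cells:
  fixes E :: "('a::euclidean_space \<times> (real^'n)) set"
  assumes K: "finite K" and E: "E \<in> sets borel"
  shows "emeasure lborel {x. cell_index b (snd x) \<in> K \<and> x \<in> E} =
    (\<Sum>k\<in>K. emeasure lborel {x. cell_index b (snd x) = 0 \<and> x + (0, basis_comb b (real_vec k)) \<in> E})"
proof -
  have "emeasure lborel {x. cell_index b (snd x) \<in> K \<and> x \<in> E}
      = emeasure lborel (\<Union>k\<in>K. {x. cell_index b (snd x) \<in> {k} \<and> x \<in> E})"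
    by (rule arg_cong[where f="emeasure lborel"]) auto
  also have "\<dots> = (\<Sum>k\<in>K. emeasure lborel {x. cell_index b (snd x) \<in> {k} \<and> x \<in> E})"
    by (rule sum_emeasure[symmetric]) (use K cells_borel[OF E, of "{k}" for k] in \<open>auto simp: disjoint_family_on_def\<close>)
  also have "\<dots> = (\<Sum>k\<in>K. emeasure lborel {x. cell_index b (snd x) = 0 \<and> x + (0, basis_comb b (real_vec k)) \<in> E})"
  proof (rule sum.cong[OF refl])
    fix k
    define c :: "'a \<times> (real^'n)" where "c = (0, basis_comb b (real_vec k))"
    define S where "S = {x. cell_index b (snd x) = 0 \<and> x + c \<in> E}"
    have "{x. x + c \<in> E} \<in> sets borel"
    proof -
      have "(\<lambda>x. x + c) \<in> borel_measurable borel" by measurable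
      from measurable_sets[OF this E] show ?thesis by (simp add: vimage_def)
    qed
    from cells_borel[OF this, of "{0}"] have S: "S \<in> sets borel" by (simp add: S_def)
    have "cell_index b (snd x) = k \<longleftrightarrow> cell_index b (snd (x - c)) = 0" for x :: "'a \<times> (real^'n)"
      using cell_index_add[of "snd (x - c)" k] by (simp add: c_def)
    then have "{x. cell_index b (snd x) \<in> {k} \<and> x \<in> E} = {x. x - c \<in> S}"
      by (simp add: S_def)
    then show "emeasure lborel {x. cell_index b (snd x) \<in> {k} \<and> x \<in> E}
        = emeasure lborel {x. cell_index b (snd x) = 0 \<and> x + (0, basis_comb b (real_vec k)) \<in> E}"
      using emeasure_lborel_translate[OF S, of c] by (simp add: S_def c_def)
  qed
  finally show ?thesis .
qed

lemma emeasure_cell_prod: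
  fixes A :: "'a::euclidean_space set"
  assumes "A \<in> sets borel"
  shows "emeasure lborel {x. cell_index b (snd x) = 0 \<and> fst x \<in> A} = emeasure lborel A * emeasure lborel (fund_cell b)"
proof -
  have "{x. cell_index b (snd x) = 0 \<and> fst x \<in> A} = A \<times> fund_cell b"
    by (auto simp: fund_cell_def)
  then show ?thesis using assms
    by (simp add: lborel_prod[symmetric] lborel.emeasure_pair_measure_Times)
qed

lemma emeasure_box_of: "emeasure lborel (box_of b n) = of_nat ((2 * n) ^ CARD('n)) * emeasure lborel (fund_cell b)"
proof -
  \<comment> \<open>The unit interval is an auxiliary first factor of measure 1 that brings the box
    into the form required by \<open>emeasure_cells\<close>.\<close>
  define E :: "(real \<times> (real^'n)) set" where "E = cbox 0 1 \<times> UNIV"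
  have bx: "box_of b n \<in> sets borel"
    using measurable_sets[OF cell_index_measurable, of "index_box UNIV n"] by (simp add: box_of_eq vimage_def)
  have E: "E \<in> sets borel"
    unfolding E_def by (intro borel_closed closed_Times) auto
  have "cbox 0 1 \<times> box_of b n = {x. cell_index b (snd x) \<in> index_box UNIV n \<and> x \<in> E}"
    by (auto simp: E_def box_of_eq)
  moreover have "emeasure lborel (cbox (0::real) 1 \<times> box_of b n) = emeasure lborel (box_of b n)"
    using bx by (simp add: lborel_prod[symmetric] lborel.emeasure_pair_measure_Times)
  moreover have "{x. cell_index b (snd x) = 0 \<and> x + (0, c) \<in> E} = {x. cell_index b (snd x) = 0 \<and> fst x \<in> cbox (0::real) 1}" for c
    by (auto simp: E_def)
  ultimately have "emeasure lborel (box_of b n) = (\<Sum>k\<in>index_box (UNIV :: 'n set) n. emeasure lborel (fund_cell b))"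
    using emeasure_cells[OF finite_index_box E, of UNIV n] emeasure_cell_prod[of "cbox (0::real) 1"] by simp
  then show ?thesis by (simp add: card_index_box)
qed

end


locale random_lattice_potential = lattice_potential b J W \<epsilon> C + prob_space \<beta>
  for b :: "'n::finite \<Rightarrow> real^'n" and J :: "'j set" and W \<epsilon> C and \<beta> :: "(real^'n \<Rightarrow> 'j) measure" +
  assumes sets_eq: "sets \<beta> = sets (config_borel b J)"
    and invariant: "shift_invariant b \<beta>" and ergodic: "shift_ergodic b \<beta>"
begin

lemma space_eq: "space \<beta> = space (config_borel b J)"
  by (rule sets_eq_imp_space_eq[OF sets_eq])

lemma space_configs: "\<omega> \<in> space \<beta> \<Longrightarrow> \<omega> \<in> configs"
  by (simp add: space_eq config_space_configs)

abbreviation translate :: "int^'n \<Rightarrow> (real^'n \<Rightarrow> 'j) \<Rightarrow> (real^'n \<Rightarrow> 'j)" where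
  "translate k \<equiv> shift b (basis_comb b (real_vec k))"

lemma lattice_vec: "basis_comb b (real_vec k) \<in> lattice_of b"
  by (simp add: lattice_of_eq)

lemma translate_measurable: "translate k \<in> measurable \<beta> \<beta>"
  using shift_measurable[OF lattice_vec] by (simp add: measurable_cong_sets[OF sets_eq sets_eq])

sublocale act: measure_preserving_action \<beta> translate
proof
  fix k l and \<omega> :: "real^'n \<Rightarrow> 'j"
  show "translate k \<in> measurable \<beta> \<beta>" by (rule translate_measurable)
  show "distr \<beta> \<beta> (translate k) = \<beta>"
  proof (rule measure_eqI)
    fix A assume "A \<in> sets (distr \<beta> \<beta> (translate k))"
    then show "emeasure (distr \<beta> \<beta> (translate k)) A = emeasure \<beta> A"
      using invariant lattice_vec[of k] by (simp add: emeasure_distr[OF translate_measurable] shift_invariant_def)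
  qed simp
  assume "\<omega> \<in> space \<beta>"
  then have extn: "\<omega> \<in> extensional (lattice_of b)" by (auto simp: space_eq space_config_borel PiE_def)
  have "real_vec 0 = (0 :: real^'n)" by (simp add: real_vec_def vec_eq_iff)
  then show "translate 0 \<omega> = \<omega>"
    using extensional_restrict[OF extn] by (simp add: shift_def linear_0[OF linear_basis_comb])
  show "translate (k + l) \<omega> = translate k (translate l \<omega>)"
    by (rule ext) (simp add: shift_def restrict_def real_vec_add linear_add[OF linear_basis_comb]
        lattice_add lattice_vec add.assoc)
qed

section \<open>Phase space volume over one cell\<close>

definition cell_mass :: "(real \<times> (real^'n)) set \<Rightarrow> (real^'n \<Rightarrow> 'j) \<Rightarrow> ennreal" where
  "cell_mass A \<omega> = emeasure lborel {x. cell_index b (snd x) = 0 \<and> energy_velocity (H \<omega>) x \<in> A}"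

lemma energy_velocity_borel:
  assumes "\<omega> \<in> space \<beta>" shows "energy_velocity (H \<omega>) \<in> borel_measurable borel"
  using measurable_Pair2[OF energy_velocity_measurable, of \<omega>] assms by (simp add: space_eq)

lemma energy_velocity_vimage:
  assumes "\<omega> \<in> space \<beta>" "A \<in> sets borel"
  shows "energy_velocity (H \<omega>) -` A \<in> sets borel"
  using measurable_sets[OF energy_velocity_borel[OF assms(1)] assms(2)] by simp

lemma cells_pair_measurable:
  assumes A: "A \<in> sets borel"
  shows "{z \<in> space (\<beta> \<Otimes>\<^sub>M lborel). cell_index b (snd (snd z)) = 0 \<and> energy_velocity (H (fst z)) (snd z) \<in> A}
    \<in> sets (\<beta> \<Otimes>\<^sub>M lborel)"
proof -
  have s: "sets (\<beta> \<Otimes>\<^sub>M lborel) = sets (config_borel b J \<Otimes>\<^sub>M (borel :: ((real^'n) \<times> (real^'n)) measure))"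
    by (intro sets_pair_measure_cong sets_eq) simp
  have [measurable]: "(\<lambda>z. energy_velocity (H (fst z)) (snd z)) \<in> borel_measurable (\<beta> \<Otimes>\<^sub>M lborel)"
    using energy_velocity_measurable by (simp add: case_prod_beta' measurable_cong_sets[OF s refl])
  have [measurable]: "cell_index b \<in> measurable borel (count_space UNIV)"
    by (rule cell_index_measurable[OF basis])
  have [measurable]: "(\<lambda>z. snd (snd z)) \<in> borel_measurable (\<beta> \<Otimes>\<^sub>M (lborel :: ((real^'n) \<times> (real^'n)) measure))"
    by (rule measurable_compose[OF measurable_snd]) simp
  note A [measurable]
  show ?thesis by measurable
qed

lemma cell_mass_measurable:
  assumes "A \<in> sets borel" shows "cell_mass A \<in> borel_measurable \<beta>"
proof -
  let ?Q = "{z \<in> space (\<beta> \<Otimes>\<^sub>M lborel). cell_index b (snd (snd z)) = 0 \<and> energy_velocity (H (fst z)) (snd z) \<in> A}"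
  have "(\<lambda>\<omega>. emeasure lborel (Pair \<omega> -` ?Q)) \<in> borel_measurable \<beta>"
    by (rule lborel.measurable_emeasure_Pair[OF cells_pair_measurable[OF assms]])
  then show ?thesis
    by (rule measurable_cong[THEN iffD1, rotated])
      (auto simp: cell_mass_def space_pair_measure intro!: arg_cong[where f="emeasure lborel"])
qed

text \<open>Obtained from |p|^2 / 2 = H - V with H <= R and |V| <= \<open>bnd\<close>.\<close>

definition momentum_bound :: "real \<Rightarrow> real" where
  "momentum_bound R = sqrt (2 * (R + bnd))"

definition mass_bound :: "real \<Rightarrow> real" where
  "mass_bound R = measure lborel (cball 0 (momentum_bound R) :: (real^'n) set)"

definition cell_volume :: real where
  "cell_volume = measure lborel (fund_cell b)"

lemma cell_volume: "emeasure lborel (fund_cell b) = ennreal cell_volume" "0 < cell_volume"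
proof -
  show eq: "emeasure lborel (fund_cell b) = ennreal cell_volume"
    using fund_cell_finite[OF basis] unfolding cell_volume_def by (intro emeasure_eq_ennreal_measure) auto
  show "0 < cell_volume" using fund_cell_pos[OF basis] unfolding eq by simp
qed

text \<open>A bounded set \<open>A\<close> limits the energy, hence the momentum, while positions
  lie in one cell. The bound is uniform in \<omega>, as the ergodic theorem for bounded functions
  demands.\<close>

lemma cell_mass_le:
  assumes \<omega>: "\<omega> \<in> space \<beta>" and A: "A \<subseteq> cball 0 R"
  shows "cell_mass A \<omega> \<le> ennreal (mass_bound R * cell_volume)"
proof -
  let ?P = "cball 0 (momentum_bound R) :: (real^'n) set"
  have "{x. cell_index b (snd x) = 0 \<and> energy_velocity (H \<omega>) x \<in> A} \<subseteq> {x. cell_index b (snd x) = 0 \<and> fst x \<in> ?P}"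
  proof (intro subsetI CollectI, elim CollectE conjE, intro conjI)
    fix x assume "energy_velocity (H \<omega>) x \<in> A"
    then have "norm (energy_velocity (H \<omega>) x) \<le> R" using A by auto
    then have "\<bar>H \<omega> x\<bar> \<le> R"
      using norm_fst_le[of "H \<omega> x" "asymptotic_velocity (H \<omega>) x"] by (simp add: energy_velocity_def)
    then have "(norm (fst x))\<^sup>2 \<le> 2 * (R + bnd)"
      using potential_bound[OF space_configs[OF \<omega>], of "snd x"]
      by (simp add: hamiltonian_def case_prod_beta abs_le_iff)
    then have "norm (fst x) \<le> momentum_bound R" unfolding momentum_bound_def by (rule real_le_rsqrt)
    then show "fst x \<in> ?P" by simp
  qed
  then have "cell_mass A \<omega> \<le> emeasure lborel {x. cell_index b (snd x) = 0 \<and> fst x \<in> ?P}"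
    unfolding cell_mass_def
    using cells_borel[OF basis, of "fst -` ?P" "{0}"] measurable_sets[OF fst_snd_borel(1), of ?P]
    by (intro emeasure_mono) auto
  also have "\<dots> = emeasure lborel ?P * emeasure lborel (fund_cell b)"
    by (rule emeasure_cell_prod[OF basis]) simp
  also have "emeasure lborel ?P = ennreal (mass_bound R)"
    unfolding mass_bound_def using emeasure_lborel_cball_finite[of "0 :: real^'n" "momentum_bound R"]
    by (intro emeasure_eq_ennreal_measure) auto
  also have "ennreal (mass_bound R) * emeasure lborel (fund_cell b) = ennreal (mass_bound R * cell_volume)"
    unfolding cell_volume(1) by (rule ennreal_mult[symmetric]) (simp_all add: mass_bound_def cell_volume_def)
  finally show ?thesis .
qed

text \<open>Division by the cell volume makes box averages of this function equal to the empirical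
  mass without leftover constants.\<close>

definition cell_density :: "(real \<times> (real^'n)) set \<Rightarrow> (real^'n \<Rightarrow> 'j) \<Rightarrow> real" where
  "cell_density A \<omega> = enn2real (cell_mass A \<omega>) / cell_volume"

lemma cell_density_measurable:
  assumes "A \<in> sets borel" shows "cell_density A \<in> borel_measurable \<beta>"
proof -
  note [measurable] = cell_mass_measurable[OF assms]
  show ?thesis unfolding cell_density_def[abs_def] by measurable
qed

lemma cell_mass_eq:
  assumes "\<omega> \<in> space \<beta>" "A \<subseteq> cball 0 R"
  shows "cell_mass A \<omega> = ennreal (cell_density A \<omega> * cell_volume)"
proof -
  have "cell_mass A \<omega> < \<infinity>" using cell_mass_le[OF assms] by (rule le_less_trans) simp
  then show ?thesis using cell_volume(2) by (simp add: cell_density_def)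
qed

lemma cell_density_nonneg: "0 \<le> cell_density A \<omega>"
  using cell_volume(2) by (simp add: cell_density_def)

lemma cell_density_bound:
  assumes "\<omega> \<in> space \<beta>" "A \<subseteq> cball 0 R"
  shows "\<bar>cell_density A \<omega>\<bar> \<le> mass_bound R"
proof -
  have "cell_density A \<omega> * cell_volume \<le> mass_bound R * cell_volume"
    using cell_mass_le[OF assms] cell_mass_eq[OF assms] cell_volume(2)
    by (simp add: ennreal_le_iff mass_bound_def)
  then show ?thesis using cell_volume(2) cell_density_nonneg[of A \<omega>] by simp
qed

abbreviation empirical :: "(real^'n \<Rightarrow> 'j) \<Rightarrow> nat \<Rightarrow> (real \<times> (real^'n)) measure" where
  "empirical \<omega> n \<equiv> distr (box_measure b n) borel (energy_velocity (H \<omega>))"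

text \<open>Moving cell k back to the fundamental cell replaces \<omega> by its translate, by
  \<open>energy_velocity_shift\<close>. The spatial sum over the box thus becomes a sum along the
  orbit of a single configuration.\<close>

lemma emeasure_empirical:
  assumes \<omega>: "\<omega> \<in> space \<beta>" and A: "A \<in> sets borel"
  shows "emeasure (empirical \<omega> n) A =
    (1 / (of_nat ((2 * n) ^ CARD('n)) * ennreal cell_volume)) * (\<Sum>k\<in>index_box UNIV n. cell_mass A (translate k \<omega>))"
proof -
  let ?B = "UNIV \<times> box_of b n :: ((real^'n) \<times> (real^'n)) set"
  have Beq: "?B = {x. cell_index b (snd x) \<in> index_box UNIV n \<and> x \<in> UNIV}"
    by (auto simp: box_of_eq[OF basis])
  have B: "?B \<in> sets borel" unfolding Beq by (rule cells_borel[OF basis]) simp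
  have m: "energy_velocity (H \<omega>) \<in> measurable (box_measure b n) borel"
    unfolding box_measure_def using energy_velocity_borel[OF \<omega>]
    by (simp add: measurable_cong_sets[OF sets_scale_measure refl] measurable_restrict_space1)
  have sp: "space (box_measure b n) = ?B"
    by (simp add: box_measure_def space_scale_measure space_restrict_space)
  have "emeasure (empirical \<omega> n) A = emeasure (box_measure b n) (energy_velocity (H \<omega>) -` A \<inter> ?B)"
    by (simp add: emeasure_distr[OF m A] sp)
  also have "\<dots> = 1 / emeasure lborel (box_of b n) * emeasure lborel (energy_velocity (H \<omega>) -` A \<inter> ?B)"
    unfolding box_measure_def using B by (simp add: emeasure_restrict_space)
  also have "energy_velocity (H \<omega>) -` A \<inter> ?B
      = {x. cell_index b (snd x) \<in> index_box UNIV n \<and> x \<in> energy_velocity (H \<omega>) -` A}"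
    unfolding Beq by auto
  also have "emeasure lborel \<dots> = (\<Sum>k\<in>index_box UNIV n. cell_mass A (translate k \<omega>))"
    unfolding emeasure_cells[OF basis finite_index_box energy_velocity_vimage[OF \<omega> A]] cell_mass_def
  proof (intro sum.cong refl arg_cong[where f="emeasure lborel"] Collect_cong conj_cong)
    fix k and x :: "(real^'n) \<times> (real^'n)"
    show "x + (0, basis_comb b (real_vec k)) \<in> energy_velocity (H \<omega>) -` A
        \<longleftrightarrow> energy_velocity (H (translate k \<omega>)) x \<in> A"
      using energy_velocity_shift[OF space_configs[OF \<omega>] lattice_vec, of k "fst x" "snd x"]
      by (cases x) simp
  qed
  finally show ?thesis unfolding emeasure_box_of[OF basis] cell_volume(1) .
qed

lemma emeasure_empirical_bounded:
  assumes \<omega>: "\<omega> \<in> space \<beta>" and A: "A \<in> sets borel" "A \<subseteq> cball 0 R"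
  shows "emeasure (empirical \<omega> n) A = (if n = 0 then 0 else ennreal (act.box_avg UNIV n (cell_density A) \<omega>))"
proof (cases "n = 0")
  case True
  \<comment> \<open>The box of index 0 is empty; the prefactor 1 / 0 is infinite, and infinity times
    0 is 0.\<close>
  then have "index_box (UNIV :: 'n set) n = {}" by (auto simp: index_box_def)
  then show ?thesis using True by (simp add: emeasure_empirical[OF \<omega> A(1)])
next
  case False
  let ?c = "(2 * real n) ^ CARD('n)"
  have c: "0 < ?c" using False by simp
  have "(\<Sum>k\<in>index_box UNIV n. cell_mass A (translate k \<omega>))
      = ennreal (\<Sum>k\<in>index_box UNIV n. cell_density A (translate k \<omega>) * cell_volume)"
  proof -
    have "(\<Sum>k\<in>index_box UNIV n. cell_mass A (translate k \<omega>))
        = (\<Sum>k\<in>index_box UNIV n. ennreal (cell_density A (translate k \<omega>) * cell_volume))"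
      by (intro sum.cong refl cell_mass_eq[OF act.act_space[OF \<omega>] A(2)])
    also have "\<dots> = ennreal (\<Sum>k\<in>index_box UNIV n. cell_density A (translate k \<omega>) * cell_volume)"
      using cell_volume(2) cell_density_nonneg by (intro sum_ennreal) simp
    finally show ?thesis .
  qed
  also have "\<dots> = ennreal ((\<Sum>k\<in>index_box UNIV n. cell_density A (translate k \<omega>)) * cell_volume)"
    by (simp add: sum_distrib_right)
  finally have s: "(\<Sum>k\<in>index_box UNIV n. cell_mass A (translate k \<omega>))
      = ennreal ((\<Sum>k\<in>index_box UNIV n. cell_density A (translate k \<omega>)) * cell_volume)" .
  have "(of_nat ((2 * n) ^ CARD('n)) :: ennreal) = ennreal ?c"
    by (simp add: ennreal_of_nat_eq_real_of_nat)
  then have "1 / (of_nat ((2 * n) ^ CARD('n)) * ennreal cell_volume) = ennreal (1 / (?c * cell_volume))"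
    using c cell_volume(2) by (simp add: ennreal_mult[symmetric] divide_ennreal ennreal_1[symmetric] del: ennreal_1)
  then have "emeasure (empirical \<omega> n) A
      = ennreal (1 / (?c * cell_volume) * ((\<Sum>k\<in>index_box UNIV n. cell_density A (translate k \<omega>)) * cell_volume))"
    unfolding emeasure_empirical[OF \<omega> A(1)] s
    using c cell_volume(2) cell_density_nonneg by (simp add: ennreal_mult[symmetric] sum_nonneg)
  also have "1 / (?c * cell_volume) * ((\<Sum>k\<in>index_box UNIV n. cell_density A (translate k \<omega>)) * cell_volume)
      = act.box_avg UNIV n (cell_density A) \<omega>"
    using cell_volume(2) by (simp add: act.box_avg_def)
  finally show ?thesis using False by simp
qed

lemma box_avg_density_nonneg: "0 \<le> act.box_avg S n (cell_density A) \<omega>"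
  unfolding act.box_avg_def by (intro divide_nonneg_nonneg sum_nonneg cell_density_nonneg) simp

lemma empirical_locally_finite:
  assumes "\<omega> \<in> space \<beta>" shows "locally_finite_borel (empirical \<omega> n)"
  unfolding locally_finite_borel_def
proof (intro conjI allI impI)
  fix K :: "(real \<times> (real^'n)) set" assume K: "compact K"
  obtain R where "\<forall>x\<in>K. norm x \<le> R" using compact_imp_bounded[OF K] unfolding bounded_iff by blast
  then have "K \<subseteq> cball 0 R" by auto
  with K show "emeasure (empirical \<omega> n) K < \<infinity>"
    using emeasure_empirical_bounded[OF assms, of K R n] by (simp add: borel_compact)
qed simp

text \<open>Momenta range over the whole space, so the total mass is infinite; local finiteness
  rests on the momentum bound for bounded energies.\<close>

definition limit_measure :: "(real \<times> (real^'n)) measure" where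
  "limit_measure = distr (scale_measure (ennreal (1 / cell_volume))
     (restrict_space (\<beta> \<Otimes>\<^sub>M lborel) {z. cell_index b (snd (snd z)) = 0}))
     borel (\<lambda>z. energy_velocity (H (fst z)) (snd z))"

lemma emeasure_limit_measure:
  assumes A: "A \<in> sets borel" "A \<subseteq> cball 0 R"
  shows "emeasure limit_measure A = ennreal (\<integral>\<omega>. cell_density A \<omega> \<partial>\<beta>)"
proof -
  let ?M = "\<beta> \<Otimes>\<^sub>M (lborel :: ((real^'n) \<times> (real^'n)) measure)"
  let ?E = "\<lambda>z. energy_velocity (H (fst z)) (snd z)"
  let ?D = "{z. cell_index b (snd (snd z)) = 0} :: ((real^'n \<Rightarrow> 'j) \<times> (real^'n) \<times> (real^'n)) set"
  let ?Q = "{z \<in> space ?M. cell_index b (snd (snd z)) = 0 \<and> ?E z \<in> A}"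
  have s: "sets ?M = sets (config_borel b J \<Otimes>\<^sub>M borel)"
    by (intro sets_pair_measure_cong sets_eq) simp
  have Em: "?E \<in> borel_measurable ?M"
    using energy_velocity_measurable by (simp add: case_prod_beta' measurable_cong_sets[OF s refl])
  have D: "?D \<inter> space ?M \<in> sets ?M"
    using cells_pair_measurable[of UNIV] by (simp add: Int_def conj_commute)
  have "emeasure limit_measure A = ennreal (1 / cell_volume) * emeasure (restrict_space ?M ?D) (?E -` A \<inter> (?D \<inter> space ?M))"
    unfolding limit_measure_def
    by (subst emeasure_distr)
      (use Em A in \<open>auto simp: measurable_cong_sets[OF sets_scale_measure refl] space_scale_measure
        space_restrict_space2 space_restrict_space intro!: measurable_restrict_space1\<close>)
  also have "emeasure (restrict_space ?M ?D) (?E -` A \<inter> (?D \<inter> space ?M)) = emeasure ?M (?E -` A \<inter> (?D \<inter> space ?M))"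
    by (rule emeasure_restrict_space[OF D]) auto
  also have "?E -` A \<inter> (?D \<inter> space ?M) = ?Q" by auto
  also have "emeasure ?M ?Q = (\<integral>\<^sup>+\<omega>. emeasure lborel (Pair \<omega> -` ?Q) \<partial>\<beta>)"
    by (rule lborel.emeasure_pair_measure_alt[OF cells_pair_measurable[OF A(1)]])
  also have "\<dots> = (\<integral>\<^sup>+\<omega>. ennreal (cell_density A \<omega> * cell_volume) \<partial>\<beta>)"
  proof (rule nn_integral_cong)
    fix \<omega> assume \<omega>: "\<omega> \<in> space \<beta>"
    have "emeasure lborel (Pair \<omega> -` ?Q) = cell_mass A \<omega>"
      unfolding cell_mass_def
      by (rule arg_cong[where f="emeasure lborel"]) (use \<omega> in \<open>auto simp: space_pair_measure\<close>)
    then show "emeasure lborel (Pair \<omega> -` ?Q) = ennreal (cell_density A \<omega> * cell_volume)"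
      using cell_mass_eq[OF \<omega> A(2)] by simp
  qed
  also have "\<dots> = ennreal (\<integral>\<omega>. cell_density A \<omega> * cell_volume \<partial>\<beta>)"
  proof (rule nn_integral_eq_integral)
    have "integrable \<beta> (cell_density A)"
      by (rule integrable_bounded[OF cell_density_measurable[OF A(1)] cell_density_bound[OF _ A(2)]])
    then show "integrable \<beta> (\<lambda>\<omega>. cell_density A \<omega> * cell_volume)" by simp
  qed (use cell_density_nonneg cell_volume(2) in simp)
  also have "ennreal (1 / cell_volume) * \<dots> = ennreal (1 / cell_volume * (\<integral>\<omega>. cell_density A \<omega> * cell_volume \<partial>\<beta>))"
    using cell_volume(2) cell_density_nonneg by (intro ennreal_mult[symmetric]) auto
  also have "1 / cell_volume * (\<integral>\<omega>. cell_density A \<omega> * cell_volume \<partial>\<beta>) = (\<integral>\<omega>. cell_density A \<omega> \<partial>\<beta>)"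
    using cell_volume(2) by simp
  finally show ?thesis .
qed

lemma limit_measure_locally_finite: "locally_finite_borel limit_measure"
  unfolding locally_finite_borel_def
proof (intro conjI allI impI)
  fix K :: "(real \<times> (real^'n)) set" assume K: "compact K"
  obtain R where "\<forall>x\<in>K. norm x \<le> R" using compact_imp_bounded[OF K] unfolding bounded_iff by blast
  then have "K \<subseteq> cball 0 R" by auto
  with K show "emeasure limit_measure K < \<infinity>"
    using emeasure_limit_measure[of K R] by (simp add: borel_compact)
qed (simp add: limit_measure_def)

lemma empirical_measure_tendsto:
  assumes A: "A \<in> sets borel" "A \<subseteq> cball 0 R"
  shows "AE \<omega> in \<beta>. (\<lambda>n. measure (empirical \<omega> n) A) \<longlonglongrightarrow> measure limit_measure A"
proof -
  have lim: "measure limit_measure A = (\<integral>\<omega>. cell_density A \<omega> \<partial>\<beta>)"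
    using emeasure_limit_measure[OF A] cell_density_nonneg by (simp add: measure_def)
  have "AE \<omega> in \<beta>. (\<lambda>n. act.box_avg UNIV n (cell_density A) \<omega>) \<longlonglongrightarrow> (\<integral>\<omega>. cell_density A \<omega> \<partial>\<beta>)"
  proof (rule act.box_avg_tendsto_integral[OF cell_density_measurable[OF A(1)] cell_density_bound[OF _ A(2)]])
    fix S assume S: "S \<in> sets \<beta>" "\<And>k. translate k -` S \<inter> space \<beta> = S"
    \<comment> \<open>Every lattice vector is an integer combination of the basis, so invariance
      under all \<open>translate k\<close> is invariance under all lattice shifts.\<close>
    have "\<forall>l\<in>lattice_of b. shift b l -` S \<inter> space \<beta> = S"
      unfolding lattice_of_eq using S(2) by auto
    then have "emeasure \<beta> S = 0 \<or> emeasure \<beta> S = 1"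
      using ergodic S(1) by (simp add: shift_ergodic_def)
    then show "prob S = 0 \<or> prob S = 1" by (auto simp: measure_def)
  qed
  then show ?thesis using AE_space
  proof eventually_elim
    case (elim \<omega>)
    show ?case unfolding lim
    proof (rule Lim_transform_eventually[OF elim(1)])
      show "\<forall>\<^sub>F n in sequentially. act.box_avg UNIV n (cell_density A) \<omega> = measure (empirical \<omega> n) A"
        using eventually_gt_at_top[of 0]
        by eventually_elim
          (simp add: measure_def emeasure_empirical_bounded[OF elim(2) A] box_avg_density_nonneg)
    qed
  qed
qed

theorem empirical_vague_limit: "AE \<omega> in \<beta>. vague_limit (empirical \<omega>) limit_measure"
proof -
  have cell: "grid_point k -` {y} \<in> sets borel \<and> grid_point k -` {y} \<subseteq> cball 0 (norm y + DIM(real \<times> (real^'n)))"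
    for k and y :: "real \<times> (real^'n)"
  proof
    show "grid_point k -` {y} \<in> sets borel"
      using measurable_sets[OF grid_point_measurable, of "{y}" k] by simp
    show "grid_point k -` {y} \<subseteq> cball 0 (norm y + DIM(real \<times> (real^'n)))"
      by (rule grid_point_vimage_subset)
  qed
  \<comment> \<open>Countably many scales and grid points merge all exceptional null sets into
    one.\<close>
  have "AE \<omega> in \<beta>. \<forall>k. \<forall>y\<in>range (grid_point k).
      (\<lambda>n. measure (empirical \<omega> n) (grid_point k -` {y})) \<longlonglongrightarrow> measure limit_measure (grid_point k -` {y})"
    unfolding AE_all_countable AE_ball_countable[OF countable_range_grid_point]
    by (intro allI ballI empirical_measure_tendsto[OF cell[THEN conjunct1] cell[THEN conjunct2]])
  then show ?thesis using AE_space
  proof eventually_elim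
    case (elim \<omega>)
    show ?case
    proof (rule vague_limit_gridI)
      fix R
      have "measure (empirical \<omega> n) (cball 0 R) \<le> mass_bound R" for n
      proof -
        have "\<bar>act.box_avg UNIV n (cell_density (cball 0 R)) \<omega>\<bar> \<le> mass_bound R"
          by (rule act.box_avg_bounded[OF cell_density_bound[OF _ order_refl] elim(2)])
        moreover have "emeasure (empirical \<omega> n) (cball 0 R)
            = (if n = 0 then 0 else ennreal (act.box_avg UNIV n (cell_density (cball 0 R)) \<omega>))"
          by (rule emeasure_empirical_bounded[OF elim(2) _ order_refl]) simp
        ultimately show ?thesis
          using box_avg_density_nonneg[of UNIV n "cball 0 R" \<omega>] by (simp add: measure_def mass_bound_def)
      qed
      then show "\<exists>C. \<forall>n. measure (empirical \<omega> n) (cball 0 R) \<le> C" by blast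
    qed (use elim empirical_locally_finite limit_measure_locally_finite in auto)
  qed
qed

end

section \<open>Multi-indices of order at most two\<close>

lemma count_list_single:
  assumes "\<And>k. count_list ks k = (if k = i then 1 else 0)"
  shows "ks = [i]"
proof (cases ks)
  case Nil
  then show ?thesis using assms[of i] by simp
next
  case (Cons a ks')
  then have a: "a = i" using assms[of a] by (simp split: if_splits)
  have "count_list ks' k = 0" for k
    using assms[of k] Cons a by (simp split: if_splits)
  then have "k \<notin> set ks'" for k by (metis count_list_0_iff)
  then have "ks' = []" by (metis list.set_intros(1) neq_Nil_conv)
  then show ?thesis using Cons a by simp
qed

text \<open>This pins down the lists that the choice in \<open>mi_partial\<close> may return for a
  second-order multi-index; adding the two indicator terms also covers i = k.\<close>

lemma count_list_pair:
  assumes "\<And>j. count_list js j = (if j = i then 1 else 0) + (if j = k then 1 else 0)"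
  shows "js = [i, k] \<or> js = [k, i]"
proof (cases js)
  case Nil
  then show ?thesis using assms[of i] by simp
next
  case (Cons a js')
  then have "a = i \<or> a = k" using assms[of a] by (simp split: if_splits)
  then show ?thesis
  proof
    assume a: "a = i"
    have "js' = [k]"
      by (rule count_list_single) (use assms Cons a in \<open>force split: if_splits\<close>)
    then show ?thesis using Cons a by simp
  next
    assume a: "a = k"
    have "js' = [i]"
      by (rule count_list_single) (use assms Cons a in \<open>force split: if_splits\<close>)
    then show ?thesis using Cons a by simp
  qed
qed

definition unit_index :: "'n \<Rightarrow> 'n \<Rightarrow> nat" where
  "unit_index i = (\<lambda>j. if j = i then 1 else 0)"

lemma mi_partial_zero:
  fixes f :: "real^'n::finite \<Rightarrow> real"
  shows "mi_partial (\<lambda>_. 0) f = f"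
proof -
  have "(SOME is. \<forall>i. count_list is i = 0) = ([] :: 'n list)"
  proof (rule some_equality)
    fix js :: "'n list" assume "\<forall>i. count_list js i = 0"
    then have "set js = {}" by (auto simp: count_list_0_iff)
    then show "js = []" by simp
  qed simp
  then show ?thesis by (simp add: mi_partial_def iter_partial_def)
qed

lemma mi_partial_unit: "mi_partial (unit_index i) f = partial_deriv i f"
proof -
  have "(SOME is. \<forall>k. count_list is k = unit_index i k) = [i]"
    by (rule some_equality) (auto simp: unit_index_def intro!: count_list_single)
  then show ?thesis by (simp add: mi_partial_def iter_partial_def)
qed

text \<open>Which order the choice operator picks is unknown, but it depends on the multi-index
  alone; stating equality of operators gives the same order for all functions.\<close>

lemma mi_partial_unit2:
  "mi_partial (\<lambda>j. unit_index i j + unit_index k j) = (\<lambda>f. partial_deriv i (partial_deriv k f)) \<or>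
   mi_partial (\<lambda>j. unit_index i j + unit_index k j) = (\<lambda>f. partial_deriv k (partial_deriv i f))"
proof -
  define js where "js = (SOME is. \<forall>j. count_list is j = unit_index i j + unit_index k j)"
  have "\<exists>is. \<forall>j. count_list is j = unit_index i j + unit_index k j"
    by (rule exI[of _ "[i, k]"]) (auto simp: unit_index_def)
  then have "\<forall>j. count_list js j = unit_index i j + unit_index k j"
    unfolding js_def by (rule someI_ex)
  then have "js = [i, k] \<or> js = [k, i]"
    by (intro count_list_pair) (simp add: unit_index_def)
  moreover have "mi_partial (\<lambda>j. unit_index i j + unit_index k j) = iter_partial js"
    by (simp add: mi_partial_def js_def fun_eq_iff)
  ultimately show ?thesis by (auto simp: iter_partial_def fun_eq_iff)
qed

lemma mi_order_unit: "mi_order (unit_index i) = 1"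
  by (simp add: mi_order_def unit_index_def)

theorem proposition3p1:
  fixes b :: "'n::finite \<Rightarrow> real^'n"
    and J :: "'j set"
    and \<eta> :: enat
    and W :: "'j \<Rightarrow> real^'n \<Rightarrow> real"
    and \<epsilon> :: real
    and C :: "('n \<Rightarrow> nat) \<Rightarrow> real"
    and \<beta> :: "(real^'n \<Rightarrow> 'j) measure"
  assumes "is_lattice_basis b"
    and "finite J" and "card J \<ge> 2"
    and "\<eta> \<ge> 2"
    and "\<forall>j\<in>J. C_diff \<eta> (W j)"
    and "\<epsilon> > 0"
    and "\<forall>\<alpha>. enat (mi_order \<alpha>) \<le> \<eta> \<longrightarrow> C \<alpha> > 0"
    and "\<forall>j\<in>J. \<forall>\<alpha> q. enat (mi_order \<alpha>) \<le> \<eta> \<longrightarrow>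
           \<bar>mi_partial \<alpha> (W j) q\<bar> \<le> C \<alpha> * (1 + (norm q)\<^sup>2) powr (- (real CARD('n) + \<epsilon>) / 2)"
    and "prob_space \<beta>"
    and "sets \<beta> = sets (config_borel b J)"
    and "shift_invariant b \<beta>"
    and "shift_ergodic b \<beta>"
  shows "\<exists>\<nu> :: (real \<times> (real^'n)) measure. AE \<omega> in \<beta>.
           vague_limit (\<lambda>n. distr (box_measure b n) borel (energy_velocity (hamiltonian b W \<omega>))) \<nu>"
proof -
  have le: "enat k \<le> \<eta>" if "k \<le> 2" for k
  proof -
    have "enat k \<le> 2" using that by (simp add: numeral_eq_enat)
    then show ?thesis using assms(4) by (rule order_trans)
  qed
  \<comment> \<open>All these constants are positive, so their sum over the multi-indices of order
    at most two dominates each of them; mixed second-order indices are counted twice.\<close>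
  define C' where "C' = C (\<lambda>_. 0) + (\<Sum>i\<in>UNIV. C (unit_index i))
    + (\<Sum>i\<in>UNIV. \<Sum>k\<in>UNIV. C (\<lambda>j. unit_index i j + unit_index k j))"
  have o0: "mi_order (\<lambda>_ :: 'n. 0) = 0" by (simp add: mi_order_def)
  have o2: "mi_order (\<lambda>j. unit_index i j + unit_index k j) = 2" for i k :: 'n
    using mi_order_unit[of i] mi_order_unit[of k] by (simp add: mi_order_def sum.distrib)
  have pos: "0 < C (\<lambda>_. 0)" "0 < C (unit_index i)" "0 < C (\<lambda>j. unit_index i j + unit_index k j)" for i k
    using assms(7) le by (simp_all add: o0 o2 mi_order_unit)
  have s1: "0 \<le> (\<Sum>i\<in>UNIV. C (unit_index i))"
    and s2: "0 \<le> (\<Sum>k\<in>UNIV. C (\<lambda>j. unit_index i j + unit_index k j))"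
    and s3: "0 \<le> (\<Sum>i\<in>UNIV. \<Sum>k\<in>UNIV. C (\<lambda>j. unit_index i j + unit_index k j))" for i
    using pos by (intro sum_nonneg less_imp_le; simp)+
  have C': "C (\<lambda>_. 0) \<le> C'" "C (unit_index i) \<le> C'" "C (\<lambda>j. unit_index i j + unit_index k j) \<le> C'" for i k
  proof -
    have "C (unit_index i) \<le> (\<Sum>i\<in>UNIV. C (unit_index i))"
      by (rule member_le_sum) (use pos in \<open>auto intro: less_imp_le\<close>)
    moreover have "C (\<lambda>j. unit_index i j + unit_index k j) \<le> (\<Sum>k\<in>UNIV. C (\<lambda>j. unit_index i j + unit_index k j))"
      by (rule member_le_sum[of k UNIV "\<lambda>k. C (\<lambda>j. unit_index i j + unit_index k j)"])
        (use pos in \<open>auto intro: less_imp_le\<close>)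
    moreover have "(\<Sum>k\<in>UNIV. C (\<lambda>j. unit_index i j + unit_index k j))
        \<le> (\<Sum>i\<in>UNIV. \<Sum>k\<in>UNIV. C (\<lambda>j. unit_index i j + unit_index k j))"
      by (rule member_le_sum[of i UNIV "\<lambda>i. \<Sum>k\<in>UNIV. C (\<lambda>j. unit_index i j + unit_index k j)"])
        (use s2 in auto)
    ultimately show "C (\<lambda>_. 0) \<le> C'" "C (unit_index i) \<le> C'" "C (\<lambda>j. unit_index i j + unit_index k j) \<le> C'"
      using s1 s3 pos(1) unfolding C'_def by linarith+
  qed
  have bound: "\<bar>mi_partial \<alpha> (W j) x\<bar> \<le> C' * decay \<epsilon> x"
    if "j \<in> J" "mi_order \<alpha> \<le> 2" "C \<alpha> \<le> C'" for j \<alpha> x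
  proof -
    have "\<bar>mi_partial \<alpha> (W j) x\<bar> \<le> C \<alpha> * decay \<epsilon> x"
      using assms(8) that(1) le[OF that(2)] by (simp add: decay_def)
    also have "\<dots> \<le> C' * decay \<epsilon> x" using that(3) by (rule mult_right_mono) simp
    finally show ?thesis .
  qed
  have cd: "C_diff \<eta> (W j)" if "j \<in> J" for j using assms(5) that by blast
  have cont: "continuous_on UNIV (iter_partial js (W j))" if "j \<in> J" "length js \<le> 2" for j js
    using cd[OF that(1)] le[OF that(2)] by (simp add: C_diff_def)
  have part: "has_partial i (iter_partial js (W j)) x" if "j \<in> J" "length js \<le> 1" for i j js x
    using cd[OF that(1)] le[of "Suc (length js)"] that(2) by (simp add: C_diff_def)
  interpret random_lattice_potential b J W \<epsilon> C' \<beta>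
  proof (intro random_lattice_potential.intro lattice_potential.intro random_lattice_potential_axioms.intro assms)
    show "0 \<le> C'" using C'(1) pos(1) by linarith
    fix j x i k assume j: "j \<in> J"
    show "continuous_on UNIV (W j)" using cont[OF j, of "[]"] by (simp add: iter_partial_def)
    show "continuous_on UNIV (partial_deriv i (W j))" using cont[OF j, of "[i]"] by (simp add: iter_partial_def)
    show "has_partial i (W j) x" using part[OF j, of "[]"] by (simp add: iter_partial_def)
    show "has_partial i (partial_deriv k (W j)) x" using part[OF j, of "[k]"] by (simp add: iter_partial_def)
    show "\<bar>W j x\<bar> \<le> C' * decay \<epsilon> x"
      using bound[OF j, of "\<lambda>_. 0"] C'(1) by (simp add: mi_partial_zero o0)
    show "\<bar>partial_deriv i (W j) x\<bar> \<le> C' * decay \<epsilon> x"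
      using bound[OF j, of "unit_index i"] C'(2) by (simp add: mi_partial_unit mi_order_unit)
  next
    fix i k
    show "(\<forall>j\<in>J. \<forall>x. \<bar>partial_deriv i (partial_deriv k (W j)) x\<bar> \<le> C' * decay \<epsilon> x) \<or>
      (\<forall>j\<in>J. \<forall>x. \<bar>partial_deriv k (partial_deriv i (W j)) x\<bar> \<le> C' * decay \<epsilon> x)"
      using mi_partial_unit2[of i k]
    proof
      assume "mi_partial (\<lambda>j. unit_index i j + unit_index k j) = (\<lambda>f. partial_deriv i (partial_deriv k f))"
      from bound[OF _ _ C'(3)[of i k], unfolded this o2] show ?thesis by simp
    next
      assume "mi_partial (\<lambda>j. unit_index i j + unit_index k j) = (\<lambda>f. partial_deriv k (partial_deriv i f))"
      from bound[OF _ _ C'(3)[of i k], unfolded this o2] show ?thesis by simp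
    qed
  qed
  show ?thesis using empirical_vague_limit by blast
qed

end
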